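(* Let $d\ge 1$, let $\mu\in\mathbb{R}^d$, let $\Sigma$ be a symmetric positive semi-definite real $d\times d$ matrix, and let $X\sim N(\mu,\Sigma)$ be a Gaussian random vector in $\mathbb{R}^d$ with mean $\mu$ and covariance matrix $\Sigma$. Let $f:\mathbb{R}^d\to\mathbb{R}$ be a Lipschitz function with respect to the Euclidean distance. Then for every $x>0$, $$\mathbb{P}\big(f(X)-\mathbb{E}f(X)\ge x\big)\le \exp\left(-\frac{x^2}{2\,\|\Sigma^{1/2}\nabla f\|_\infty^2}\right),$$ where $$\|\Sigma^{1/2}\nabla f\|_\infty^2:=\sup_{y\in\mathbb{R}^d}\|\Sigma^{1/2}\nabla f(y)\|^2=\sup_{y\in\mathbb{R}^d}\langle\nabla f(y),\Sigma\nabla f(y)\rangle.$$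
   Context: $\|\cdot\|$ is the Euclidean norm, $\langle\cdot,\cdot\rangle$ the Euclidean inner product on $\mathbb{R}^d$, $\Sigma^{1/2}$ the positive semi-definite square root of $\Sigma$, and $\nabla$ the gradient. A Lipschitz function $f$ is differentiable Lebesgue-almost everywhere (Rademacher's theorem); the supremum defining $\|\Sigma^{1/2}\nabla f\|_\infty^2$ is taken over the points $y\in\mathbb{R}^d$ at which $f$ is differentiable. If $\|\Sigma^{1/2}\nabla f\|_\infty=0$, the right-hand side of the inequality is read as $0$. The matrix $\Sigma$ is allowed to be singular. *)

theory Defs
  imports "HOL-Probability.Probability"
begin

definition pos_semidef :: "real^'n^'n \<Rightarrow> bool" where
  "pos_semidef A \<longleftrightarrow> transpose A = A \<and> (\<forall>u. 0 \<le> u \<bullet> (A *v u))"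

definition psd_sqrt :: "real^'n^'n \<Rightarrow> real^'n^'n" where
  "psd_sqrt A = (THE B. pos_semidef B \<and> B ** B = A)"

text \<open>One-dimensional normal law with mean \<open>m\<close> and variance \<open>v\<close>. The library density
  is parametrised by the standard deviation and needs \<open>v > 0\<close>; variance zero is
  the Dirac mass.\<close>

definition normal_law :: "real \<Rightarrow> real \<Rightarrow> real measure" where
  "normal_law m v =
    (if v = 0 then return borel m else density lborel (\<lambda>x. ennreal (normal_density m (sqrt v) x)))"

text \<open>A random vector is Gaussian when each of its linear functionals is normal, possibly
  degenerate; this includes laws with singular covariance, which have no Lebesgue density.\<close>

definition gaussian_vector :: "'a measure \<Rightarrow> ('a \<Rightarrow> real^'n) \<Rightarrow> bool" where
  "gaussian_vector M X \<longleftrightarrow>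
    X \<in> borel_measurable M \<and>
    (\<forall>u. \<exists>m v. 0 \<le> v \<and> distr M borel (\<lambda>\<omega>. u \<bullet> X \<omega>) = normal_law m v)"

definition covariance_matrix :: "'a measure \<Rightarrow> ('a \<Rightarrow> real^'n) \<Rightarrow> real^'n^'n" where
  "covariance_matrix M X =
    (\<chi> i j. \<integral>\<omega>. (X \<omega> $ i - (\<integral>\<omega>'. X \<omega>' $ i \<partial>M)) * (X \<omega> $ j - (\<integral>\<omega>'. X \<omega>' $ j \<partial>M)) \<partial>M)"

definition has_normal_law :: "'a measure \<Rightarrow> ('a \<Rightarrow> real^'n) \<Rightarrow> real^'n \<Rightarrow> real^'n^'n \<Rightarrow> bool" where
  "has_normal_law M X \<mu> \<Sigma> \<longleftrightarrow>
    gaussian_vector M X \<and> (\<integral>\<omega>. X \<omega> \<partial>M) = \<mu> \<and> covariance_matrix M X = \<Sigma>"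

definition gradient :: "(real^'n \<Rightarrow> real) \<Rightarrow> real^'n \<Rightarrow> real^'n" where
  "gradient f y = (THE g. GDERIV f y :> g)"

text \<open>A real-valued supremum; it is meaningful for Lipschitz \<open>f\<close>, where the set of
  differentiability points is nonempty (Rademacher) and gradients are bounded.\<close>

definition sup_sqrt_gradient_sq :: "real^'n^'n \<Rightarrow> (real^'n \<Rightarrow> real) \<Rightarrow> real" where
  "sup_sqrt_gradient_sq \<Sigma> f =
    (SUP y\<in>{y. f differentiable (at y)}. (norm (psd_sqrt \<Sigma> *v gradient f y))\<^sup>2)"

end

(*
  X has the law of mu + S Z, where S is the square root of Sigma and Z is standard Gaussian, so it
  suffices to control h z = f (mu + S z). By Rademacher's theorem and an averaging argument over
  boxes, the increments of f in a direction S w are at most sup |S grad f| |w|: h is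
  sigma-Lipschitz for sigma^2 = sup |S grad f|^2, even if the range of S is a null set.

  For sigma-Lipschitz h the bound E exp (h Z) <= exp (E h Z + sigma^2 / 2) comes from the heat
  semigroup P: for smoothed h, one step of length s costs P_s (exp h) <= (1 + s sigma^2 / 2 +
  O (s^(3/2))) exp (P_s h), and n steps of length 1/n give the factor exp (sigma^2 / 2) as n tends to
  infinity. Chernoff's inequality then yields the tail bound.
*)
theory Submission
  imports Defs
begin

section \<open>Square roots of positive semidefinite matrices\<close>

text \<open>The supremum sees only points where \<open>f\<close> is differentiable. For singular
  \<open>\<Sigma>\<close> the set of all \<open>\<mu> + S z\<close> may miss every such point, so no
  chain rule for \<open>h\<close> is available. An increment of \<open>f\<close> that is too large
  at one point is, by continuity, too large on an open box, and there almost every point counts.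

  Smoothing serves to remove the dimension. The Lipschitz bound alone controls the variance of
  \<open>h (x + sqrt s Z)\<close> only by \<open>s \<sigma>\<^sup>2\<close> times the second moment
  of \<open>norm Z\<close>, which is the dimension; the linear part of \<open>h\<close> contributes
  just \<open>s (norm g)\<^sup>2\<close>. Linearising requires a second-order remainder, and since
  later steps act on \<open>heat\<close> evolutions of \<open>h\<close> and not on \<open>h\<close>,
  its constant must hold for all \<open>\<sigma>\<close>-Lipschitz functions at once. Gaussian
  smoothing of a fixed variance \<open>\<epsilon>\<close> provides this. The constant may blow up as
  \<open>\<epsilon>\<close> decreases, so \<open>n\<close> tends to infinity first and
  \<open>\<epsilon>\<close> to zero afterwards.

  A singular Gaussian law has no density, so the law of \<open>X\<close> is identified by
  characteristic functions, whose uniqueness in every dimension is itself derived by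
  smoothing.\<close>

lemma selfadjoint_eigenvector:
  fixes A :: "'a::euclidean_space \<Rightarrow> 'a"
  assumes lin: "linear A" and sa: "\<And>x y. A x \<bullet> y = x \<bullet> A y"
    and V: "subspace V" "V \<noteq> {0}" "A ` V \<subseteq> V"
  obtains v l where "v \<in> V" "norm v = 1" "A v = l *\<^sub>R v"
proof -
  let ?S = "V \<inter> sphere 0 1"
  have "compact ?S"
    by (metis V(1) closed_Int_compact closed_subspace compact_sphere)
  moreover obtain u where u: "u \<in> V" "u \<noteq> 0" using V subspace_0 by blast
  then have "(1 / norm u) *\<^sub>R u \<in> ?S" using V by (simp add: subspace_scale)
  then have "?S \<noteq> {}" by blast
  moreover have "continuous_on ?S (\<lambda>x. x \<bullet> A x)"
    by (intro continuous_intros linear_continuous_on) (simp add: lin linear_conv_bounded_linear[symmetric])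
  ultimately obtain v where v: "v \<in> ?S" and max: "\<And>y. y \<in> ?S \<Longrightarrow> y \<bullet> A y \<le> v \<bullet> A v"
    using continuous_attains_sup[of ?S "\<lambda>x. x \<bullet> A x"] by blast
  \<comment> \<open>The maximum of the quadratic form on the unit sphere of \<open>V\<close> is the
    eigenvalue, and the maximiser \<open>v\<close> is the eigenvector.\<close>
  define l where "l = v \<bullet> A v"
  have vv: "v \<bullet> v = 1" "v \<in> V" using v by (auto simp: norm_eq_1)
  have le: "y \<bullet> A y \<le> l * (y \<bullet> y)" if "y \<in> V" for y
  proof (cases "y = 0")
    case True then show ?thesis using lin by simp
  next
    case False
    have "(1 / norm y) *\<^sub>R y \<in> ?S" using V that False by (simp add: subspace_scale)
    from max[OF this] have "(y \<bullet> A y) / (norm y)^2 \<le> l"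
      using lin by (simp add: l_def linear_cmul power2_eq_square)
    then show ?thesis using False by (simp add: field_simps power2_norm_eq_inner)
  qed
  \<comment> \<open>First-order optimality along \<open>v + t w\<close>: a term linear in
    \<open>t\<close> is dominated by one quadratic in \<open>t\<close> for every real
    \<open>t\<close>, so its coefficient vanishes.\<close>
  have orth: "w \<bullet> A v = 0" if w: "w \<in> V" "v \<bullet> w = 0" for w
  proof -
    let ?q = "l * (w \<bullet> w) - w \<bullet> A w"
    have q: "2 * t * (w \<bullet> A v) \<le> t^2 * ?q" for t
    proof -
      have "v + t *\<^sub>R w \<in> V" using V vv w by (simp add: subspace_add subspace_scale)
      from le[OF this] have "l + 2 * t * (w \<bullet> A v) + t^2 * (w \<bullet> A w) \<le> l * (1 + t^2 * (w \<bullet> w))"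
        using lin w sa[of v w] vv
        by (simp add: linear_add linear_cmul inner_simps l_def power2_eq_square inner_commute algebra_simps)
      then show ?thesis by (simp add: algebra_simps)
    qed
    show ?thesis
    proof (rule ccontr)
      define p where "p = w \<bullet> A v"
      assume "w \<bullet> A v \<noteq> 0"
      then have p: "p \<noteq> 0" by (simp add: p_def)
      \<comment> \<open>\<open>Q\<close> is positive and exceeds the quadratic coefficient, so
        \<open>t = p / Q\<close> would give \<open>2 * p^2 \<le> p^2\<close>.\<close>
      define Q where "Q = \<bar>?q\<bar> + 1"
      have Q: "Q > 0" "?q < Q" unfolding Q_def by linarith+
      have "2 * (p / Q) * p \<le> (p/Q)^2 * ?q" using q[of "p/Q"] by (simp add: p_def)
      also have "\<dots> \<le> (p/Q)^2 * Q" using Q by (intro mult_left_mono) auto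
      also have "\<dots> = p^2 / Q" using Q by (simp add: power2_eq_square)
      finally have "2 * p^2 \<le> p^2" using Q by (simp add: field_simps power2_eq_square)
      then show False using p by simp
    qed
  qed
  \<comment> \<open>The component of \<open>A v\<close> orthogonal to \<open>v\<close>. By
    \<open>orth\<close> it is orthogonal to \<open>A v\<close> as well, hence to itself.\<close>
  define w where "w = A v - l *\<^sub>R v"
  have wV: "w \<in> V" unfolding w_def using V vv by (auto intro!: subspace_diff subspace_scale)
  have vw: "v \<bullet> w = 0" by (simp add: w_def inner_diff_right vv l_def)
  have "w \<bullet> w = w \<bullet> A v - l * (w \<bullet> v)" unfolding w_def by (simp add: inner_diff_right)
  then have "w = 0" using orth[OF wV vw] vw by (simp add: inner_commute)
  then show ?thesis using that[of v l] v by (auto simp: w_def)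
qed

text \<open>Split off one eigenvector: self-adjointness makes its orthogonal complement inside
  \<open>V\<close> invariant, and the dimension drops. The formulation for invariant subspaces is
  what lets the induction run.\<close>

lemma selfadjoint_orthonormal_eigenbasis:
  fixes A :: "'a::euclidean_space \<Rightarrow> 'a"
  assumes lin: "linear A" and sa: "\<And>x y. A x \<bullet> y = x \<bullet> A y"
    and "subspace V" "A ` V \<subseteq> V"
  shows "\<exists>B. finite B \<and> pairwise orthogonal B \<and> span B = V \<and>
    (\<forall>v\<in>B. norm v = 1 \<and> (\<exists>l. A v = l *\<^sub>R v))"
  using assms(3,4)
proof (induction "dim V" arbitrary: V rule: less_induct)
  case less
  show ?case
  proof (cases "V = {0}")
    case True
    then show ?thesis by (intro exI[of _ "{}"]) auto
  next
    case False
    obtain v l where v: "v \<in> V" "norm v = 1" "A v = l *\<^sub>R v"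
      using selfadjoint_eigenvector[OF lin sa less.prems(1) False less.prems(2)] by blast
    have vv: "v \<bullet> v = 1" using v by (simp add: norm_eq_1)
    define W where "W = V \<inter> {w. v \<bullet> w = 0}"
    have W: "subspace W" unfolding W_def using less.prems by (intro subspace_inter subspace_hyperplane)
    have "A w \<in> W" if "w \<in> W" for w
      using that less.prems sa[of v w] v by (auto simp: W_def)
    then have AW: "A ` W \<subseteq> W" by blast
    have "v \<notin> W" using vv by (simp add: W_def)
    then have "W \<subset> V" using v W_def by blast
    then have "dim W < dim V" using dim_psubset[of W V] W less.prems span_eq_iff[of W] span_eq_iff[of V] by metis
    from less.hyps[OF this W AW] obtain B where B: "finite B" "pairwise orthogonal B" "span B = W"
      "\<And>v. v \<in> B \<Longrightarrow> norm v = 1 \<and> (\<exists>l. A v = l *\<^sub>R v)" by blast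
    have BW: "B \<subseteq> W" using B span_superset by blast
    show ?thesis
    proof (rule exI[of _ "insert v B"], intro conjI ballI)
      show "finite (insert v B)" using B by simp
      show "pairwise orthogonal (insert v B)"
        using B BW by (auto simp: pairwise_insert W_def orthogonal_def inner_commute)
      show "span (insert v B) = V"
      proof
        show "span (insert v B) \<subseteq> V"
          using less.prems v BW by (intro span_minimal) (auto simp: W_def)
        show "V \<subseteq> span (insert v B)"
        proof
          fix x assume x: "x \<in> V"
          have "x - (v \<bullet> x) *\<^sub>R v \<in> W"
            using x v less.prems vv by (auto simp: W_def inner_diff_right intro!: subspace_diff subspace_scale)
          then show "x \<in> span (insert v B)" unfolding span_insert using B by auto
        qed
      qed
      show "norm u = 1" "\<exists>l. A u = l *\<^sub>R u" if "u \<in> insert v B" for u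
        using B(4) v that by auto
    qed
  qed
qed

lemma pos_semidef_dot: "pos_semidef A \<Longrightarrow> (A *v x) \<bullet> y = x \<bullet> (A *v y)"
  by (metis dot_lmul_matrix pos_semidef_def vector_transpose_matrix)

lemma pos_semidef_nonneg: "pos_semidef A \<Longrightarrow> 0 \<le> x \<bullet> (A *v x)"
  by (simp add: pos_semidef_def)

lemma pos_semidef_eigenbasis:
  assumes "pos_semidef (A :: real^'n^'n)"
  obtains B where "finite B" "pairwise orthogonal B" "span B = UNIV"
    "\<And>v. v \<in> B \<Longrightarrow> norm v = 1 \<and> (\<exists>l\<ge>0. A *v v = l *\<^sub>R v)"
proof -
  obtain B where B: "finite B" "pairwise orthogonal B" "span B = UNIV"
    "\<And>v. v \<in> B \<Longrightarrow> norm v = 1 \<and> (\<exists>l. A *v v = l *\<^sub>R v)"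
    using selfadjoint_orthonormal_eigenbasis[of "(*v) A" UNIV] pos_semidef_dot[OF assms] by auto
  have "\<exists>l\<ge>0. A *v v = l *\<^sub>R v" if v: "v \<in> B" for v
  proof -
    obtain l where l: "A *v v = l *\<^sub>R v" using B(4)[OF v] by blast
    have "l = v \<bullet> (A *v v)" using l B(4)[OF v] by (simp add: norm_eq_1)
    then have "l \<ge> 0" using pos_semidef_nonneg[OF assms] by simp
    then show ?thesis using l by blast
  qed
  then show ?thesis using that B by blast
qed

text \<open>Scale each eigenvector by the root of its eigenvalue. The explicit sum makes
  \<open>S\<close> visibly linear and symmetric, and its square has to be compared with
  \<open>A\<close> only on the spanning set \<open>B\<close>.\<close>

lemma psd_sqrt_exists:
  assumes A: "pos_semidef (A :: real^'n^'n)"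
  shows "\<exists>S. pos_semidef S \<and> S ** S = A"
proof -
  obtain B where B: "finite B" "pairwise orthogonal B" "span B = UNIV"
    "\<And>v. v \<in> B \<Longrightarrow> norm v = 1 \<and> (\<exists>l\<ge>0. A *v v = l *\<^sub>R v)"
    using pos_semidef_eigenbasis[OF A] by metis
  then obtain l where l: "\<And>v. v \<in> B \<Longrightarrow> 0 \<le> l v" "\<And>v. v \<in> B \<Longrightarrow> A *v v = l v *\<^sub>R v" by metis
  define S where "S x = (\<Sum>v\<in>B. (sqrt (l v) * (v \<bullet> x)) *\<^sub>R v)" for x
  have S: "linear S" unfolding S_def
    by (rule linearI) (auto simp: inner_simps algebra_simps sum.distrib scaleR_sum_right)
  have Sv: "S u = sqrt (l u) *\<^sub>R u" if u: "u \<in> B" for u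
  proof -
    have "S u = (\<Sum>v\<in>B. if v = u then sqrt (l u) *\<^sub>R u else 0)" unfolding S_def
    proof (rule sum.cong)
      fix v assume v: "v \<in> B"
      show "(sqrt (l v) * (v \<bullet> u)) *\<^sub>R v = (if v = u then sqrt (l u) *\<^sub>R u else 0)"
        using B(2) B(4)[OF u] u v by (auto simp: pairwise_def orthogonal_def norm_eq_1)
    qed simp
    then show ?thesis using B(1) u by simp
  qed
  have sym: "S x \<bullet> y = x \<bullet> S y" for x y
    unfolding S_def by (simp add: inner_sum_left inner_sum_right inner_commute mult.commute mult.left_commute)
  have nn: "x \<bullet> S x \<ge> 0" for x
    unfolding S_def inner_sum_right
    by (intro sum_nonneg) (simp add: l inner_commute mult.assoc)
  have "matrix S ** matrix S = A"
  proof -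
    have SS: "linear (\<lambda>x. S (S x))" using linear_compose[OF S S] by (simp add: o_def)
    have "S (S v) = A *v v" if "v \<in> B" for v using that l by (simp add: Sv linear_cmul[OF S])
    then have "S (S x) = A *v x" for x
      using linear_eq_on_span[OF SS, of "(*v) A" B x] B(3) by simp
    then show ?thesis
      by (simp add: matrix_eq matrix_vector_mul_assoc[symmetric] matrix_works S)
  qed
  moreover have "pos_semidef (matrix S)"
    unfolding pos_semidef_def
  proof
    have "adjoint S = S" using sym by (metis adjoint_unique)
    then show "transpose (matrix S) = matrix S" using matrix_adjoint[OF S] by simp
  qed (simp add: matrix_works S nn)
  ultimately show ?thesis by blast
qed

text \<open>On an eigenvector \<open>v\<close> of \<open>B\<close> with eigenvalue \<open>l\<close>,
  the defect \<open>w = C v - l v\<close> satisfies \<open>C w = - l w\<close>. For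
  \<open>l > 0\<close> positivity of \<open>C\<close> forces \<open>w = 0\<close>; for
  \<open>l = 0\<close> the norm of \<open>C v\<close> vanishes directly. Uniqueness gives the
  \<open>THE\<close> in \<open>psd_sqrt\<close> its meaning.\<close>

lemma psd_sqrt_unique:
  assumes B: "pos_semidef (B :: real^'n^'n)" and C: "pos_semidef C" and eq: "B ** B = C ** C"
  shows "B = C"
proof -
  obtain E where E: "finite E" "pairwise orthogonal E" "span E = UNIV"
    "\<And>v. v \<in> E \<Longrightarrow> norm v = 1 \<and> (\<exists>l\<ge>0. B *v v = l *\<^sub>R v)"
    using pos_semidef_eigenbasis[OF B] by metis
  have ev: "B *v v = C *v v" if v: "v \<in> E" for v
  proof -
    obtain l where l: "l \<ge> 0" "B *v v = l *\<^sub>R v" using E(4)[OF v] by blast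
    have CC: "C *v (C *v v) = (l * l) *\<^sub>R v"
      using l arg_cong[OF eq, of "\<lambda>M. M *v v"]
      by (simp add: matrix_vector_mul_assoc[symmetric] matrix_vector_mult_scaleR)
    define w where "w = C *v v - l *\<^sub>R v"
    have Cw: "C *v w = - l *\<^sub>R w"
      by (simp add: w_def CC matrix_vector_mult_scaleR matrix_vector_mult_diff_distrib algebra_simps)
    have "w = 0"
    proof (cases "l = 0")
      case True
      then have "(C *v v) \<bullet> (C *v v) = 0" using CC pos_semidef_dot[OF C, of v "C *v v"] by simp
      then show ?thesis using True by (simp add: w_def)
    next
      case False
      have "0 \<le> - l * (w \<bullet> w)" using pos_semidef_nonneg[OF C, of w] by (simp add: Cw)
      then have "w \<bullet> w \<le> 0" using False l by (simp add: mult_le_0_iff)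
      then show ?thesis using inner_ge_zero[of w] by (simp add: order_antisym)
    qed
    then show ?thesis using l by (simp add: w_def)
  qed
  have "B *v x = C *v x" for x
    using linear_eq_on_span[of "(*v) B" "(*v) C" E x] E(3) ev by simp
  then show ?thesis by (simp add: matrix_eq)
qed

lemma psd_sqrt:
  assumes "pos_semidef A"
  shows "pos_semidef (psd_sqrt A)" "psd_sqrt A ** psd_sqrt A = A"
proof -
  have "\<exists>!S. pos_semidef S \<and> S ** S = A"
    using psd_sqrt_exists[OF assms] psd_sqrt_unique by metis
  from theI'[OF this] show "pos_semidef (psd_sqrt A)" "psd_sqrt A ** psd_sqrt A = A"
    unfolding psd_sqrt_def by auto
qed

text \<open>Used twice: it equates the two forms of the supremum, and it shows that
  \<open>\<mu> + S Z\<close> has the variances prescribed by \<open>\<Sigma>\<close>.\<close>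

lemma norm_psd_sqrt_mult:
  assumes "pos_semidef A"
  shows "(norm (psd_sqrt A *v x))\<^sup>2 = x \<bullet> (A *v x)"
  using psd_sqrt[OF assms] pos_semidef_dot[of "psd_sqrt A" x "psd_sqrt A *v x"]
  by (simp add: power2_norm_eq_inner matrix_vector_mul_assoc)

section \<open>Rademacher's theorem\<close>

text \<open>Continuous induction: the set of \<open>x\<close> with
  \<open>\<Phi> a \<le> \<Phi> x\<close> is closed, and its supremum cannot lie before
  \<open>b\<close>, since one more step to the right starts there. The same principle serves below
  for measures of sets on the line and for averages over boxes.\<close>

lemma right_step_mono:
  fixes \<Phi> :: "real \<Rightarrow> real"
  assumes "a \<le> b" and cont: "continuous_on {a..b} \<Phi>"
    and step: "\<And>x. a \<le> x \<Longrightarrow> x < b \<Longrightarrow> \<exists>y. x < y \<and> y \<le> b \<and> \<Phi> x \<le> \<Phi> y"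
  shows "\<Phi> a \<le> \<Phi> b"
proof -
  define S where "S = {x \<in> {a..b}. \<Phi> a \<le> \<Phi> x}"
  have S: "a \<in> S" "bdd_above S" using \<open>a \<le> b\<close> by (auto simp: S_def)
  have "S = {a..b} \<inter> \<Phi> -` {\<Phi> a..}" by (auto simp: S_def)
  then have "closed S"
    using continuous_closed_preimage[OF cont closed_atLeastAtMost closed_atLeast] by simp
  then have s: "Sup S \<in> S" using S by (intro closed_contains_Sup) auto
  have "Sup S = b"
  proof (rule ccontr)
    assume "Sup S \<noteq> b"
    then have "Sup S < b" "a \<le> Sup S" using s by (auto simp: S_def)
    then obtain y where "Sup S < y" "y \<le> b" "\<Phi> (Sup S) \<le> \<Phi> y" using step by blast
    then have "y \<in> S" using s by (auto simp: S_def)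
    then show False using cSup_upper[OF _ S(2)] \<open>Sup S < y\<close> by fastforce
  qed
  then show ?thesis using s by (simp add: S_def)
qed

section \<open>Dini derivatives and null sets on the line\<close>

text \<open>The half-open interval makes the quantity exactly additive when an interval is cut at a
  point.\<close>

definition meas_upto :: "real set \<Rightarrow> real \<Rightarrow> real \<Rightarrow> real" where
  "meas_upto S a x = measure lborel (S \<inter> {a<..x})"

lemma fmeasurable_Int_Ioc:
  fixes a b :: real
  assumes "S \<in> sets borel"
  shows "S \<inter> {a<..b} \<in> fmeasurable lborel"
proof (rule fmeasurableI)
  have "emeasure lborel (S \<inter> {a<..b}) \<le> emeasure lborel {a..b}"
    by (rule emeasure_mono) auto
  also have "\<dots> < \<infinity>" by (cases "a \<le> b") auto
  finally show "emeasure lborel (S \<inter> {a<..b}) < \<infinity>" .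
qed (use assms in auto)

lemma meas_upto_split:
  assumes "S \<in> sets borel" "a \<le> x" "x \<le> y"
  shows "meas_upto S a y = meas_upto S a x + meas_upto S x y"
proof -
  have "S \<inter> {a<..y} = (S \<inter> {a<..x}) \<union> (S \<inter> {x<..y})" using assms by auto
  moreover have "measure lborel ((S \<inter> {a<..x}) \<union> (S \<inter> {x<..y})) =
      measure lborel (S \<inter> {a<..x}) + measure lborel (S \<inter> {x<..y})"
    using fmeasurable_Int_Ioc[OF assms(1)] by (intro measure_Un_AE) auto
  ultimately show ?thesis
    by (simp add: meas_upto_def)
qed

lemma meas_upto_bounds:
  assumes "S \<in> sets borel" "x \<le> y"
  shows "0 \<le> meas_upto S x y" "meas_upto S x y \<le> y - x"
proof -
  have "measure lborel (S \<inter> {x<..y}) \<le> measure lborel (UNIV \<inter> {x<..y})"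
    using assms by (intro measure_mono_fmeasurable fmeasurable_Int_Ioc) auto
  then show "meas_upto S x y \<le> y - x" using assms by (simp add: meas_upto_def)
qed (simp add: meas_upto_def)

lemma continuous_meas_upto:
  assumes "S \<in> sets borel"
  shows "continuous_on {a..b} (meas_upto S a)"
proof -
  have "\<bar>meas_upto S a x - meas_upto S a y\<bar> \<le> \<bar>x - y\<bar>" if "x \<in> {a..b}" "y \<in> {a..b}" for x y
    using that meas_upto_split[OF assms, of a x y] meas_upto_bounds[OF assms, of x y]
      meas_upto_split[OF assms, of a y x] meas_upto_bounds[OF assms, of y x]
    by (cases "x \<le> y") auto
  then have "1-lipschitz_on {a..b} (meas_upto S a)"
    by (intro lipschitz_onI) (auto simp: dist_real_def)
  then show ?thesis by (rule lipschitz_on_continuous_on)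
qed

text \<open>At a point of \<open>K\<close> a Dini step of length \<open>t\<close> gains
  \<open>r * t\<close>, which pays for the at most \<open>t\<close> units of \<open>K\<close> passed
  over. Off the closed set \<open>K\<close> a short step avoids \<open>K\<close>, and monotonicity
  of \<open>G\<close> is enough.\<close>

lemma meas_upto_upper_dini:
  fixes G :: "real \<Rightarrow> real"
  assumes G: "mono G" "continuous_on UNIV G" and K: "closed K" and "0 \<le> r" "a \<le> b"
    and dini: "\<And>x e. x \<in> K \<Longrightarrow> 0 < e \<Longrightarrow> \<exists>t. 0 < t \<and> t < e \<and> r * t \<le> G (x + t) - G x"
  shows "r * meas_upto K a b \<le> G b - G a"
proof -
  have KS: "K \<in> sets borel" using K by simp
  define \<Phi> where "\<Phi> x = G x - r * meas_upto K a x" for x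
  have "\<Phi> a \<le> \<Phi> b"
  proof (rule right_step_mono[OF \<open>a \<le> b\<close>])
    show "continuous_on {a..b} \<Phi>" unfolding \<Phi>_def
      by (intro continuous_intros continuous_meas_upto KS continuous_on_subset[OF G(2)]) simp
    fix x assume x: "a \<le> x" "x < b"
    have red: "\<Phi> x \<le> \<Phi> y" if "x < y" "r * meas_upto K x y \<le> G y - G x" for y
      using that x meas_upto_split[OF KS, of a x y] by (simp add: \<Phi>_def algebra_simps)
    show "\<exists>y. x < y \<and> y \<le> b \<and> \<Phi> x \<le> \<Phi> y"
    proof (cases "x \<in> K")
      case True
      then obtain t where t: "0 < t" "t < b - x" "r * t \<le> G (x + t) - G x"
        using dini[of x "b - x"] x by auto
      have "r * meas_upto K x (x + t) \<le> r * t"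
        using meas_upto_bounds[OF KS, of x "x + t"] t \<open>0 \<le> r\<close> by (intro mult_left_mono) auto
      then show ?thesis using t by (intro exI[of _ "x + t"] conjI red) auto
    next
      case False
      then obtain d where d: "0 < d" "ball x d \<subseteq> - K"
        using K open_contains_ball[of "- K"] by (auto simp: closed_def)
      define y where "y = x + min (d/2) (b - x)"
      have y: "x < y" "y \<le> b" "y < x + d" using d x by (auto simp: y_def)
      have "K \<inter> {x<..y} = {}" using d(2) y by (force simp: dist_real_def)
      then have "meas_upto K x y = 0" by (simp add: meas_upto_def)
      then have "\<Phi> x \<le> \<Phi> y" using y G(1) by (intro red) (auto simp: monoD)
      then show ?thesis using y by blast
    qed
  qed
  then show ?thesis by (simp add: \<Phi>_def meas_upto_def)
qed

text \<open>Enclose \<open>K\<close> in an open \<open>U\<close> that exceeds it by measure less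
  than \<open>e\<close>. Inside a bounded interval, sparseness on the pieces of \<open>U\<close>
  gives \<open>|K| \<le> \<theta> * |U| \<le> \<theta> * (|K| + e)\<close>, and
  \<open>\<theta> < 1\<close> leaves only measure zero.\<close>

lemma closed_null_if_sparse:
  assumes K: "closed K" and \<theta>: "0 \<le> \<theta>" "\<theta> < 1"
    and sparse: "\<And>a b. a \<le> b \<Longrightarrow> meas_upto K a b \<le> \<theta> * (b - a)"
  shows "emeasure lborel K = 0"
proof -
  have KS: "K \<in> sets borel" using K by simp
  have zero: "meas_upto K a b = 0" if ab: "a \<le> b" for a b
  proof -
    have le: "meas_upto K a b \<le> \<theta> * (meas_upto K a b + e)" if "e > 0" for e
    proof -
      obtain U where U: "open U" "K \<subseteq> U" "emeasure lborel (U - K) < ennreal e"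
        using outer_regular_lborel[OF KS \<open>e > 0\<close>] by blast
      have US: "U \<in> sets borel" using U by simp
      define \<Phi> where "\<Phi> x = \<theta> * meas_upto U a x - meas_upto K a x" for x
      have "\<Phi> a \<le> \<Phi> b"
      proof (rule right_step_mono[OF ab])
        show "continuous_on {a..b} \<Phi>" unfolding \<Phi>_def
          by (intro continuous_intros continuous_meas_upto KS US)
        fix x assume x: "a \<le> x" "x < b"
        have red: "\<Phi> x \<le> \<Phi> y" if "x < y" "meas_upto K x y \<le> \<theta> * meas_upto U x y" for y
          using that x meas_upto_split[OF KS, of a x y] meas_upto_split[OF US, of a x y]
          by (simp add: \<Phi>_def algebra_simps)
        \<comment> \<open>Near each point one can either stay inside \<open>U\<close>, where
          \<open>U\<close> has full length and sparseness applies, or avoid \<open>K\<close>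
          altogether.\<close>
        have "\<exists>T. open T \<and> x \<in> T \<and> (T \<subseteq> U \<or> T \<inter> K = {})"
        proof (cases "x \<in> U")
          case True
          then show ?thesis using U by blast
        next
          case False
          then show ?thesis using U K by (intro exI[of _ "- K"]) auto
        qed
        then obtain T d where T: "T \<subseteq> U \<or> T \<inter> K = {}" and d: "0 < d" "ball x d \<subseteq> T"
          by (meson open_contains_ball)
        define y where "y = x + min (d/2) (b - x)"
        have y: "x < y" "y \<le> b" "y < x + d" using d x by (auto simp: y_def)
        have "{x<..y} \<subseteq> ball x d" using y by (auto simp: dist_real_def)
        then have *: "{x<..y} \<subseteq> U \<or> {x<..y} \<inter> K = {}" using T d by blast
        have "meas_upto K x y \<le> \<theta> * meas_upto U x y"
          using *
        proof
          assume "{x<..y} \<subseteq> U"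
          then have "meas_upto U x y = y - x" using y by (simp add: meas_upto_def Int_absorb1)
          then show ?thesis using sparse[of x y] y by simp
        next
          assume "{x<..y} \<inter> K = {}"
          then have "meas_upto K x y = 0" by (simp add: meas_upto_def Int_commute)
          then show ?thesis using meas_upto_bounds[OF US, of x y] y \<theta> by simp
        qed
        then show "\<exists>y. x < y \<and> y \<le> b \<and> \<Phi> x \<le> \<Phi> y" using y red by blast
      qed
      then have "meas_upto K a b \<le> \<theta> * meas_upto U a b" by (simp add: \<Phi>_def meas_upto_def)
      also have "meas_upto U a b \<le> meas_upto K a b + e"
      proof -
        have fm: "U - K \<in> fmeasurable lborel"
          using U(3) US KS by (intro fmeasurableI) (auto intro: less_trans)
        have fmK: "K \<inter> {a<..b} \<in> fmeasurable lborel"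
          by (rule fmeasurable_Int_Ioc[OF KS])
        have "meas_upto U a b \<le> measure lborel ((K \<inter> {a<..b}) \<union> (U - K))"
          unfolding meas_upto_def using fm fmK US
          by (intro measure_mono_fmeasurable fmeasurable.Un) auto
        also have "\<dots> \<le> meas_upto K a b + measure lborel (U - K)"
          unfolding meas_upto_def using fm fmK by (intro measure_Un_le) auto
        also have "measure lborel (U - K) \<le> e"
          using U(3) \<open>e > 0\<close> fm by (simp add: emeasure_eq_measure2 ennreal_less_iff)
        finally show ?thesis by simp
      qed
      finally show ?thesis using \<theta> by (simp add: mult_left_mono)
    qed
    have "meas_upto K a b \<le> \<theta> * meas_upto K a b"
    proof (rule field_le_epsilon)
      fix e :: real assume "e > 0"
      then have "\<theta> * e \<le> e" using \<theta> by (simp add: mult_left_le_one_le)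
      then show "meas_upto K a b \<le> \<theta> * meas_upto K a b + e"
        using le[OF \<open>e > 0\<close>] by (simp add: algebra_simps)
    qed
    then have "(1 - \<theta>) * meas_upto K a b \<le> 0" by (simp add: algebra_simps)
    then show ?thesis using \<theta> meas_upto_bounds[OF KS ab] by (simp add: mult_le_0_iff)
  qed
  have "emeasure lborel (K \<inter> {-real n<..real n}) = 0" for n
  proof -
    have "K \<inter> {-real n<..real n} \<in> fmeasurable lborel"
      by (rule fmeasurable_Int_Ioc[OF KS])
    then show ?thesis using zero[of "-real n" "real n"]
      by (simp add: emeasure_eq_measure2 meas_upto_def)
  qed
  then have "emeasure lborel (\<Union>n. K \<inter> {-real n<..real n}) = 0"
    using KS by (intro emeasure_UN_eq_0) auto
  moreover have "(\<Union>n. K \<inter> {-real n<..real n}) = K"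
  proof safe
    fix x assume "x \<in> K"
    obtain n where "\<bar>x\<bar> < real n" using reals_Archimedean2 by blast
    then show "x \<in> (\<Union>n. K \<inter> {-real n<..real n})" using \<open>x \<in> K\<close> by (auto intro!: exI[of _ n])
  qed
  ultimately show ?thesis by simp
qed

text \<open>Outer regularity of the complement leaves a closed subset of \<open>E\<close> that
  misses only measure \<open>e\<close>. This lets the Dini argument work with closed sets.\<close>

lemma emeasure_zero_if_closed_subsets_null:
  fixes E :: "'a::euclidean_space set"
  assumes E: "E \<in> sets borel" and null: "\<And>K. closed K \<Longrightarrow> K \<subseteq> E \<Longrightarrow> emeasure lborel K = 0"
  shows "emeasure lborel E = 0"
proof -
  have le: "emeasure lborel E \<le> 0 + ennreal e" if "e > 0" for e
  proof -
    have mE: "- E \<in> sets borel" using E by (metis borel_comp)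
    obtain U where U: "open U" "- E \<subseteq> U" "emeasure lborel (U - (- E)) < ennreal e"
      using outer_regular_lborel[OF mE \<open>e > 0\<close>] by blast
    have K: "closed (- U)" "- U \<subseteq> E" using U by auto
    have "E = (- U) \<union> (U - (- E))" using K by auto
    then have "emeasure lborel E \<le> emeasure lborel (- U) + emeasure lborel (U - (- E))"
      using emeasure_subadditive[of "- U" lborel "U - (- E)"] U E K by (auto simp: borel_closed)
    then show ?thesis using null[OF K] U(3) by auto
  qed
  have "emeasure lborel E \<le> 0" by (rule ennreal_le_epsilon, rule le)
  then show ?thesis by simp
qed

text \<open>The points from which difference quotients above \<open>q\<close> occur at arbitrarily
  small positive times, so that the upper right Dini derivative along \<open>v\<close> is at least
  \<open>q\<close>. For continuous \<open>f\<close> this form is a countable intersection of open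
  sets, hence Borel.\<close>

definition dini_gt :: "('a::euclidean_space \<Rightarrow> real) \<Rightarrow> 'a \<Rightarrow> real \<Rightarrow> 'a set" where
  "dini_gt f v q = (\<Inter>n::nat. \<Union>t\<in>{0<..<inverse (real (Suc n))}. {x. q * t < f (x + t *\<^sub>R v) - f x})"

lemma dini_gt_borel:
  assumes "continuous_on UNIV f"
  shows "dini_gt f v q \<in> sets borel"
proof -
  have "open {x. q * t < f (x + t *\<^sub>R v) - f x}" for t
    by (intro open_Collect_less continuous_intros continuous_on_compose2[OF assms]) auto
  then have "open (\<Union>t\<in>{0<..<inverse (real (Suc n))}. {x. q * t < f (x + t *\<^sub>R v) - f x})" for n
    by auto
  then show ?thesis unfolding dini_gt_def by (intro sets.countable_INT'') (auto intro: borel_open)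
qed

lemma dini_gtD:
  assumes "x \<in> dini_gt f v q" "0 < e"
  shows "\<exists>t. 0 < t \<and> t < e \<and> q * t < f (x + t *\<^sub>R v) - f x"
proof -
  obtain n where "inverse (real (Suc n)) < e" using reals_Archimedean[OF \<open>0 < e\<close>] by blast
  moreover have "x \<in> (\<Union>t\<in>{0<..<inverse (real (Suc n))}. {x. q * t < f (x + t *\<^sub>R v) - f x})"
    using assms(1) unfolding dini_gt_def by blast
  then obtain t where "0 < t" "t < inverse (real (Suc n))" "q * t < f (x + t *\<^sub>R v) - f x"
    by auto
  ultimately show ?thesis by (intro exI[of _ t]) auto
qed

lemma dini_gtI:
  assumes "\<And>e. 0 < e \<Longrightarrow> \<exists>t. 0 < t \<and> t < e \<and> q * t < f (x + t *\<^sub>R v) - f x"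
  shows "x \<in> dini_gt f v q"
  unfolding dini_gt_def
proof
  fix n
  show "x \<in> (\<Union>t\<in>{0<..<inverse (real (Suc n))}. {x. q * t < f (x + t *\<^sub>R v) - f x})"
    using assms[of "inverse (real (Suc n))"] by auto
qed

text \<open>On a closed set \<open>K\<close> where the upper right derivative exceeds \<open>q\<close> and the lower one is
  below \<open>p\<close>, the upper derivative bound applied to \<open>F + L id\<close> and to \<open>L id - F\<close> shows that
  \<open>K\<close> has density at most \<open>2 L / (2 L + q - p) < 1\<close> in every interval.\<close>

lemma lipschitz_dini_gap_null:
  fixes F :: "real \<Rightarrow> real"
  assumes lip: "L-lipschitz_on UNIV F" and "p < q"
  shows "emeasure lborel (dini_gt F 1 q \<inter> dini_gt (\<lambda>x. - F x) 1 (- p)) = 0"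
proof (rule emeasure_zero_if_closed_subsets_null)
  have cont: "continuous_on UNIV F" using lip by (rule lipschitz_on_continuous_on)
  show "dini_gt F 1 q \<inter> dini_gt (\<lambda>x. - F x) 1 (- p) \<in> sets borel"
    by (intro sets.Int dini_gt_borel continuous_intros cont)
  fix K assume K: "closed K" "K \<subseteq> dini_gt F 1 q \<inter> dini_gt (\<lambda>x. - F x) 1 (- p)"
  show "emeasure lborel K = 0"
  proof (cases "K = {}")
    case False
    have L: "\<bar>F x - F y\<bar> \<le> L * \<bar>x - y\<bar>" for x y
      using lipschitz_onD[OF lip, of x y] by (simp add: dist_real_def)
    have L0: "0 \<le> L" using lip by (rule lipschitz_on_nonneg)
    \<comment> \<open>A single point of \<open>K\<close> already yields \<open>q < L\<close> and
      \<open>- L < p\<close>, which makes the rates \<open>q + L\<close> and \<open>L - p\<close>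
      used below nonnegative.\<close>
    obtain x where x: "x \<in> K" using False by blast
    obtain t where "0 < t" "q * t < F (x + t) - F x"
      using dini_gtD[of x F 1 q 1] x K by auto
    then have "q * t < L * t" using L[of "x + t" x] by (simp only: add_diff_cancel_left' abs_of_pos)
    then have qL: "q < L" using \<open>0 < t\<close> by simp
    obtain t where "0 < t" "- p * t < - F (x + t) + F x"
      using dini_gtD[of x "\<lambda>x. - F x" 1 "- p" 1] x K by auto
    then have "- p * t < L * t" using L[of "x + t" x] by (simp only: add_diff_cancel_left' abs_of_pos)
    then have pL: "- p < L" using \<open>0 < t\<close> by (metis mult_less_cancel_right_pos)
    define \<theta> where "\<theta> = 2 * L / (2 * L + q - p)"
    have th: "0 \<le> \<theta>" "\<theta> < 1" using L0 \<open>p < q\<close> by (auto simp: \<theta>_def)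
    show ?thesis
    proof (rule closed_null_if_sparse[OF K(1) th])
      fix a b :: real assume ab: "a \<le> b"
      have "(q + L) * meas_upto K a b \<le> (F b + L * b) - (F a + L * a)"
      proof (rule meas_upto_upper_dini[OF _ _ K(1) _ ab, of "\<lambda>x. F x + L * x"])
        show "mono (\<lambda>x. F x + L * x)"
        proof (rule monoI)
          fix x y :: real assume "x \<le> y"
          then show "F x + L * x \<le> F y + L * y" using L[of x y] by (auto simp: algebra_simps)
        qed
        show "continuous_on UNIV (\<lambda>x. F x + L * x)" by (intro continuous_intros cont)
        show "0 \<le> q + L" using pL \<open>p < q\<close> by simp
        fix x e :: real assume "x \<in> K" "0 < e"
        then obtain t where "0 < t" "t < e" "q * t < F (x + t) - F x"
          using dini_gtD[of x F 1 q e] K by auto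
        then show "\<exists>t. 0 < t \<and> t < e \<and> (q + L) * t \<le> (F (x + t) + L * (x + t)) - (F x + L * x)"
          by (intro exI[of _ t]) (auto simp: algebra_simps)
      qed
      moreover have "(L - p) * meas_upto K a b \<le> (- F b + L * b) - (- F a + L * a)"
      proof (rule meas_upto_upper_dini[OF _ _ K(1) _ ab, of "\<lambda>x. - F x + L * x"])
        show "mono (\<lambda>x. - F x + L * x)"
        proof (rule monoI)
          fix x y :: real assume "x \<le> y"
          then show "- F x + L * x \<le> - F y + L * y" using L[of x y] by (auto simp: algebra_simps)
        qed
        show "continuous_on UNIV (\<lambda>x. - F x + L * x)" by (intro continuous_intros cont)
        show "0 \<le> L - p" using qL \<open>p < q\<close> by simp
        fix x e :: real assume "x \<in> K" "0 < e"
        then obtain t where "0 < t" "t < e" "- p * t < - F (x + t) - - F x"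
          using dini_gtD[of x "\<lambda>x. - F x" 1 "- p" e] K by auto
        then show "\<exists>t. 0 < t \<and> t < e \<and> (L - p) * t \<le> (- F (x + t) + L * (x + t)) - (- F x + L * x)"
          by (intro exI[of _ t]) (auto simp: algebra_simps)
      qed
      ultimately have "(2 * L + q - p) * meas_upto K a b \<le> 2 * L * (b - a)"
        by (simp add: algebra_simps)
      then show "meas_upto K a b \<le> \<theta> * (b - a)"
        unfolding \<theta>_def using L0 \<open>p < q\<close> by (simp add: field_simps)
    qed
  qed simp
qed

lemma nn_integral_lborel_translate:
  fixes c :: "'a::euclidean_space"
  assumes [measurable]: "g \<in> borel_measurable borel"
  shows "(\<integral>\<^sup>+x. g (x + c) \<partial>lborel) = (\<integral>\<^sup>+x. g x \<partial>lborel)"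
proof -
  have "(\<integral>\<^sup>+x. g x \<partial>distr lborel borel ((+) c)) = (\<integral>\<^sup>+x. g (c + x) \<partial>lborel)"
    by (subst nn_integral_distr) auto
  then show ?thesis by (simp add: lborel_distr_plus add.commute)
qed

text \<open>Average over the translates by \<open>s v\<close> with \<open>s\<close> in the unit
  interval: all of them have the measure of \<open>N\<close>, and Fubini integrates along the lines
  first.\<close>

lemma null_if_null_on_lines:
  fixes N :: "'a::euclidean_space set"
  assumes N: "N \<in> sets borel" and lines: "\<And>x. emeasure lborel {s. x + s *\<^sub>R v \<in> N} = 0"
  shows "emeasure lborel N = 0"
proof -
  have [measurable]: "N \<in> sets borel" by fact
  let ?h = "\<lambda>(s::real) x. indicator {0..1} s * indicator N (x + s *\<^sub>R v) :: ennreal"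
  have "emeasure lborel N = (\<integral>\<^sup>+s. indicator {0..1::real} s * emeasure lborel N \<partial>lborel)"
    by (simp add: nn_integral_multc)
  also have "\<dots> = (\<integral>\<^sup>+s. (\<integral>\<^sup>+x. ?h s x \<partial>lborel) \<partial>lborel)"
  proof (rule nn_integral_cong)
    fix s :: real
    have "(\<integral>\<^sup>+x. ?h s x \<partial>lborel) = indicator {0..1} s * (\<integral>\<^sup>+x. indicator N (x + s *\<^sub>R v) \<partial>lborel)"
      by (simp add: nn_integral_cmult)
    then show "indicator {0..1} s * emeasure lborel N = (\<integral>\<^sup>+x. ?h s x \<partial>lborel)"
      using nn_integral_lborel_translate[of "indicator N" "s *\<^sub>R v"] by simp
  qed
  also have "\<dots> = (\<integral>\<^sup>+x. (\<integral>\<^sup>+s. ?h s x \<partial>lborel) \<partial>lborel)"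
    by (rule lborel_pair.Fubini') simp
  also have "\<dots> = (\<integral>\<^sup>+x. 0 \<partial>(lborel :: 'a measure))"
  proof (rule nn_integral_cong)
    fix x :: 'a
    have "(\<integral>\<^sup>+s. ?h s x \<partial>lborel) \<le> (\<integral>\<^sup>+s. indicator {s. x + s *\<^sub>R v \<in> N} s \<partial>lborel)"
      by (intro nn_integral_mono) (auto simp: indicator_def)
    also have "\<dots> = 0" using lines[of x] by simp
    finally show "(\<integral>\<^sup>+s. ?h s x \<partial>lborel) = 0" by simp
  qed
  finally show ?thesis by simp
qed

text \<open>Boundedness keeps the lower and upper limits finite, so without a limit they differ.
  Placing rationals between them makes the exceptional set a countable union.\<close>

lemma bounded_convergent_at_right:
  fixes g :: "real \<Rightarrow> real"
  assumes bound: "\<And>t. 0 < t \<Longrightarrow> \<bar>g t\<bar> \<le> C"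
    and nolim: "\<nexists>l. (g \<longlongrightarrow> l) (at_right 0)"
  shows "\<exists>p q :: rat. p < q \<and> (\<exists>\<^sub>F t in at_right 0. g t < of_rat p) \<and> (\<exists>\<^sub>F t in at_right 0. of_rat q < g t)"
proof -
  let ?i = "Liminf (at_right 0) (\<lambda>t. ereal (g t))" and ?s = "Limsup (at_right 0) (\<lambda>t. ereal (g t))"
  have ev: "\<forall>\<^sub>F t::real in at_right 0. 0 < t" by (simp add: eventually_at_right_less)
  have le: "?i \<le> ?s" by (rule Liminf_le_Limsup) simp
  have b: "- C \<le> g t" "g t \<le> C" if "0 < t" for t
    using bound[OF that] by linarith+
  have lo: "ereal (- C) \<le> ?i"
    by (rule Liminf_bounded, rule eventually_mono[OF ev]) (use b in auto)
  have hi: "?s \<le> ereal C"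
    by (rule Limsup_bounded, rule eventually_mono[OF ev]) (use b in auto)
  have "?i \<noteq> ?s"
  proof
    assume eq: "?i = ?s"
    then obtain l where l: "?i = ereal l" using lo hi by (cases ?s) auto
    have "((\<lambda>t. ereal (g t)) \<longlongrightarrow> ereal l) (at_right 0)"
      using eq l by (intro Liminf_eq_Limsup) auto
    then show False using nolim by (auto simp: lim_ereal)
  qed
  then have "?i < ?s" using le by simp
  then obtain p where p: "?i < ereal (real_of_rat p)" "ereal (real_of_rat p) < ?s" using ereal_dense3 by blast
  then obtain q where q: "ereal (real_of_rat p) < ereal (real_of_rat q)" "ereal (real_of_rat q) < ?s" using ereal_dense3 by blast
  show ?thesis
  proof (intro exI conjI)
    show "p < q" using q by (simp add: of_rat_less)
    show "\<exists>\<^sub>F t in at_right 0. g t < of_rat p"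
    proof (rule ccontr)
      assume "\<not> ?thesis"
      then have "\<forall>\<^sub>F t in at_right 0. ereal (of_rat p) \<le> ereal (g t)" by (simp add: not_frequently not_less)
      from Liminf_bounded[OF this] p show False by simp
    qed
    show "\<exists>\<^sub>F t in at_right 0. of_rat q < g t"
    proof (rule ccontr)
      assume "\<not> ?thesis"
      then have "\<forall>\<^sub>F t in at_right 0. ereal (g t) \<le> ereal (of_rat q)" by (simp add: not_frequently not_less)
      from Limsup_bounded[OF this] q show False by simp
    qed
  qed
qed

section \<open>Directional derivatives almost everywhere\<close>

definition diff_quot :: "('a::euclidean_space \<Rightarrow> real) \<Rightarrow> 'a \<Rightarrow> real \<Rightarrow> 'a \<Rightarrow> real" where
  "diff_quot f v t x = (f (x + t *\<^sub>R v) - f x) / t"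

text \<open>The limit runs along one fixed sequence, so that the function is Borel for continuous
  \<open>f\<close>. For Lipschitz \<open>f\<close> it is almost everywhere the genuine right-hand
  derivative along \<open>v\<close>.\<close>

definition rderiv :: "('a::euclidean_space \<Rightarrow> real) \<Rightarrow> 'a \<Rightarrow> 'a \<Rightarrow> real" where
  "rderiv f v x = lim (\<lambda>n. diff_quot f v (inverse (real (Suc n))) x)"

lemma diff_quot_bound:
  assumes "L-lipschitz_on UNIV f" "0 < t"
  shows "\<bar>diff_quot f v t x\<bar> \<le> L * norm v"
proof -
  have "\<bar>f (x + t *\<^sub>R v) - f x\<bar> \<le> L * (t * norm v)"
    using lipschitz_onD[OF assms(1), of "x + t *\<^sub>R v" x] assms(2) by (simp add: dist_norm)
  then show ?thesis using assms(2) by (simp add: diff_quot_def field_simps)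
qed

lemma filterlim_inverse_Suc_at_right: "filterlim (\<lambda>n. inverse (real (Suc n))) (at_right 0) sequentially"
  by (rule tendsto_imp_filterlim_at_right[OF LIMSEQ_inverse_real_of_nat]) simp

text \<open>Points without a limit show a rational gap between lower and upper Dini derivative, so
  they lie in the countable union \<open>N\<close>. Along a line in direction \<open>v\<close> each
  gap set becomes the one-dimensional gap set of \<open>F s = f (x + s v)\<close>, which is
  null.\<close>

lemma rderiv_exists_AE:
  fixes f :: "'a::euclidean_space \<Rightarrow> real"
  assumes lip: "L-lipschitz_on UNIV f"
  shows "AE x in lborel. ((\<lambda>t. diff_quot f v t x) \<longlongrightarrow> rderiv f v x) (at_right 0)"
proof -
  define N where "N = (\<Union>(p,q)\<in>{pq :: rat \<times> rat. fst pq < snd pq}.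
    dini_gt f v (of_rat q) \<inter> dini_gt (\<lambda>x. - f x) v (- of_rat p))"
  have cont: "continuous_on UNIV f" using lip by (rule lipschitz_on_continuous_on)
  have N: "N \<in> sets borel" unfolding N_def
    by (intro sets.countable_UN'') (auto intro!: sets.Int dini_gt_borel continuous_intros cont)
  have "emeasure lborel N = 0"
  proof (rule null_if_null_on_lines[OF N])
    fix x
    define F where "F s = f (x + s *\<^sub>R v)" for s
    have lipF: "(L * norm v)-lipschitz_on UNIV F"
    proof (rule lipschitz_onI)
      show "dist (F s) (F t) \<le> L * norm v * dist s t" for s t
        using lipschitz_onD[OF lip, of "x + s *\<^sub>R v" "x + t *\<^sub>R v"]
        by (simp add: F_def dist_norm mult.assoc mult.commute[of "norm v"] flip: scaleR_diff_left)
      show "0 \<le> L * norm v" using lipschitz_on_nonneg[OF lip] by simp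
    qed
    have shift: "dini_gt F 1 q = {s. x + s *\<^sub>R v \<in> dini_gt f v q}"
      "dini_gt (\<lambda>s. - F s) 1 q = {s. x + s *\<^sub>R v \<in> dini_gt (\<lambda>x. - f x) v q}" for q
      by (auto simp: dini_gt_def F_def algebra_simps)
    have "(\<Union>(p,q)\<in>{pq :: rat \<times> rat. fst pq < snd pq}.
        dini_gt F 1 (of_rat q) \<inter> dini_gt (\<lambda>s. - F s) 1 (- of_rat p)) \<in> null_sets lborel"
    proof (rule null_sets_UN')
      fix i :: "rat \<times> rat" assume "i \<in> {pq. fst pq < snd pq}"
      then obtain p q where i: "i = (p, q)" "p < q" by (cases i) auto
      have "continuous_on UNIV F" using lipF by (rule lipschitz_on_continuous_on)
      then show "(case i of (p, q) \<Rightarrow> dini_gt F 1 (of_rat q) \<inter> dini_gt (\<lambda>s. - F s) 1 (- of_rat p)) \<in> null_sets lborel"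
        using lipschitz_dini_gap_null[OF lipF]
        by (auto simp: i of_rat_less null_sets_def intro!: sets.Int dini_gt_borel continuous_intros)
    qed auto
    moreover have "{s. x + s *\<^sub>R v \<in> N} = (\<Union>(p,q)\<in>{pq :: rat \<times> rat. fst pq < snd pq}.
        dini_gt F 1 (of_rat q) \<inter> dini_gt (\<lambda>s. - F s) 1 (- of_rat p))"
      unfolding N_def shift by blast
    ultimately show "emeasure lborel {s. x + s *\<^sub>R v \<in> N} = 0" by auto
  qed
  then have "N \<in> null_sets lborel" using N by auto
  moreover have "((\<lambda>t. diff_quot f v t x) \<longlongrightarrow> rderiv f v x) (at_right 0)" if "x \<notin> N" for x
  proof -
    have "\<exists>l. ((\<lambda>t. diff_quot f v t x) \<longlongrightarrow> l) (at_right 0)"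
    proof (rule ccontr)
      assume "\<not> ?thesis"
      from bounded_convergent_at_right[OF diff_quot_bound[OF lip] this]
      obtain p q :: rat where pq: "p < q" and
        p: "\<exists>\<^sub>F t in at_right 0. diff_quot f v t x < of_rat p" and
        q: "\<exists>\<^sub>F t in at_right 0. of_rat q < diff_quot f v t x" by blast
      have "x \<in> dini_gt f v (of_rat q)"
      proof (rule dini_gtI)
        fix e :: real assume "0 < e"
        then have "\<forall>\<^sub>F t in at_right 0. 0 < t \<and> t < e" by (auto simp: eventually_at_right_field)
        from frequently_eventually_frequently[OF q this]
        obtain t where "0 < t" "t < e" "of_rat q < diff_quot f v t x" using frequently_ex by force
        then show "\<exists>t. 0 < t \<and> t < e \<and> of_rat q * t < f (x + t *\<^sub>R v) - f x"
          by (intro exI[of _ t]) (auto simp: diff_quot_def field_simps)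
      qed
      moreover have "x \<in> dini_gt (\<lambda>x. - f x) v (- of_rat p)"
      proof (rule dini_gtI)
        fix e :: real assume "0 < e"
        then have "\<forall>\<^sub>F t in at_right 0. 0 < t \<and> t < e" by (auto simp: eventually_at_right_field)
        from frequently_eventually_frequently[OF p this]
        obtain t where "0 < t" "t < e" "diff_quot f v t x < of_rat p" using frequently_ex by force
        then show "\<exists>t. 0 < t \<and> t < e \<and> - of_rat p * t < - f (x + t *\<^sub>R v) - - f x"
          by (intro exI[of _ t]) (auto simp: diff_quot_def field_simps)
      qed
      ultimately show False using that pq by (auto simp: N_def)
    qed
    then obtain l where l: "((\<lambda>t. diff_quot f v t x) \<longlongrightarrow> l) (at_right 0)" by blast
    then have "(\<lambda>n. diff_quot f v (inverse (real (Suc n))) x) \<longlonglongrightarrow> l"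
      by (rule filterlim_compose) (rule filterlim_inverse_Suc_at_right)
    then have "rderiv f v x = l" unfolding rderiv_def by (rule limI)
    then show ?thesis using l by simp
  qed
  ultimately show ?thesis by (intro AE_I'[of N]) auto
qed

section \<open>Linearity of the directional derivative in the direction\<close>

lemma lborel_integral_translate:
  fixes c :: "'a::euclidean_space" and g :: "'a \<Rightarrow> 'b::{banach, second_countable_topology}"
  assumes [measurable]: "g \<in> borel_measurable borel"
  shows "(\<integral>x. g (x + c) \<partial>lborel) = (\<integral>x. g x \<partial>lborel)"
proof -
  have "(\<integral>x. g x \<partial>distr lborel borel ((+) c)) = (\<integral>x. g (c + x) \<partial>lborel)"
    by (subst integral_distr) auto
  then show ?thesis by (simp add: lborel_distr_plus add.commute)
qed

lemma lborel_integrable_indicator_bounded: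
  fixes g :: "'a::euclidean_space \<Rightarrow> real"
  assumes [measurable]: "g \<in> borel_measurable borel" and A: "A \<in> sets borel" "bounded A"
    and bound: "AE x in lborel. \<bar>g x\<bar> \<le> C"
  shows "integrable lborel (\<lambda>x. indicator A x * g x)"
proof (rule Bochner_Integration.integrable_bound)
  have [measurable]: "A \<in> sets lborel" "g \<in> borel_measurable lborel" using A assms(1) by auto
  show "integrable lborel (\<lambda>x. C * indicator A x :: real)"
    using A emeasure_bounded_finite[OF A(2)] by simp
  show "AE x in lborel. norm (indicator A x * g x) \<le> norm (C * indicator A x :: real)"
    using bound by eventually_elim (auto simp: indicator_def)
  show "(\<lambda>x. indicator A x * g x) \<in> borel_measurable lborel" by measurable
qed

lemma null_cbox_minus_box: "cbox a b - box a b \<in> null_sets (lborel :: 'a::euclidean_space measure)"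
proof -
  have "emeasure lborel (cbox a b - box a b) = emeasure lborel (cbox a b) - emeasure lborel (box a b)"
    using emeasure_bounded_finite[OF bounded_box, of a b]
    by (intro emeasure_Diff) (auto simp: box_subset_cbox)
  also have "\<dots> = 0" by (auto simp: emeasure_lborel_cbox_eq emeasure_lborel_box_eq)
  finally show ?thesis by auto
qed

text \<open>The positive and negative parts of \<open>h\<close>, cut to a large box, are densities
  of two finite measures that agree on all boxes, an intersection-stable generator. The measures
  coincide, and so do the densities almost everywhere.\<close>

lemma AE_zero_if_box_integrals_zero:
  fixes h :: "'a::euclidean_space \<Rightarrow> real"
  assumes [measurable]: "h \<in> borel_measurable borel"
    and int: "\<And>a b. integrable lborel (\<lambda>x. indicator (box a b) x * h x)"
    and zero: "\<And>a b. (\<integral>x. indicator (box a b) x * h x \<partial>lborel) = 0"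
  shows "AE x in lborel. h x = 0"
proof -
  have "AE x in lborel. \<forall>n::nat. x \<in> box (- real n *\<^sub>R One) (real n *\<^sub>R One) \<longrightarrow> h x = 0"
    unfolding AE_all_countable
  proof
    fix n :: nat
    let ?B = "box (- real n *\<^sub>R One) (real n *\<^sub>R One) :: 'a set"
    define P where "P x = ennreal (indicator ?B x * max 0 (h x))" for x
    define Q where "Q x = ennreal (indicator ?B x * max 0 (- h x))" for x
    have [measurable]: "P \<in> borel_measurable borel" "Q \<in> borel_measurable borel"
      unfolding P_def Q_def by measurable
    have eq: "emeasure (density lborel P) (box a b) = emeasure (density lborel Q) (box a b)" for a b
    proof -
      obtain c d where cd: "?B \<inter> box a b = box c d" unfolding box_Int_box by blast
      have split: "indicator (box c d) x * h x =
          indicator (box c d) x * max 0 (h x) - indicator (box c d) x * max 0 (- h x)" for x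
        by (auto simp: indicator_def max_def)
      have i: "integrable lborel (\<lambda>x. indicator (box c d) x * max 0 (h x))"
        "integrable lborel (\<lambda>x. indicator (box c d) x * max 0 (- h x))"
        using int[of c d] by (auto intro!: Bochner_Integration.integrable_bound[OF int[of c d]] simp: indicator_def)
      have "(\<integral>x. indicator (box c d) x * max 0 (h x) \<partial>lborel) = (\<integral>x. indicator (box c d) x * max 0 (- h x) \<partial>lborel)"
        using zero[of c d] i unfolding split by simp
      moreover have "emeasure (density lborel P) (box a b) = ennreal (\<integral>x. indicator (box c d) x * max 0 (h x) \<partial>lborel)"
      proof -
        have "emeasure (density lborel P) (box a b) = (\<integral>\<^sup>+x. ennreal (indicator (box c d) x * max 0 (h x)) \<partial>lborel)"
          by (subst emeasure_density) (auto intro!: nn_integral_cong simp: P_def cd[symmetric] indicator_def)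
        also have "\<dots> = ennreal (\<integral>x. indicator (box c d) x * max 0 (h x) \<partial>lborel)"
          by (rule nn_integral_eq_integral[OF i(1)]) simp
        finally show ?thesis .
      qed
      moreover have "emeasure (density lborel Q) (box a b) = ennreal (\<integral>x. indicator (box c d) x * max 0 (- h x) \<partial>lborel)"
      proof -
        have "emeasure (density lborel Q) (box a b) = (\<integral>\<^sup>+x. ennreal (indicator (box c d) x * max 0 (- h x)) \<partial>lborel)"
          by (subst emeasure_density) (auto intro!: nn_integral_cong simp: Q_def cd[symmetric] indicator_def)
        also have "\<dots> = ennreal (\<integral>x. indicator (box c d) x * max 0 (- h x) \<partial>lborel)"
          by (rule nn_integral_eq_integral[OF i(2)]) simp
        finally show ?thesis .
      qed
      ultimately show ?thesis by simp
    qed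
    have fin: "emeasure (density lborel P) (box a b) \<noteq> \<infinity>" for a b
    proof -
      have "emeasure (density lborel P) (box a b) \<le> (\<integral>\<^sup>+x. ennreal (norm (indicator ?B x * h x)) \<partial>lborel)"
        by (subst emeasure_density) (auto intro!: nn_integral_mono ennreal_leI simp: P_def indicator_def)
      also have "\<dots> < \<infinity>" using int[of "- real n *\<^sub>R One" "real n *\<^sub>R One"] unfolding integrable_iff_bounded by simp
      finally show ?thesis by simp
    qed
    have "density lborel P = density lborel Q"
    proof (rule measure_eqI_generator_eq)
      let ?E = "range (\<lambda>(a, b). box a b :: 'a set)"
      show "Int_stable ?E" by (auto simp: Int_stable_def box_Int_box)
      show "?E \<subseteq> Pow UNIV" "sets (density lborel P) = sigma_sets UNIV ?E" "sets (density lborel Q) = sigma_sets UNIV ?E"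
        by (simp_all add: borel_eq_box)
      let ?A = "\<lambda>n::nat. box (- (real n *\<^sub>R One)) (real n *\<^sub>R One) :: 'a set"
      show "range ?A \<subseteq> ?E" "(\<Union>i. ?A i) = UNIV" unfolding UN_box_eq_UNIV by auto
      show "emeasure (density lborel P) (?A i) \<noteq> \<infinity>" for i by (rule fin)
      show "emeasure (density lborel P) X = emeasure (density lborel Q) X" if "X \<in> ?E" for X
        using that eq by auto
    qed
    then have "AE x in lborel. P x = Q x"
      by (intro sigma_finite_measure.density_unique[OF sigma_finite_lborel]) auto
    then show "AE x in lborel. x \<in> ?B \<longrightarrow> h x = 0"
      by eventually_elim (auto simp: P_def Q_def max_def ennreal_eq_0_iff split: if_splits)
  qed
  then show ?thesis
  proof eventually_elim
    case (elim x)
    have "x \<in> (\<Union>n. box (- (real n *\<^sub>R One)) (real n *\<^sub>R One))" by (simp add: UN_box_eq_UNIV)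
    then show ?case using elim by auto
  qed
qed

lemma diff_quot_measurable:
  assumes "continuous_on UNIV f"
  shows "diff_quot f v t \<in> borel_measurable borel"
proof -
  have [measurable]: "f \<in> borel_measurable borel" by (rule borel_measurable_continuous_onI[OF assms])
  show ?thesis unfolding diff_quot_def by measurable
qed

lemma rderiv_measurable:
  assumes "continuous_on UNIV f"
  shows "rderiv f v \<in> borel_measurable borel"
  unfolding rderiv_def by (intro borel_measurable_lim_metric diff_quot_measurable assms)

lemma rderiv_zero: "rderiv f 0 x = 0"
  unfolding rderiv_def by (simp add: diff_quot_def)

lemma rderiv_seq_AE:
  assumes "L-lipschitz_on UNIV f"
  shows "AE x in lborel. (\<lambda>n. diff_quot f v (inverse (real (Suc n))) x) \<longlonglongrightarrow> rderiv f v x"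
  using rderiv_exists_AE[OF assms, of v]
  by eventually_elim (erule filterlim_compose, rule filterlim_inverse_Suc_at_right)

lemma rderiv_bound_AE:
  assumes "L-lipschitz_on UNIV f"
  shows "AE x in lborel. \<bar>rderiv f v x\<bar> \<le> L * norm v"
  using rderiv_seq_AE[OF assms, of v]
proof eventually_elim
  case (elim x)
  have "(\<lambda>n. \<bar>diff_quot f v (inverse (real (Suc n))) x\<bar>) \<longlonglongrightarrow> \<bar>rderiv f v x\<bar>"
    using elim by (rule tendsto_rabs)
  then show ?case by (rule Lim_bounded[where M=0]) (use diff_quot_bound[OF assms] in auto)
qed

text \<open>The moving base point \<open>x + t n v\<close> is what additivity requires. Translation
  of the integral moves it onto the indicator, which converges off the null boundary of the box, and
  dominated convergence applies.\<close>

lemma rderiv_box_limit: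
  fixes f :: "'a::euclidean_space \<Rightarrow> real"
  assumes lip: "L-lipschitz_on UNIV f"
  defines "t n \<equiv> inverse (real (Suc n))"
  shows "(\<lambda>n. \<integral>x. indicator (box a b) x * diff_quot f w (t n) (x + t n *\<^sub>R v) \<partial>lborel)
    \<longlonglongrightarrow> (\<integral>x. indicator (box a b) x * rderiv f w x \<partial>lborel)"
proof -
  have cont: "continuous_on UNIV f" using lip by (rule lipschitz_on_continuous_on)
  note [measurable] = diff_quot_measurable[OF cont] rderiv_measurable[OF cont]
  have t: "0 < t n" "t n \<le> 1" for n by (auto simp: t_def field_simps)
  have t0: "t \<longlonglongrightarrow> 0" unfolding t_def by (rule LIMSEQ_inverse_real_of_nat)
  obtain R where R: "\<And>x. x \<in> box a b \<Longrightarrow> norm x \<le> R"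
    using bounded_box[of a b] unfolding bounded_iff by blast
  let ?s = "\<lambda>n x. indicator (box a b) (x - t n *\<^sub>R v) * diff_quot f w (t n) x"
  have "(\<integral>x. indicator (box a b) x * diff_quot f w (t n) (x + t n *\<^sub>R v) \<partial>lborel) = (\<integral>x. ?s n x \<partial>lborel)" for n
    using lborel_integral_translate[of "?s n" "t n *\<^sub>R v"] by simp
  moreover have "(\<lambda>n. \<integral>x. ?s n x \<partial>lborel) \<longlonglongrightarrow> (\<integral>x. indicator (box a b) x * rderiv f w x \<partial>lborel)"
  proof (rule integral_dominated_convergence)
    \<comment> \<open>This ball contains every shifted box, because
      \<open>t n \<le> 1\<close>.\<close>
    show "integrable lborel (\<lambda>x. L * norm w * indicator (cball 0 (R + norm v)) x)"
      using emeasure_bounded_finite[OF bounded_cball, of 0 "R + norm v"]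
      by (intro integrable_mult_right integrable_real_indicator) auto
    show "AE x in lborel. norm (?s n x) \<le> L * norm w * indicator (cball 0 (R + norm v)) x" for n
    proof (rule AE_I2)
      fix x
      show "norm (?s n x) \<le> L * norm w * indicator (cball 0 (R + norm v)) x"
      proof (cases "x - t n *\<^sub>R v \<in> box a b")
        case True
        have "norm x \<le> norm (x - t n *\<^sub>R v) + norm (t n *\<^sub>R v)"
          using norm_triangle_ineq[of "x - t n *\<^sub>R v" "t n *\<^sub>R v"] by simp
        also have "norm (t n *\<^sub>R v) \<le> norm v" using t[of n] by (simp add: mult_left_le_one_le)
        finally have "x \<in> cball 0 (R + norm v)" using R[OF True] by simp
        then show ?thesis using True diff_quot_bound[OF lip t(1)[of n], of w x] by simp
      next
        case False
        then show ?thesis using lipschitz_on_nonneg[OF lip] by simp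
      qed
    qed
    have "AE x in lborel. x \<notin> cbox a b - box a b" using null_cbox_minus_box[of a b] by (rule AE_not_in)
    then show "AE x in lborel. (\<lambda>n. ?s n x) \<longlonglongrightarrow> indicator (box a b) x * rderiv f w x"
      using rderiv_seq_AE[OF lip, of w]
    proof eventually_elim
      case (elim x)
      have lim: "(\<lambda>n. x - t n *\<^sub>R v) \<longlonglongrightarrow> x"
        using tendsto_diff[OF tendsto_const tendsto_scaleR[OF t0 tendsto_const], of x v] by simp
      have "\<forall>\<^sub>F n in sequentially. (x - t n *\<^sub>R v \<in> box a b) = (x \<in> box a b)"
      proof (cases "x \<in> box a b")
        case True
        then show ?thesis using topological_tendstoD[OF lim open_box True] by simp
      next
        case False
        then have "x \<in> - cbox a b" using elim by auto
        then have "\<forall>\<^sub>F n in sequentially. x - t n *\<^sub>R v \<in> - cbox a b"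
          using lim by (intro topological_tendstoD) (auto simp: open_Compl closed_cbox)
        then show ?thesis by eventually_elim (use False box_subset_cbox in auto)
      qed
      then have "\<forall>\<^sub>F n in sequentially. indicator (box a b) x = (indicator (box a b) (x - t n *\<^sub>R v) :: real)"
        by eventually_elim (auto simp: indicator_def)
      then have "(\<lambda>n. indicator (box a b) (x - t n *\<^sub>R v) :: real) \<longlonglongrightarrow> indicator (box a b) x"
        by (rule Lim_transform_eventually[OF tendsto_const])
      then show ?case using elim(2) unfolding t_def by (intro tendsto_mult)
    qed
  qed measurable
  ultimately show ?thesis by simp
qed

text \<open>The increment along \<open>t (v + w)\<close> from \<open>x\<close> is the increment
  along \<open>t v\<close> from \<open>x\<close> plus that along \<open>t w\<close> from
  \<open>x + t v\<close>. This is exact before the limit. Box averages tolerate the moving base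
  point, which pointwise limits need not do.\<close>

lemma rderiv_add_AE:
  fixes f :: "'a::euclidean_space \<Rightarrow> real"
  assumes lip: "L-lipschitz_on UNIV f"
  shows "AE x in lborel. rderiv f (v + w) x = rderiv f v x + rderiv f w x"
proof -
  have cont: "continuous_on UNIV f" using lip by (rule lipschitz_on_continuous_on)
  note [measurable] = diff_quot_measurable[OF cont] rderiv_measurable[OF cont]
  let ?t = "\<lambda>n. inverse (real (Suc n))"
  have int: "integrable lborel (\<lambda>x. indicator (box a b) x * rderiv f u x)" for a b u
    by (rule lborel_integrable_indicator_bounded[OF _ _ _ rderiv_bound_AE[OF lip]]) auto
  have intq: "integrable lborel (\<lambda>x. indicator (box a b) x * diff_quot f u (?t n) (x + y))" for a b u n y
    by (rule lborel_integrable_indicator_bounded[of _ _ "L * norm u"])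
      (use diff_quot_bound[OF lip] in auto)
  have eq: "(\<integral>x. indicator (box a b) x * rderiv f (v + w) x \<partial>lborel) =
    (\<integral>x. indicator (box a b) x * rderiv f v x \<partial>lborel) + (\<integral>x. indicator (box a b) x * rderiv f w x \<partial>lborel)" for a b
  proof (rule LIMSEQ_unique)
    show "(\<lambda>n. \<integral>x. indicator (box a b) x * diff_quot f (v + w) (?t n) x \<partial>lborel)
      \<longlonglongrightarrow> (\<integral>x. indicator (box a b) x * rderiv f (v + w) x \<partial>lborel)"
      using rderiv_box_limit[OF lip, of a b "v + w" 0] by simp
    have "(\<lambda>n. (\<integral>x. indicator (box a b) x * diff_quot f v (?t n) (x + ?t n *\<^sub>R 0) \<partial>lborel) +
        (\<integral>x. indicator (box a b) x * diff_quot f w (?t n) (x + ?t n *\<^sub>R v) \<partial>lborel))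
      \<longlonglongrightarrow> (\<integral>x. indicator (box a b) x * rderiv f v x \<partial>lborel) + (\<integral>x. indicator (box a b) x * rderiv f w x \<partial>lborel)"
      by (intro tendsto_add rderiv_box_limit[OF lip])
    moreover have "(\<integral>x. indicator (box a b) x * diff_quot f v (?t n) (x + ?t n *\<^sub>R 0) \<partial>lborel) +
        (\<integral>x. indicator (box a b) x * diff_quot f w (?t n) (x + ?t n *\<^sub>R v) \<partial>lborel) =
        (\<integral>x. indicator (box a b) x * diff_quot f (v + w) (?t n) x \<partial>lborel)" for n
      by (subst Bochner_Integration.integral_add[symmetric, OF intq intq])
        (auto intro!: Bochner_Integration.integral_cong simp: diff_quot_def algebra_simps add_divide_distrib diff_divide_distrib)
    ultimately show "(\<lambda>n. \<integral>x. indicator (box a b) x * diff_quot f (v + w) (?t n) x \<partial>lborel)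
      \<longlonglongrightarrow> (\<integral>x. indicator (box a b) x * rderiv f v x \<partial>lborel) + (\<integral>x. indicator (box a b) x * rderiv f w x \<partial>lborel)"
      by simp
  qed
  have "AE x in lborel. rderiv f (v + w) x - rderiv f v x - rderiv f w x = 0"
  proof (rule AE_zero_if_box_integrals_zero)
    fix a b
    have e: "indicator (box a b) x * (rderiv f (v + w) x - rderiv f v x - rderiv f w x) =
      indicator (box a b) x * rderiv f (v + w) x - indicator (box a b) x * rderiv f v x - indicator (box a b) x * rderiv f w x" for x
      by (simp add: algebra_simps)
    show "integrable lborel (\<lambda>x. indicator (box a b) x * (rderiv f (v + w) x - rderiv f v x - rderiv f w x))"
      unfolding e by (intro Bochner_Integration.integrable_diff int)
    show "(\<integral>x. indicator (box a b) x * (rderiv f (v + w) x - rderiv f v x - rderiv f w x) \<partial>lborel) = 0"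
      unfolding e using int eq by (simp add: Bochner_Integration.integral_diff Bochner_Integration.integrable_diff)
  qed measurable
  then show ?thesis by eventually_elim simp
qed

text \<open>A positive factor rescales the time variable. A change of sign is out of reach for a
  one-sided limit and comes from additivity instead, since \<open>v + (- v) = 0\<close> has
  derivative zero.\<close>

lemma rderiv_scale_AE:
  fixes f :: "'a::euclidean_space \<Rightarrow> real"
  assumes lip: "L-lipschitz_on UNIV f"
  shows "AE x in lborel. rderiv f (c *\<^sub>R v) x = c * rderiv f v x"
proof -
  have pos: "AE x in lborel. rderiv f (c *\<^sub>R v) x = c * rderiv f v x" if "0 < c" for c v
    using rderiv_exists_AE[OF lip, of v] rderiv_exists_AE[OF lip, of "c *\<^sub>R v"]
  proof eventually_elim
    case (elim x)
    have "filterlim (\<lambda>t. c * t) (at_right 0) (at_right (0::real))"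
      unfolding filterlim_at using \<open>0 < c\<close>
      by (auto intro!: tendsto_eq_intros simp: eventually_at_right_less eventually_at_filter)
    then have "((\<lambda>t. c * diff_quot f v (c * t) x) \<longlongrightarrow> c * rderiv f v x) (at_right 0)"
      by (intro tendsto_mult tendsto_const filterlim_compose[OF elim(1)])
    moreover have "(\<lambda>t. c * diff_quot f v (c * t) x) = (\<lambda>t. diff_quot f (c *\<^sub>R v) t x)"
      using \<open>0 < c\<close> by (auto simp: diff_quot_def mult.commute)
    ultimately show ?case using elim(2) tendsto_unique[OF trivial_limit_at_right_real] by metis
  qed
  have neg: "AE x in lborel. rderiv f (- v) x = - rderiv f v x" for v
    using rderiv_add_AE[OF lip, of v "- v"] by eventually_elim (simp add: rderiv_zero)
  consider "c > 0" | "c = 0" | "c < 0" by linarith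
  then show ?thesis
  proof cases
    case 3
    then show ?thesis using pos[of "- c" v] neg[of "(- c) *\<^sub>R v"]
      by (auto elim: AE_mp)
  qed (use pos in \<open>auto simp: rderiv_zero\<close>)
qed

lemma rderiv_linear_AE:
  fixes f :: "'a::euclidean_space \<Rightarrow> real"
  assumes lip: "L-lipschitz_on UNIV f"
  shows "AE x in lborel. rderiv f v x = v \<bullet> (\<Sum>b\<in>Basis. rderiv f b x *\<^sub>R b)"
proof -
  have "AE x in lborel. rderiv f (\<Sum>b\<in>S. (v \<bullet> b) *\<^sub>R b) x = (\<Sum>b\<in>S. (v \<bullet> b) * rderiv f b x)" if "finite S" for S :: "'a set"
    using that
  proof (induction S)
    case (insert b S)
    show ?case
      using insert.IH rderiv_add_AE[OF lip, of "(v \<bullet> b) *\<^sub>R b" "\<Sum>b\<in>S. (v \<bullet> b) *\<^sub>R b"] rderiv_scale_AE[OF lip, of "v \<bullet> b" b]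
      by eventually_elim (simp add: insert.hyps)
  qed (simp add: rderiv_zero)
  from this[OF finite_Basis] show ?thesis
    by eventually_elim (simp add: euclidean_representation inner_sum_right mult.commute)
qed

section \<open>From directional derivatives to differentiability\<close>

text \<open>By compactness of the unit sphere finitely many directions of \<open>D\<close> come
  close to all of them, which makes the convergence uniform. The Lipschitz condition absorbs the
  replacement of a direction by a nearby one.\<close>

lemma lipschitz_has_derivative_if_dense:
  fixes f :: "'a::euclidean_space \<Rightarrow> real"
  assumes lip: "L-lipschitz_on UNIV f"
    and D: "\<And>X. open X \<Longrightarrow> X \<noteq> {} \<Longrightarrow> \<exists>d\<in>D. d \<in> X"
    and lim: "\<And>d. d \<in> D \<Longrightarrow> ((\<lambda>t. diff_quot f d t x) \<longlongrightarrow> d \<bullet> G) (at_right 0)"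
  shows "(f has_derivative (\<lambda>h. h \<bullet> G)) (at x)"
  unfolding has_derivative_at_alt
proof (intro conjI allI impI)
  show "bounded_linear (\<lambda>h. h \<bullet> G)" by (rule bounded_linear_inner_left)
  fix e :: real assume e: "e > 0"
  have L: "0 \<le> L" using lip by (rule lipschitz_on_nonneg)
  \<comment> \<open>Moving a direction by \<open>\<delta>\<close> costs at most
    \<open>(L + norm G) * \<delta>\<close> per unit length, to be kept below \<open>e / 2\<close>;
    the added one keeps the denominator positive.\<close>
  define \<delta> where "\<delta> = (e / 2) / (L + norm G + 1)"
  have \<delta>: "0 < \<delta>" "(L + norm G) * \<delta> \<le> e / 2"
  proof -
    have p: "0 < L + norm G + 1" using L norm_ge_zero[of G] by linarith
    then show "0 < \<delta>" using e by (simp add: \<delta>_def)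
    have "(L + norm G) * \<delta> \<le> (L + norm G + 1) * \<delta>" using \<open>0 < \<delta>\<close> by (intro mult_right_mono) auto
    also have "\<dots> = e / 2" 
    proof -
      have "a * (e / 2 / a) = e / 2" if "0 < a" for a using that by simp
      from this[OF p] show ?thesis by (simp add: \<delta>_def)
    qed
    finally show "(L + norm G) * \<delta> \<le> e / 2" .
  qed
  have "sphere 0 1 \<subseteq> (\<Union>d\<in>D. ball d \<delta>)"
  proof
    fix u :: 'a
    obtain d where "d \<in> D" "d \<in> ball u \<delta>" using D[of "ball u \<delta>"] \<delta> by auto
    then show "u \<in> (\<Union>d\<in>D. ball d \<delta>)" by (auto simp: dist_commute)
  qed
  then obtain D0 where D0: "D0 \<subseteq> D" "finite D0" "sphere 0 1 \<subseteq> (\<Union>d\<in>D0. ball d \<delta>)"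
    using compactE_image[OF compact_sphere, of D "\<lambda>d. ball d \<delta>" 0 1] by (metis open_ball)
  have "\<forall>\<^sub>F t in at_right 0. \<bar>diff_quot f d t x - d \<bullet> G\<bar> < e / 2" if "d \<in> D0" for d
    using tendstoD[OF lim, of d "e / 2"] that D0 e by (auto simp: dist_real_def)
  then have "\<forall>\<^sub>F t in at_right 0. \<forall>d\<in>D0. \<bar>diff_quot f d t x - d \<bullet> G\<bar> < e / 2"
    using D0(2) by (simp add: eventually_ball_finite)
  then obtain r where r: "r > 0" and rr: "\<And>t d. 0 < t \<Longrightarrow> t < r \<Longrightarrow> d \<in> D0 \<Longrightarrow> \<bar>diff_quot f d t x - d \<bullet> G\<bar> < e / 2"
    unfolding eventually_at_right_field by (metis)
  show "\<exists>d>0. \<forall>y. norm (y - x) < d \<longrightarrow> norm (f y - f x - (y - x) \<bullet> G) \<le> e * norm (y - x)"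
  proof (intro exI conjI allI impI)
    show "r > 0" by fact
    fix y assume y: "norm (y - x) < r"
    show "norm (f y - f x - (y - x) \<bullet> G) \<le> e * norm (y - x)"
    proof (cases "y = x")
      case False
      define t where "t = norm (y - x)"
      define u where "u = (1 / t) *\<^sub>R (y - x)"
      have t: "0 < t" "t < r" using False y by (auto simp: t_def)
      have yu: "y = x + t *\<^sub>R u" using t by (simp add: u_def)
      have "u \<in> sphere 0 1" using t by (simp add: u_def t_def)
      then obtain d where d: "d \<in> D0" "norm (u - d) < \<delta>" using D0(3) by (auto simp: dist_norm norm_minus_commute)
      have 1: "\<bar>f y - f (x + t *\<^sub>R d)\<bar> \<le> L * (t * norm (u - d))"
        using lipschitz_onD[OF lip, of y "x + t *\<^sub>R d"] t by (simp add: yu dist_norm flip: scaleR_diff_right)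
      have 2: "\<bar>f (x + t *\<^sub>R d) - f x - t * (d \<bullet> G)\<bar> \<le> t * (e / 2)"
      proof -
        have "f (x + t *\<^sub>R d) - f x - t * (d \<bullet> G) = t * (diff_quot f d t x - d \<bullet> G)"
          using t by (simp add: diff_quot_def field_simps)
        then show ?thesis using rr[OF t d(1)] t by (simp add: abs_mult)
      qed
      have 3: "\<bar>(d - u) \<bullet> G\<bar> \<le> norm (u - d) * norm G"
        using Cauchy_Schwarz_ineq2[of "d - u" G] by (simp add: norm_minus_commute)
      have 4: "\<bar>t * ((d - u) \<bullet> G)\<bar> \<le> t * (norm (u - d) * norm G)"
        using mult_left_mono[OF 3, of t] t by (simp add: abs_mult)
      have "f y - f x - (y - x) \<bullet> G = (f y - f (x + t *\<^sub>R d)) + (f (x + t *\<^sub>R d) - f x - t * (d \<bullet> G)) + t * ((d - u) \<bullet> G)"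
        by (simp add: yu inner_diff_left algebra_simps)
      then have "\<bar>f y - f x - (y - x) \<bullet> G\<bar> \<le> L * (t * norm (u - d)) + t * (e / 2) + t * (norm (u - d) * norm G)"
        using 1 2 4 by linarith
      also have "\<dots> = t * ((L + norm G) * norm (u - d) + e / 2)" by (simp add: algebra_simps)
      also have "\<dots> \<le> t * ((L + norm G) * \<delta> + e / 2)"
        using d t L by (intro mult_left_mono add_right_mono) auto
      also have "\<dots> \<le> t * e" using \<delta> t by (intro mult_left_mono) auto
      finally show ?thesis by (simp add: t_def mult.commute)
    qed simp
  qed
qed

text \<open>Existence and linearity of the derivative hold for each direction off a null set of its
  own. A countable dense set of directions leaves a single null set.\<close>

theorem lipschitz_differentiable_AE:
  fixes f :: "'a::euclidean_space \<Rightarrow> real"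
  assumes lip: "L-lipschitz_on UNIV f"
  shows "AE x in lborel. (f has_derivative (\<lambda>h. h \<bullet> (\<Sum>b\<in>Basis. rderiv f b x *\<^sub>R b))) (at x)"
proof -
  obtain D :: "'a set" where D: "countable D" "\<And>X. open X \<Longrightarrow> X \<noteq> {} \<Longrightarrow> \<exists>d\<in>D. d \<in> X"
    using countable_dense_setE by blast
  have "AE x in lborel. \<forall>d\<in>D. ((\<lambda>t. diff_quot f d t x) \<longlongrightarrow> d \<bullet> (\<Sum>b\<in>Basis. rderiv f b x *\<^sub>R b)) (at_right 0)"
  proof (subst AE_ball_countable[OF D(1)], rule ballI)
    fix d
    show "AE x in lborel. ((\<lambda>t. diff_quot f d t x) \<longlongrightarrow> d \<bullet> (\<Sum>b\<in>Basis. rderiv f b x *\<^sub>R b)) (at_right 0)"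
      using rderiv_exists_AE[OF lip, of d] rderiv_linear_AE[OF lip, of d] by eventually_elim simp
  qed
  then show ?thesis
    by eventually_elim (rule lipschitz_has_derivative_if_dense[OF lip D(2)], auto)
qed

section \<open>Increments of Lipschitz functions bounded by their derivatives\<close>

text \<open>Supplies the step for \<open>right_step_mono\<close>: box averages of difference
  quotients converge to a limit of at most \<open>c\<close> times the volume, so at some arbitrarily
  short time they are within \<open>e\<close> of that bound.\<close>

lemma box_increment_step:
  fixes g :: "'a::euclidean_space \<Rightarrow> real"
  assumes lip: "L-lipschitz_on UNIV g" and le: "AE x in lborel. rderiv g v x \<le> c"
    and "0 < e" "0 < d"
  shows "\<exists>t. 0 < t \<and> t \<le> d \<and> (\<integral>x. indicator (box a b) x * (g (x + t *\<^sub>R v) - g x) \<partial>lborel)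
    \<le> (c * measure lborel (box a b) + e) * t"
proof -
  have cont: "continuous_on UNIV g" using lip by (rule lipschitz_on_continuous_on)
  note [measurable] = diff_quot_measurable[OF cont] rderiv_measurable[OF cont]
  let ?t = "\<lambda>n. inverse (real (Suc n))"
  have fin: "emeasure lborel (box a b) < \<infinity>" using emeasure_bounded_finite[OF bounded_box] by blast
  have lim: "(\<lambda>n. \<integral>x. indicator (box a b) x * diff_quot g v (?t n) x \<partial>lborel)
    \<longlonglongrightarrow> (\<integral>x. indicator (box a b) x * rderiv g v x \<partial>lborel)"
    using rderiv_box_limit[OF lip, of a b v 0] by simp
  have "(\<integral>x. indicator (box a b) x * rderiv g v x \<partial>lborel) \<le> (\<integral>x. c * indicator (box a b) x \<partial>lborel)"
  proof (rule integral_mono_AE)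
    show "integrable lborel (\<lambda>x. indicator (box a b) x * rderiv g v x)"
      by (rule lborel_integrable_indicator_bounded[OF _ _ _ rderiv_bound_AE[OF lip]]) auto
    show "integrable lborel (\<lambda>x. c * indicator (box a b) x :: real)"
      using fin by (intro integrable_mult_right integrable_real_indicator) auto
    show "AE x in lborel. indicator (box a b) x * rderiv g v x \<le> c * indicator (box a b) x"
      using le by eventually_elim (auto simp: indicator_def)
  qed
  also have "\<dots> = c * measure lborel (box a b)" by simp
  finally have "(\<integral>x. indicator (box a b) x * rderiv g v x \<partial>lborel) < c * measure lborel (box a b) + e"
    using \<open>0 < e\<close> by simp
  from order_tendstoD(2)[OF lim this] 
  have "\<forall>\<^sub>F n in sequentially. (\<integral>x. indicator (box a b) x * diff_quot g v (?t n) x \<partial>lborel) < c * measure lborel (box a b) + e" .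
  moreover have "\<forall>\<^sub>F n in sequentially. ?t n < d"
    using order_tendstoD(2)[OF LIMSEQ_inverse_real_of_nat \<open>0 < d\<close>] .
  ultimately have "\<forall>\<^sub>F n in sequentially. (\<integral>x. indicator (box a b) x * diff_quot g v (?t n) x \<partial>lborel) < c * measure lborel (box a b) + e \<and> ?t n < d"
    by (rule eventually_conj)
  then obtain n where n: "(\<integral>x. indicator (box a b) x * diff_quot g v (?t n) x \<partial>lborel) < c * measure lborel (box a b) + e" "?t n < d"
    using eventually_happens'[OF sequentially_bot] by blast
  have "(\<integral>x. indicator (box a b) x * (g (x + ?t n *\<^sub>R v) - g x) \<partial>lborel) =
    (\<integral>x. ?t n * (indicator (box a b) x * diff_quot g v (?t n) x) \<partial>lborel)"
    by (intro Bochner_Integration.integral_cong) (auto simp: diff_quot_def)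
  also have "\<dots> = ?t n * (\<integral>x. indicator (box a b) x * diff_quot g v (?t n) x \<partial>lborel)"
    by (rule integral_mult_right_zero)
  also have "\<dots> \<le> ?t n * (c * measure lborel (box a b) + e)"
    using n by (intro mult_left_mono) auto
  finally show ?thesis using n by (intro exI[of _ "?t n"]) (auto simp: mult.commute)
qed

lemma lipschitz_on_translate:
  fixes c :: "'a::real_normed_vector"
  assumes "L-lipschitz_on UNIV f"
  shows "L-lipschitz_on UNIV (\<lambda>x. f (x + c))"
proof (rule lipschitz_onI)
  show "dist (f (x + c)) (f (y + c)) \<le> L * dist x y" for x y
    using lipschitz_onD[OF assms, of "x + c" "y + c"] by (simp add: dist_norm)
qed (rule lipschitz_on_nonneg[OF assms])

text \<open>The segment from \<open>x\<close> to \<open>x + v\<close> may avoid every point of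
  differentiability, so the bound cannot be integrated along it. A violation at \<open>x\<close>
  persists with margin \<open>\<eta>\<close> on an open box, whereas the box average
  \<open>\<phi>\<close> of the increments grows at rate at most \<open>c * m\<close>.\<close>

theorem lipschitz_increment_le:
  fixes f :: "'a::euclidean_space \<Rightarrow> real"
  assumes lip: "L-lipschitz_on UNIV f"
    and bound: "\<And>x f'. (f has_derivative f') (at x) \<Longrightarrow> f' v \<le> c"
  shows "f (x + v) - f x \<le> c"
proof (rule ccontr)
  assume "\<not> ?thesis"
  then have gt: "c < f (x + v) - f x" by simp
  have cont: "continuous_on UNIV f" using lip by (rule lipschitz_on_continuous_on)
  have [measurable]: "f \<in> borel_measurable borel" by (rule borel_measurable_continuous_onI[OF cont])
  define \<eta> where "\<eta> = (f (x + v) - f x - c) / 2"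
  have \<eta>: "0 < \<eta>" "c + \<eta> < f (x + v) - f x" using gt by (auto simp: \<eta>_def field_simps)
  have op: "open {x. c + \<eta> < f (x + v) - f x}"
    by (intro open_Collect_less continuous_intros continuous_on_compose2[OF cont]) auto
  have "x \<in> {x. c + \<eta> < f (x + v) - f x}" using \<eta> by simp
  from open_contains_box[OF op this]
  obtain a b where ab: "box a b \<subseteq> {x. c + \<eta> < f (x + v) - f x}" "\<forall>i\<in>Basis. a \<bullet> i < b \<bullet> i"
    by metis
  define m where "m = measure lborel (box a b)"
  have fin: "emeasure lborel (box a b) < \<infinity>" using emeasure_bounded_finite[OF bounded_box] by blast
  have m: "0 < m" unfolding m_def using ab(2) by (subst measure_lborel_box_eq) (auto simp: inner_diff_left intro!: prod_pos less_imp_le)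
  define \<phi> where "\<phi> s = (\<integral>x. indicator (box a b) x * (f (x + s *\<^sub>R v) - f x) \<partial>lborel)" for s
  have int: "integrable lborel (\<lambda>x. indicator (box a b) x * (f (x + s *\<^sub>R v) - f (x + t *\<^sub>R v)))" for s t
  proof (rule lborel_integrable_indicator_bounded)
    show "AE x in lborel. \<bar>f (x + s *\<^sub>R v) - f (x + t *\<^sub>R v)\<bar> \<le> L * norm (s *\<^sub>R v - t *\<^sub>R v)"
    proof (rule AE_I2)
      fix x
      show "\<bar>f (x + s *\<^sub>R v) - f (x + t *\<^sub>R v)\<bar> \<le> L * norm (s *\<^sub>R v - t *\<^sub>R v)"
        using lipschitz_onD[OF lip, of "x + s *\<^sub>R v" "x + t *\<^sub>R v"] by (simp add: dist_norm)
    qed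
  qed auto
  have \<phi>_diff: "\<phi> s - \<phi> t = (\<integral>x. indicator (box a b) x * (f (x + s *\<^sub>R v) - f (x + t *\<^sub>R v)) \<partial>lborel)" for s t
    unfolding \<phi>_def using int[of s 0] int[of t 0]
    by (subst Bochner_Integration.integral_diff[symmetric]) (auto simp: algebra_simps intro!: Bochner_Integration.integral_cong)
  have "(L * norm v * m)-lipschitz_on {0..1} \<phi>"
  proof (rule lipschitz_onI)
    show "0 \<le> L * norm v * m" using m lipschitz_on_nonneg[OF lip] by simp
    fix s t
    have "\<bar>\<phi> s - \<phi> t\<bar> \<le> (\<integral>x. \<bar>indicator (box a b) x * (f (x + s *\<^sub>R v) - f (x + t *\<^sub>R v))\<bar> \<partial>lborel)"
      unfolding \<phi>_diff by (rule integral_abs_bound)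
    also have "\<dots> \<le> (\<integral>x. (L * norm v * \<bar>s - t\<bar>) * indicator (box a b) x \<partial>lborel)"
    proof (rule integral_mono)
      show "integrable lborel (\<lambda>x. (L * norm v * \<bar>s - t\<bar>) * indicator (box a b) x :: real)"
        using fin by (intro integrable_mult_right integrable_real_indicator) auto
      fix x
      have "\<bar>f (x + s *\<^sub>R v) - f (x + t *\<^sub>R v)\<bar> \<le> L * (\<bar>s - t\<bar> * norm v)"
        using lipschitz_onD[OF lip, of "x + s *\<^sub>R v" "x + t *\<^sub>R v"]
        by (simp add: dist_norm flip: scaleR_diff_left)
      then show "\<bar>indicator (box a b) x * (f (x + s *\<^sub>R v) - f (x + t *\<^sub>R v))\<bar> \<le> (L * norm v * \<bar>s - t\<bar>) * indicator (box a b) x"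
        by (auto simp: indicator_def mult_ac)
    qed (use int in auto)
    also have "\<dots> = L * norm v * \<bar>s - t\<bar> * m" by (simp add: m_def)
    finally show "dist (\<phi> s) (\<phi> t) \<le> L * norm v * m * dist s t" by (simp add: dist_real_def mult_ac)
  qed
  then have \<phi>_cont: "continuous_on {0..1} \<phi>" by (rule lipschitz_on_continuous_on)
  \<comment> \<open>Translating \<open>f\<close> by \<open>s v\<close> carries the derivative bound
    to every intermediate time.\<close>
  have le: "AE x in lborel. rderiv (\<lambda>x. f (x + s *\<^sub>R v)) v x \<le> c" for s
    using lipschitz_differentiable_AE[OF lipschitz_on_translate[OF lip, of "s *\<^sub>R v"]]
      rderiv_linear_AE[OF lipschitz_on_translate[OF lip, of "s *\<^sub>R v"], of v]
  proof eventually_elim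
    case (elim x)
    have "((\<lambda>y. f (y - s *\<^sub>R v + s *\<^sub>R v)) has_derivative (\<lambda>h. h \<bullet> (\<Sum>b\<in>Basis. rderiv (\<lambda>x. f (x + s *\<^sub>R v)) b x *\<^sub>R b))) (at (x + s *\<^sub>R v))"
      by (rule has_derivative_compose[of "\<lambda>y. y - s *\<^sub>R v" "\<lambda>h. h" "x + s *\<^sub>R v" UNIV "\<lambda>y. f (y + s *\<^sub>R v)"])
        (use elim(1) in \<open>auto intro!: derivative_eq_intros\<close>)
    then show ?case using bound[of _ "x + s *\<^sub>R v"] elim(2) by simp
  qed
  have "\<phi> 1 \<le> c * m + e" if e: "0 < e" for e
  proof -
    \<comment> \<open>The slack \<open>e\<close> in the slope turns a bound on the limiting rate
      into an actual step at each time.\<close>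
    define \<Psi> where "\<Psi> s = (c * m + e) * s - \<phi> s" for s
    have "\<Psi> 0 \<le> \<Psi> 1"
    proof (rule right_step_mono[of 0 1 \<Psi>])
      show "continuous_on {0..1} \<Psi>" unfolding \<Psi>_def by (intro continuous_intros \<phi>_cont)
      fix s :: real assume s: "0 \<le> s" "s < 1"
      obtain t where t: "0 < t" "t \<le> 1 - s"
        "(\<integral>x. indicator (box a b) x * (f (x + t *\<^sub>R v + s *\<^sub>R v) - f (x + s *\<^sub>R v)) \<partial>lborel) \<le> (c * m + e) * t"
        using box_increment_step[OF lipschitz_on_translate[OF lip, of "s *\<^sub>R v"] le e, of "1 - s" a b] s unfolding m_def by auto
      have "\<phi> (s + t) - \<phi> s \<le> (c * m + e) * t"
        unfolding \<phi>_diff using t(3) by (simp add: scaleR_add_left add_ac)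
      then show "\<exists>y>s. y \<le> 1 \<and> \<Psi> s \<le> \<Psi> y"
        using t by (intro exI[of _ "s + t"]) (auto simp: \<Psi>_def algebra_simps)
    qed simp
    then show ?thesis by (simp add: \<Psi>_def \<phi>_def)
  qed
  then have "\<phi> 1 \<le> c * m" by (rule field_le_epsilon)
  moreover have "(c + \<eta>) * m \<le> \<phi> 1"
  proof -
    have "(\<integral>x. (c + \<eta>) * indicator (box a b) x \<partial>lborel) \<le> \<phi> 1"
      unfolding \<phi>_def
    proof (rule integral_mono)
      show "integrable lborel (\<lambda>x. (c + \<eta>) * indicator (box a b) x :: real)"
        using fin by (intro integrable_mult_right integrable_real_indicator) auto
      show "integrable lborel (\<lambda>x. indicator (box a b) x * (f (x + 1 *\<^sub>R v) - f x))"
        using int[of 1 0] by simp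
      show "(c + \<eta>) * indicator (box a b) x \<le> indicator (box a b) x * (f (x + 1 *\<^sub>R v) - f x)" for x
        using ab(1) by (auto simp: indicator_def)
    qed
    then show ?thesis by (simp add: m_def)
  qed
  ultimately have "\<eta> * m \<le> 0" by (simp add: algebra_simps)
  then show False using \<eta> m by (simp add: mult_le_0_iff)
qed

section \<open>The standard Gaussian measure\<close>

text \<open>The product form suits coordinatewise integration. The radial form
  \<open>gauss_density_eq\<close> is the one used for shifts and for self-duality under the Fourier
  transform.\<close>

definition gauss_density :: "'a::euclidean_space \<Rightarrow> real" where
  "gauss_density x = (\<Prod>b\<in>Basis. std_normal_density (x \<bullet> b))"

definition std_gauss :: "'a::euclidean_space measure" where
  "std_gauss = density lborel (\<lambda>x. ennreal (gauss_density x))"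

lemma gauss_density_measurable [measurable]: "gauss_density \<in> borel_measurable borel"
  unfolding gauss_density_def by measurable

lemma gauss_density_pos: "0 < gauss_density x"
  unfolding gauss_density_def by (intro prod_pos) (simp add: normal_density_pos)

lemma gauss_density_nonneg [simp]: "0 \<le> gauss_density x"
  using gauss_density_pos[of x] by simp

lemma gauss_density_eq:
  fixes x :: "'a::euclidean_space"
  shows "gauss_density x = (1 / sqrt (2 * pi)) ^ DIM('a) * exp (- (norm x)\<^sup>2 / 2)"
proof -
  have "gauss_density x = (\<Prod>b\<in>(Basis::'a set). 1 / sqrt (2 * pi)) * (\<Prod>b\<in>Basis. exp (- (x \<bullet> b)\<^sup>2 / 2))"
    unfolding gauss_density_def prod.distrib[symmetric] by (simp add: std_normal_density_def)
  also have "(\<Prod>b\<in>Basis. exp (- (x \<bullet> b)\<^sup>2 / 2)) = exp (\<Sum>b\<in>Basis. - (x \<bullet> b)\<^sup>2 / 2)"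
    by (simp add: exp_sum)
  also have "(\<Sum>b\<in>Basis. - (x \<bullet> b)\<^sup>2 / 2) = - (norm x)\<^sup>2 / 2"
    unfolding power2_norm_eq_inner by (subst euclidean_inner)
      (simp add: sum_negf sum_divide_distrib power2_eq_square)
  finally show ?thesis by simp
qed

lemma sets_std_gauss [simp, measurable_cong]: "sets std_gauss = sets borel"
  by (simp add: std_gauss_def)

lemma space_std_gauss [simp]: "space std_gauss = UNIV"
  by (simp add: std_gauss_def)

interpretation lborel_product: product_sigma_finite "\<lambda>_. lborel :: real measure"
  by standard

lemma lborel_integral_prod:
  fixes g :: "'a::euclidean_space \<Rightarrow> real \<Rightarrow> 'b::{real_normed_field, banach, second_countable_topology}"
  assumes "\<And>b. b \<in> Basis \<Longrightarrow> integrable lborel (g b)"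
  shows "integrable lborel (\<lambda>x::'a. \<Prod>b\<in>Basis. g b (x \<bullet> b))"
    and "(\<integral>x. (\<Prod>b\<in>Basis. g b (x \<bullet> b)) \<partial>lborel) = (\<Prod>b\<in>Basis. \<integral>t. g b t \<partial>lborel)"
proof -
  have [measurable]: "b \<in> Basis \<Longrightarrow> g b \<in> borel_measurable borel" for b
    using borel_measurable_integrable[OF assms] by simp
  have coord: "(\<Prod>b\<in>Basis. g b ((\<Sum>b'\<in>Basis. f b' *\<^sub>R b') \<bullet> b)) = (\<Prod>b\<in>(Basis::'a set). g b (f b))" for f
    by (intro prod.cong) auto
  show "integrable lborel (\<lambda>x::'a. \<Prod>b\<in>Basis. g b (x \<bullet> b))"
    by (subst lborel_eq, subst integrable_distr_eq)
      (auto simp: coord intro!: lborel_product.product_integrable_prod assms)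
  show "(\<integral>x. (\<Prod>b\<in>Basis. g b (x \<bullet> b)) \<partial>lborel) = (\<Prod>b\<in>Basis. \<integral>t. g b t \<partial>lborel)"
    by (subst lborel_eq, subst integral_distr)
      (auto simp: coord intro!: lborel_product.product_integral_prod assms)
qed

lemma integral_std_gauss:
  fixes g :: "'a::euclidean_space \<Rightarrow> 'b::{banach, second_countable_topology}"
  assumes "g \<in> borel_measurable borel"
  shows "(\<integral>x. g x \<partial>std_gauss) = (\<integral>x. gauss_density x *\<^sub>R g x \<partial>lborel)"
    and "integrable std_gauss g \<longleftrightarrow> integrable lborel (\<lambda>x. gauss_density x *\<^sub>R g x)"
  using assms unfolding std_gauss_def by (intro integral_density integrable_density; simp)+

lemma prob_space_std_gauss: "prob_space (std_gauss :: 'a::euclidean_space measure)"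
proof
  have "emeasure (std_gauss :: 'a measure) (space std_gauss) = (\<integral>\<^sup>+x. (\<Prod>b\<in>(Basis::'a set). ennreal (std_normal_density (x \<bullet> b))) \<partial>lborel)"
    by (simp add: std_gauss_def emeasure_density gauss_density_def prod_ennreal)
  also have "\<dots> = (\<Prod>b\<in>(Basis::'a set). (\<integral>\<^sup>+x. ennreal (std_normal_density x) \<partial>lborel))"
    by (rule nn_integral_lborel_prod) auto
  also have "(\<integral>\<^sup>+x. ennreal (std_normal_density x) \<partial>lborel) = 1"
    by (subst nn_integral_eq_integral) (auto simp: integrable_normal_density integral_normal_density)
  finally show "emeasure (std_gauss :: 'a measure) (space std_gauss) = 1" by simp
qed

interpretation std_gauss: prob_space "std_gauss :: 'a::euclidean_space measure"
  by (rule prob_space_std_gauss)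

lemma char_std_gauss:
  fixes u :: "'a::euclidean_space"
  shows "(\<integral>x. iexp (u \<bullet> x) \<partial>std_gauss) = complex_of_real (exp (- (norm u)\<^sup>2 / 2))"
proof -
  have 1: "iexp (u \<bullet> x) = (\<Prod>b\<in>Basis. iexp ((u \<bullet> b) * (x \<bullet> b)))" for x
    by (subst euclidean_inner) (simp add: exp_sum[symmetric] sum_distrib_left)
  have int: "integrable lborel (\<lambda>t. std_normal_density t *\<^sub>R iexp (c * t))" for c :: real
    by (rule Bochner_Integration.integrable_bound[OF integrable_normal_density[of 1 0]]) auto
  have ch: "(\<integral>t. std_normal_density t *\<^sub>R iexp (c * t) \<partial>lborel) = complex_of_real (exp (- c\<^sup>2 / 2))" for c :: real
    using fun_cong[OF char_std_normal_distribution, of c]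
    unfolding char_def by (subst (asm) integral_density) auto
  have "(\<integral>x. iexp (u \<bullet> x) \<partial>std_gauss) = (\<integral>x. (\<Prod>b\<in>Basis. std_normal_density (x \<bullet> b) *\<^sub>R iexp ((u \<bullet> b) * (x \<bullet> b))) \<partial>lborel)"
    by (subst integral_std_gauss) (auto simp: 1 gauss_density_def prod.distrib scaleR_conv_of_real)
  also have "\<dots> = (\<Prod>b\<in>Basis. complex_of_real (exp (- (u \<bullet> b)\<^sup>2 / 2)))"
    by (subst lborel_integral_prod(2)[of "\<lambda>b t. std_normal_density t *\<^sub>R iexp ((u \<bullet> b) * t)"]) (simp_all only: int ch)
  also have "\<dots> = complex_of_real (exp (\<Sum>b\<in>Basis. - (u \<bullet> b)\<^sup>2 / 2))"
    by (simp add: exp_sum)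
  also have "(\<Sum>b\<in>Basis. - (u \<bullet> b)\<^sup>2 / 2) = - (norm u)\<^sup>2 / 2"
    unfolding power2_norm_eq_inner by (subst euclidean_inner)
      (simp add: sum_negf sum_divide_distrib power2_eq_square)
  finally show ?thesis .
qed

text \<open>Completing the square turns \<open>exp (a * t)\<close> times the standard density into a
  multiple of the density centred at \<open>a\<close>. The absolute value is covered by adding the
  cases \<open>a = c\<close> and \<open>a = - c\<close>.\<close>

lemma integrable_std_normal_exp_abs:
  fixes c :: real
  shows "integrable lborel (\<lambda>t. std_normal_density t * exp (c * \<bar>t\<bar>))"
proof (rule Bochner_Integration.integrable_bound)
  show "integrable lborel (\<lambda>t. exp (c\<^sup>2 / 2) * normal_density c 1 t + exp (c\<^sup>2 / 2) * normal_density (- c) 1 t)"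
    by (intro Bochner_Integration.integrable_add integrable_mult_right integrable_normal_density) auto
  have 1: "std_normal_density t * exp (a * t) = exp (a\<^sup>2 / 2) * normal_density a 1 t" for a t :: real
    by (simp add: normal_density_def mult_exp_exp power2_eq_square field_simps)
  show "AE t in lborel. norm (std_normal_density t * exp (c * \<bar>t\<bar>))
    \<le> norm (exp (c\<^sup>2 / 2) * normal_density c 1 t + exp (c\<^sup>2 / 2) * normal_density (- c) 1 t)"
  proof (rule AE_I2)
    fix t :: real
    have "std_normal_density t * exp (c * \<bar>t\<bar>) \<le> std_normal_density t * exp (c * t) + std_normal_density t * exp (- c * t)"
      by (cases "0 \<le> t") (auto simp: normal_density_nonneg)
    also have "\<dots> = exp (c\<^sup>2 / 2) * normal_density c 1 t + exp (c\<^sup>2 / 2) * normal_density (- c) 1 t"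
      using 1[of t c] 1[of t "- c"] by simp
    finally show "norm (std_normal_density t * exp (c * \<bar>t\<bar>))
      \<le> norm (exp (c\<^sup>2 / 2) * normal_density c 1 t + exp (c\<^sup>2 / 2) * normal_density (- c) 1 t)"
      by (simp add: normal_density_nonneg)
  qed
qed measurable

text \<open>The Euclidean norm is at most the sum of the absolute coordinates, and the exponential
  of that sum factorises. Integrability of functions of exponential growth rests on this.\<close>

lemma integrable_std_gauss_exp_norm:
  "integrable std_gauss (\<lambda>x::'a::euclidean_space. exp (c * norm x))"
proof -
  have pos: "integrable std_gauss (\<lambda>x::'a. exp (c * norm x))" if c: "0 \<le> c" for c
  proof -
    have "integrable lborel (\<lambda>x::'a. gauss_density x * exp (c * norm x))"
    proof (rule Bochner_Integration.integrable_bound)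
      show "integrable lborel (\<lambda>x::'a. \<Prod>b\<in>Basis. std_normal_density (x \<bullet> b) * exp (c * \<bar>x \<bullet> b\<bar>))"
        by (rule lborel_integral_prod(1)[of "\<lambda>b t. std_normal_density t * exp (c * \<bar>t\<bar>)"]) (rule integrable_std_normal_exp_abs)
      show "AE x in lborel. norm (gauss_density x * exp (c * norm x))
        \<le> norm (\<Prod>b\<in>(Basis::'a set). std_normal_density (x \<bullet> b) * exp (c * \<bar>x \<bullet> b\<bar>))"
      proof (rule AE_I2)
        fix x :: 'a
        have "exp (c * norm x) \<le> exp (\<Sum>b\<in>Basis. c * \<bar>x \<bullet> b\<bar>)"
          using mult_left_mono[OF norm_le_l1[of x] c] by (simp add: sum_distrib_left)
        then have "gauss_density x * exp (c * norm x) \<le> gauss_density x * (\<Prod>b\<in>Basis. exp (c * \<bar>x \<bullet> b\<bar>))"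
          by (intro mult_left_mono) (auto simp: exp_sum)
        then show "norm (gauss_density x * exp (c * norm x))
          \<le> norm (\<Prod>b\<in>(Basis::'a set). std_normal_density (x \<bullet> b) * exp (c * \<bar>x \<bullet> b\<bar>))"
          by (simp add: gauss_density_def prod.distrib abs_mult abs_prod normal_density_nonneg)
      qed
    qed measurable
    then show ?thesis by (subst integral_std_gauss(2)) auto
  qed
  show ?thesis
  proof (rule Bochner_Integration.integrable_bound[OF pos[of "\<bar>c\<bar>"]])
    show "AE x in std_gauss. norm (exp (c * norm x)) \<le> norm (exp (\<bar>c\<bar> * norm (x::'a)))"
      by (rule AE_I2) (auto intro!: mult_right_mono)
  qed auto
qed

lemma integrable_std_gauss_bound:
  fixes g :: "'a::euclidean_space \<Rightarrow> 'b::{banach, second_countable_topology}"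
  assumes "g \<in> borel_measurable borel" and "\<And>x. norm (g x) \<le> A * exp (c * norm x)"
  shows "integrable std_gauss g"
proof (rule Bochner_Integration.integrable_bound)
  show "integrable std_gauss (\<lambda>x::'a. A * exp (c * norm x))"
    by (intro integrable_mult_right integrable_std_gauss_exp_norm)
  show "AE x in std_gauss. norm (g x) \<le> norm (A * exp (c * norm x))"
    by (rule AE_I2, rule order_trans[OF assms(2)]) simp
qed (use assms in simp)

text \<open>Reduces the moments of linear functionals to the one-dimensional normal law.\<close>

lemma distr_std_gauss_inner:
  fixes u :: "'a::euclidean_space"
  shows "distr std_gauss borel (\<lambda>x. u \<bullet> x) = distr std_normal_distribution borel (\<lambda>t. norm u * t)"
proof (rule Levy_uniqueness)
  interpret N: prob_space std_normal_distribution by (rule prob_space_normal_density) simp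
  show "real_distribution (distr std_gauss borel (\<lambda>x. u \<bullet> x))"
    by (intro real_distribution.intro std_gauss.prob_space_distr) (auto simp: real_distribution_axioms_def)
  show "real_distribution (distr std_normal_distribution borel (\<lambda>t. norm u * t))"
    by (intro real_distribution.intro N.prob_space_distr) (auto simp: real_distribution_axioms_def)
  show "char (distr std_gauss borel (\<lambda>x. u \<bullet> x)) = char (distr std_normal_distribution borel (\<lambda>t. norm u * t))"
  proof
    fix t
    have "char (distr std_gauss borel (\<lambda>x. u \<bullet> x)) t = (\<integral>x. iexp ((t *\<^sub>R u) \<bullet> x) \<partial>std_gauss)"
      unfolding char_def by (subst integral_distr) auto
    also have "\<dots> = complex_of_real (exp (- (t * norm u)\<^sup>2 / 2))"
      by (subst char_std_gauss) (simp add: power_mult_distrib)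
    also have "\<dots> = char std_normal_distribution (t * norm u)"
      by (simp add: char_std_normal_distribution)
    also have "\<dots> = char (distr std_normal_distribution borel (\<lambda>t. norm u * t)) t"
      unfolding char_def by (subst integral_distr) (auto simp: mult_ac)
    finally show "char (distr std_gauss borel (\<lambda>x. u \<bullet> x)) t = char (distr std_normal_distribution borel (\<lambda>t. norm u * t)) t" .
  qed
qed

lemma std_gauss_inner_moments:
  fixes u :: "'a::euclidean_space"
  shows "(\<integral>x. u \<bullet> x \<partial>std_gauss) = 0" "(\<integral>x. (u \<bullet> x)\<^sup>2 \<partial>std_gauss) = (norm u)\<^sup>2"
proof -
  have "(\<integral>x. u \<bullet> x \<partial>std_gauss) = (\<integral>t. t \<partial>distr std_gauss borel (\<lambda>x. u \<bullet> x))"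
    by (subst integral_distr) auto
  also have "\<dots> = (\<integral>t. norm u * t \<partial>std_normal_distribution)"
    unfolding distr_std_gauss_inner by (subst integral_distr) auto
  also have "\<dots> = 0" using integral_std_normal_distribution_moment_odd[of 1] by simp
  finally show "(\<integral>x. u \<bullet> x \<partial>std_gauss) = 0" .
  have "(\<integral>x. (u \<bullet> x)\<^sup>2 \<partial>std_gauss) = (\<integral>t. t\<^sup>2 \<partial>distr std_gauss borel (\<lambda>x. u \<bullet> x))"
    by (subst integral_distr) auto
  also have "\<dots> = (\<integral>t. (norm u)\<^sup>2 * t\<^sup>2 \<partial>std_normal_distribution)"
    unfolding distr_std_gauss_inner by (subst integral_distr) (auto simp: power_mult_distrib)
  also have "\<dots> = (norm u)\<^sup>2" using std_normal_distribution_even_moments[of 1]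
    by (simp add: has_bochner_integral_integral_eq)
  finally show "(\<integral>x. (u \<bullet> x)\<^sup>2 \<partial>std_gauss) = (norm u)\<^sup>2" .
qed

section \<open>Uniqueness of characteristic functions\<close>

lemma nn_integral_std_gauss:
  assumes [measurable]: "g \<in> borel_measurable borel"
  shows "(\<integral>\<^sup>+x. g x \<partial>std_gauss) = (\<integral>\<^sup>+x. ennreal (gauss_density x) * g x \<partial>lborel)"
  unfolding std_gauss_def by (rule nn_integral_density) auto

text \<open>Self-duality of the Gaussian density expresses the density of \<open>M\<close> smoothed by a small Gaussian
  through the characteristic function of \<open>M\<close> alone.\<close>

lemma gauss_density_fourier:
  fixes x :: "'a::euclidean_space"
  shows "complex_of_real (gauss_density x) =
    complex_of_real ((1 / sqrt (2 * pi)) ^ DIM('a)) * (\<integral>w. iexp (x \<bullet> w) \<partial>std_gauss)"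
  by (simp add: gauss_density_eq char_std_gauss)

lemma gauss_density_le: "gauss_density (x :: 'a::euclidean_space) \<le> (1 / sqrt (2 * pi)) ^ DIM('a)"
  unfolding gauss_density_eq by (intro mult_right_le_one_le) auto

definition char_fun :: "'a::euclidean_space measure \<Rightarrow> 'a \<Rightarrow> complex" where
  "char_fun M u = (\<integral>x. iexp (u \<bullet> x) \<partial>M)"

lemma integral_gauss_density_char_fun:
  fixes M :: "'a::euclidean_space measure"
  assumes M: "prob_space M" "sets M = sets borel"
  shows "complex_of_real (\<integral>x. gauss_density (a *\<^sub>R (y - x)) \<partial>M) =
    complex_of_real ((1 / sqrt (2 * pi)) ^ DIM('a)) * (\<integral>w. iexp (a * (y \<bullet> w)) * char_fun M (- a *\<^sub>R w) \<partial>std_gauss)"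
proof -
  interpret M: prob_space M by fact
  interpret P: pair_prob_space M "std_gauss :: 'a measure" ..
  have [measurable_cong]: "sets M = sets borel" by fact
  let ?K = "complex_of_real ((1 / sqrt (2 * pi)) ^ DIM('a))"
  have "complex_of_real (\<integral>x. gauss_density (a *\<^sub>R (y - x)) \<partial>M) = (\<integral>x. complex_of_real (gauss_density (a *\<^sub>R (y - x))) \<partial>M)"
    by (rule integral_complex_of_real[symmetric])
  also have "\<dots> = ?K * (\<integral>x. (\<integral>w. iexp (a * (y \<bullet> w)) * iexp ((- a *\<^sub>R w) \<bullet> x) \<partial>std_gauss) \<partial>M)"
    unfolding gauss_density_fourier
    by (simp only: integral_mult_right_zero)
      (simp add: inner_diff_left inner_commute mult_exp_exp algebra_simps)
  also have "(\<integral>x. (\<integral>w. iexp (a * (y \<bullet> w)) * iexp ((- a *\<^sub>R w) \<bullet> x) \<partial>std_gauss) \<partial>M) =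
      (\<integral>w. (\<integral>x. iexp (a * (y \<bullet> w)) * iexp ((- a *\<^sub>R w) \<bullet> x) \<partial>M) \<partial>std_gauss)"
  proof (rule P.Fubini_integral[symmetric])
    show "integrable (M \<Otimes>\<^sub>M std_gauss) (\<lambda>(x, w). iexp (a * (y \<bullet> w)) * iexp ((- a *\<^sub>R w) \<bullet> x))"
      by (rule P.integrable_const_bound[where B = 1]) (auto simp: norm_mult case_prod_beta)
  qed
  finally show ?thesis by (simp add: char_fun_def)
qed

text \<open>Both sides integrate \<open>F\<close> against the law of \<open>x + e Z\<close> with
  \<open>x\<close> drawn from \<open>M\<close>; the density of that law is the scaled Gaussian
  kernel averaged over \<open>M\<close>. The substitution \<open>y = x + e z\<close> produces the
  power of \<open>1 / e\<close>.\<close>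

lemma nn_integral_gauss_convolution:
  fixes M :: "'a::euclidean_space measure"
  assumes M: "prob_space M" "sets M = sets borel" and e: "0 < e" and F [measurable]: "F \<in> borel_measurable borel"
  shows "(\<integral>\<^sup>+x. (\<integral>\<^sup>+z. F (x + e *\<^sub>R z) \<partial>std_gauss) \<partial>M) =
    (\<integral>\<^sup>+y. ennreal ((1 / e) ^ DIM('a)) * F y * ennreal (\<integral>x. gauss_density ((1 / e) *\<^sub>R (y - x)) \<partial>M) \<partial>lborel)"
proof -
  interpret M: prob_space M by fact
  interpret P: pair_sigma_finite M "lborel :: 'a measure" ..
  have [measurable_cong]: "sets M = sets borel" by fact
  let ?c = "ennreal ((1 / e) ^ DIM('a))"
  let ?G = "\<lambda>x y. ennreal (gauss_density ((1 / e) *\<^sub>R (y - x)))"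
  have inner: "(\<integral>\<^sup>+z. F (x + e *\<^sub>R z) \<partial>std_gauss) = (\<integral>\<^sup>+y. ?c * F y * ?G x y \<partial>lborel)" for x
  proof -
    have "(\<integral>\<^sup>+y. ?c * F y * ?G x y \<partial>lborel) =
      (\<integral>\<^sup>+y. ?c * F y * ?G x y \<partial>density (distr lborel borel (\<lambda>z. x + e *\<^sub>R z)) (\<lambda>_. \<bar>e\<bar> ^ DIM('a)))"
      using e by (subst lborel_affine[of e x]) auto
    also have "\<dots> = (\<integral>\<^sup>+z. ennreal (\<bar>e\<bar> ^ DIM('a)) * (?c * F (x + e *\<^sub>R z) * ?G x (x + e *\<^sub>R z)) \<partial>lborel)"
      by (subst nn_integral_density) (auto simp: nn_integral_distr)
    also have "\<dots> = (\<integral>\<^sup>+z. ennreal (gauss_density z) * F (x + e *\<^sub>R z) \<partial>lborel)"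
    proof (rule nn_integral_cong)
      fix z
      have "ennreal (\<bar>e\<bar> ^ DIM('a)) * ?c = 1"
        using e by (simp add: ennreal_mult[symmetric] power_mult_distrib[symmetric])
      then have "ennreal (\<bar>e\<bar> ^ DIM('a)) * (?c * F (x + e *\<^sub>R z) * ?G x (x + e *\<^sub>R z)) = F (x + e *\<^sub>R z) * ?G x (x + e *\<^sub>R z)"
        by (metis mult.assoc mult_1)
      then show "ennreal (\<bar>e\<bar> ^ DIM('a)) * (?c * F (x + e *\<^sub>R z) * ?G x (x + e *\<^sub>R z)) = ennreal (gauss_density z) * F (x + e *\<^sub>R z)"
        using e by (simp add: mult.commute)
    qed
    finally show ?thesis by (subst nn_integral_std_gauss) auto
  qed
  have "(\<integral>\<^sup>+x. (\<integral>\<^sup>+z. F (x + e *\<^sub>R z) \<partial>std_gauss) \<partial>M) = (\<integral>\<^sup>+y. (\<integral>\<^sup>+x. ?c * F y * ?G x y \<partial>M) \<partial>lborel)"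
    unfolding inner by (rule P.Fubini'[symmetric]) measurable
  also have "\<dots> = (\<integral>\<^sup>+y. ?c * F y * (\<integral>\<^sup>+x. ?G x y \<partial>M) \<partial>lborel)"
    by (intro nn_integral_cong nn_integral_cmult) measurable
  also have "\<dots> = (\<integral>\<^sup>+y. ?c * F y * ennreal (\<integral>x. gauss_density ((1 / e) *\<^sub>R (y - x)) \<partial>M) \<partial>lborel)"
  proof (intro nn_integral_cong)
    fix y
    have "(\<integral>\<^sup>+x. ?G x y \<partial>M) = ennreal (\<integral>x. gauss_density ((1 / e) *\<^sub>R (y - x)) \<partial>M)"
    proof (rule nn_integral_eq_integral)
      show "integrable M (\<lambda>x. gauss_density ((1 / e) *\<^sub>R (y - x)))"
        by (rule M.integrable_const_bound[where B = "(1 / sqrt (2 * pi)) ^ DIM('a)"]) (auto simp: gauss_density_le)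
    qed auto
    then show "?c * F y * (\<integral>\<^sup>+x. ?G x y \<partial>M) = ?c * F y * ennreal (\<integral>x. gauss_density ((1 / e) *\<^sub>R (y - x)) \<partial>M)"
      by simp
  qed
  finally show ?thesis .
qed

text \<open>The first claim removes the smoothing in the limit. The second rewrites the smoothed
  integral in the nonnegative form for which the density formula is stated.\<close>

lemma gauss_convolution_limit:
  fixes M :: "'a::euclidean_space measure" and F :: "'a \<Rightarrow> real"
  assumes M: "prob_space M" "sets M = sets borel" and F: "continuous_on UNIV F" "\<And>x. 0 \<le> F x" "\<And>x. F x \<le> 1"
  shows "(\<lambda>n. \<integral>x. (\<integral>z. F (x + inverse (real (Suc n)) *\<^sub>R z) \<partial>std_gauss) \<partial>M) \<longlonglongrightarrow> (\<integral>x. F x \<partial>M)"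
    and "ennreal (\<integral>x. (\<integral>z. F (x + e *\<^sub>R z) \<partial>std_gauss) \<partial>M) = (\<integral>\<^sup>+x. (\<integral>\<^sup>+z. ennreal (F (x + e *\<^sub>R z)) \<partial>std_gauss) \<partial>M)"
proof -
  interpret M: prob_space M by fact
  have [measurable_cong]: "sets M = sets borel" by fact
  have [measurable]: "F \<in> borel_measurable borel" by (rule borel_measurable_continuous_onI[OF F(1)])
  have m: "(\<lambda>x. \<integral>z. F (x + e *\<^sub>R z) \<partial>std_gauss) \<in> borel_measurable M" for e by measurable
  have b: "0 \<le> (\<integral>z. F (x + e *\<^sub>R z) \<partial>std_gauss)" "(\<integral>z. F (x + e *\<^sub>R z) \<partial>std_gauss) \<le> 1" for x e
  proof -
    show "0 \<le> (\<integral>z. F (x + e *\<^sub>R z) \<partial>std_gauss)" using F by (intro integral_nonneg_AE) auto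
    have "(\<integral>z. F (x + e *\<^sub>R z) \<partial>std_gauss) \<le> (\<integral>z. 1 \<partial>(std_gauss :: 'a measure))"
      using F by (intro integral_mono std_gauss.integrable_const_bound[where B = 1]) auto
    then show "(\<integral>z. F (x + e *\<^sub>R z) \<partial>std_gauss) \<le> 1" by (simp add: std_gauss.prob_space[simplified])
  qed
  show "(\<lambda>n. \<integral>x. (\<integral>z. F (x + inverse (real (Suc n)) *\<^sub>R z) \<partial>std_gauss) \<partial>M) \<longlonglongrightarrow> (\<integral>x. F x \<partial>M)"
  proof (rule integral_dominated_convergence[where w = "\<lambda>_. 1"])
    show "AE x in M. (\<lambda>n. \<integral>z. F (x + inverse (real (Suc n)) *\<^sub>R z) \<partial>std_gauss) \<longlonglongrightarrow> F x"
    proof (rule AE_I2)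
      fix x
      have "(\<lambda>n. \<integral>z. F (x + inverse (real (Suc n)) *\<^sub>R z) \<partial>std_gauss) \<longlonglongrightarrow> (\<integral>z. F x \<partial>(std_gauss :: 'a measure))"
      proof (rule integral_dominated_convergence[where w = "\<lambda>_. 1"])
        show "AE z in std_gauss. (\<lambda>n. F (x + inverse (real (Suc n)) *\<^sub>R z)) \<longlonglongrightarrow> F x"
        proof (rule AE_I2)
          fix z :: 'a
          have "(\<lambda>n. x + inverse (real (Suc n)) *\<^sub>R z) \<longlonglongrightarrow> x + 0 *\<^sub>R z"
            by (intro tendsto_intros LIMSEQ_inverse_real_of_nat)
          then have "(\<lambda>n. x + inverse (real (Suc n)) *\<^sub>R z) \<longlonglongrightarrow> x" by simp
          then show "(\<lambda>n. F (x + inverse (real (Suc n)) *\<^sub>R z)) \<longlonglongrightarrow> F x"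
            by (intro isCont_tendsto_compose[of x F]) (use F(1) continuous_on_eq_continuous_at in auto)
        qed
      qed (use F in auto)
      then show "(\<lambda>n. \<integral>z. F (x + inverse (real (Suc n)) *\<^sub>R z) \<partial>std_gauss) \<longlonglongrightarrow> F x"
        by (simp add: std_gauss.prob_space[simplified])
    qed
  qed (use b in auto)
  have "(\<integral>\<^sup>+z. ennreal (F (x + e *\<^sub>R z)) \<partial>std_gauss) = ennreal (\<integral>z. F (x + e *\<^sub>R z) \<partial>std_gauss)" for x
    using F by (intro nn_integral_eq_integral std_gauss.integrable_const_bound[where B = 1]) auto
  then show "ennreal (\<integral>x. (\<integral>z. F (x + e *\<^sub>R z) \<partial>std_gauss) \<partial>M) = (\<integral>\<^sup>+x. (\<integral>\<^sup>+z. ennreal (F (x + e *\<^sub>R z)) \<partial>std_gauss) \<partial>M)"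
    using b m by (simp, intro nn_integral_eq_integral[symmetric] M.integrable_const_bound[where B = 1]) auto
qed

text \<open>The indicator of a nonempty closed \<open>C\<close> is the limit of the continuous
  cut-offs \<open>F n\<close>, which vanish where \<open>n * infdist x C\<close> exceeds one. Closed
  sets are an intersection-stable generator.\<close>

lemma measure_eq_if_continuous_integrals_eq:
  fixes M N :: "'a::euclidean_space measure"
  assumes M: "prob_space M" "sets M = sets borel" and N: "prob_space N" "sets N = sets borel"
    and eq: "\<And>F :: 'a \<Rightarrow> real. continuous_on UNIV F \<Longrightarrow> (\<And>x. 0 \<le> F x) \<Longrightarrow> (\<And>x. F x \<le> 1) \<Longrightarrow> (\<integral>x. F x \<partial>M) = (\<integral>x. F x \<partial>N)"
  shows "M = N"
proof -
  interpret M: prob_space M by fact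
  interpret N: prob_space N by fact
  have [measurable_cong]: "sets M = sets borel" "sets N = sets borel" by fact+
  have closed_eq: "emeasure M C = emeasure N C" if C: "closed C" for C
  proof (cases "C = {}")
    case False
    define F where "F n x = max 0 (1 - real n * infdist x C)" for n x
    have F: "continuous_on UNIV (F n)" "0 \<le> F n x" "F n x \<le> 1" for n x
      unfolding F_def by (auto intro!: continuous_intros mult_nonneg_nonneg infdist_nonneg)
    have lim: "(\<lambda>n. F n x) \<longlonglongrightarrow> indicator C x" for x
    proof (cases "x \<in> C")
      case True
      then show ?thesis by (simp add: F_def)
    next
      case False
      then have "0 < infdist x C" using C \<open>C \<noteq> {}\<close> by (simp add: infdist_pos_not_in_closed)
      then obtain n0 where "1 < real n0 * infdist x C" using reals_Archimedean3 by blast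
      have "\<forall>\<^sub>F n in sequentially. 0 = F n x"
        unfolding eventually_sequentially
      proof (intro exI allI impI)
        fix n assume "n0 \<le> n"
        then have "real n0 * infdist x C \<le> real n * infdist x C"
          by (intro mult_right_mono infdist_nonneg) auto
        then show "0 = F n x" using \<open>1 < real n0 * infdist x C\<close> by (simp add: F_def)
      qed
      then show ?thesis using False by (simp add: Lim_transform_eventually[OF tendsto_const])
    qed
    have dc: "(\<lambda>n. \<integral>x. F n x \<partial>Q) \<longlonglongrightarrow> (\<integral>x. indicator C x \<partial>Q)" if Q: "prob_space Q" "sets Q = sets borel" for Q
    proof (rule integral_dominated_convergence[where w = "\<lambda>_. 1"])
      interpret Q: prob_space Q by fact
      show "integrable Q (\<lambda>_. 1 :: real)" by simp
      have [measurable]: "F n \<in> borel_measurable borel" for n by (rule borel_measurable_continuous_onI[OF F(1)])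
      have [measurable_cong]: "sets Q = sets borel" by fact
      show "F n \<in> borel_measurable Q" for n by measurable
      have [measurable]: "C \<in> sets borel" using C by simp
      show "indicator C \<in> borel_measurable Q" by measurable
    qed (use lim F in auto)
    have "(\<integral>x. F n x \<partial>M) = (\<integral>x. F n x \<partial>N)" for n
      by (rule eq) (rule F)+
    then have "(\<integral>x. indicator C x \<partial>M) = (\<integral>x. indicator C x \<partial>N :: real)"
      using LIMSEQ_unique[OF dc[OF M]] dc[OF N] by simp
    then show ?thesis
      using C M(2) N(2) by (simp add: M.emeasure_eq_measure N.emeasure_eq_measure sets_eq_imp_space_eq)
  qed simp
  show ?thesis
  proof (rule measure_eqI_generator_eq[where E = "Collect closed" and \<Omega> = UNIV and A = "\<lambda>_. UNIV"])
    show "Int_stable (Collect (closed :: 'a set \<Rightarrow> bool))" by (auto simp: Int_stable_def)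
    show "sets M = sigma_sets UNIV (Collect closed)" "sets N = sigma_sets UNIV (Collect closed)"
      using M N by (simp_all add: borel_eq_closed)
  qed (use closed_eq in auto)
qed

text \<open>The smoothed laws have equal densities, because these are computed from the
  characteristic functions; letting the smoothing vanish recovers the laws.\<close>

theorem measure_eq_if_char_fun_eq:
  fixes M N :: "'a::euclidean_space measure"
  assumes M: "prob_space M" "sets M = sets borel" and N: "prob_space N" "sets N = sets borel"
    and eq: "\<And>u. char_fun M u = char_fun N u"
  shows "M = N"
proof (rule measure_eq_if_continuous_integrals_eq[OF M N])
  fix F :: "'a \<Rightarrow> real" assume F: "continuous_on UNIV F" "\<And>x. 0 \<le> F x" "\<And>x. F x \<le> 1"
  have [measurable]: "F \<in> borel_measurable borel" by (rule borel_measurable_continuous_onI[OF F(1)])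
  have "complex_of_real (\<integral>x. gauss_density (a *\<^sub>R (y - x)) \<partial>M) = complex_of_real (\<integral>x. gauss_density (a *\<^sub>R (y - x)) \<partial>N)" for a y
    by (simp only: integral_gauss_density_char_fun[OF M] integral_gauss_density_char_fun[OF N] eq)
  then have g: "(\<integral>x. gauss_density (a *\<^sub>R (y - x)) \<partial>M) = (\<integral>x. gauss_density (a *\<^sub>R (y - x)) \<partial>N)" for a y
    by (simp only: of_real_eq_iff)
  have "ennreal (\<integral>x. (\<integral>z. F (x + e *\<^sub>R z) \<partial>std_gauss) \<partial>M) = ennreal (\<integral>x. (\<integral>z. F (x + e *\<^sub>R z) \<partial>std_gauss) \<partial>N)" if "0 < e" for e
    unfolding gauss_convolution_limit(2)[OF M F] gauss_convolution_limit(2)[OF N F]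
    using that by (subst nn_integral_gauss_convolution[OF M], simp, simp, subst nn_integral_gauss_convolution[OF N]) (simp_all add: g)
  moreover have "0 \<le> (\<integral>x. (\<integral>z. F (x + e *\<^sub>R z) \<partial>std_gauss) \<partial>Q)" for e and Q :: "'a measure"
    using F by (intro integral_nonneg_AE AE_I2)
  ultimately have "(\<integral>x. (\<integral>z. F (x + e *\<^sub>R z) \<partial>std_gauss) \<partial>M) = (\<integral>x. (\<integral>z. F (x + e *\<^sub>R z) \<partial>std_gauss) \<partial>N)" if "0 < e" for e
    using that by (simp add: ennreal_inj)
  then show "(\<integral>x. F x \<partial>M) = (\<integral>x. F x \<partial>N)"
    using LIMSEQ_unique[OF gauss_convolution_limit(1)[OF M F]] gauss_convolution_limit(1)[OF N F] by simp
qed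

section \<open>The heat semigroup\<close>

lemma abs_diff_le_if_lipschitz:
  fixes f :: "'a::real_normed_vector \<Rightarrow> real"
  assumes "L-lipschitz_on UNIV f"
  shows "\<bar>f x - f y\<bar> \<le> L * norm (x - y)"
  using lipschitz_onD[OF assms, of x y] by (simp add: dist_norm)

text \<open>Variances of independent Gaussians add, as the characteristic functions show. This is
  the source of the semigroup law.\<close>

lemma distr_std_gauss_sum:
  assumes "0 \<le> s" "0 \<le> t"
  shows "distr (std_gauss \<Otimes>\<^sub>M std_gauss) borel (\<lambda>(z, w). sqrt s *\<^sub>R z + sqrt t *\<^sub>R w) =
    distr std_gauss borel (\<lambda>z :: 'a::euclidean_space. sqrt (s + t) *\<^sub>R z)" (is "?M = ?N")
proof (rule measure_eq_if_char_fun_eq)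
  interpret P: pair_prob_space "std_gauss :: 'a measure" "std_gauss :: 'a measure" ..
  show "prob_space ?M" by (rule P.prob_space_distr) measurable
  show "prob_space ?N" by (rule std_gauss.prob_space_distr) measurable
  fix u :: 'a
  have int: "integrable (std_gauss \<Otimes>\<^sub>M std_gauss) (\<lambda>p. iexp (u \<bullet> (sqrt s *\<^sub>R fst p + sqrt t *\<^sub>R snd p)))"
    by (rule P.integrable_const_bound[where B = 1]) auto
  have "char_fun ?M u = (\<integral>p. iexp (u \<bullet> (sqrt s *\<^sub>R fst p + sqrt t *\<^sub>R snd p)) \<partial>(std_gauss \<Otimes>\<^sub>M std_gauss))"
    unfolding char_fun_def by (subst integral_distr) (auto simp: case_prod_beta)
  also have "\<dots> = (\<integral>z. (\<integral>w. iexp ((sqrt s *\<^sub>R u) \<bullet> z) * iexp ((sqrt t *\<^sub>R u) \<bullet> w) \<partial>std_gauss) \<partial>std_gauss)"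
    by (subst P.integral_fst'[OF int, symmetric])
      (simp add: inner_add_right mult_exp_exp algebra_simps)
  also have "\<dots> = complex_of_real (exp (- (norm (sqrt s *\<^sub>R u))\<^sup>2 / 2)) * complex_of_real (exp (- (norm (sqrt t *\<^sub>R u))\<^sup>2 / 2))"
    by (simp only: integral_mult_right_zero integral_mult_left_zero char_std_gauss)
  also have "\<dots> = complex_of_real (exp (- (norm (sqrt (s + t) *\<^sub>R u))\<^sup>2 / 2))"
    unfolding of_real_mult[symmetric] mult_exp_exp
    using assms by (simp add: power_mult_distrib algebra_simps add_divide_distrib)
  also have "\<dots> = char_fun ?N u"
    unfolding char_fun_def char_std_gauss[symmetric] by (subst integral_distr) auto
  finally show "char_fun ?M u = char_fun ?N u" .
qed auto

section \<open>The heat operators on functions of exponential growth\<close>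

text \<open>A class that contains Lipschitz functions and their exponentials and is preserved by
  \<open>heat\<close>, so that iterated Gaussian integrals exist.\<close>

definition exp_growth :: "('a::euclidean_space \<Rightarrow> real) \<Rightarrow> bool" where
  "exp_growth g \<longleftrightarrow> g \<in> borel_measurable borel \<and> (\<exists>A c. 0 \<le> A \<and> 0 \<le> c \<and> (\<forall>x. \<bar>g x\<bar> \<le> A * exp (c * norm x)))"

text \<open>The root makes \<open>s\<close> a variance, hence additive under composition.\<close>

definition heat :: "real \<Rightarrow> ('a::euclidean_space \<Rightarrow> real) \<Rightarrow> 'a \<Rightarrow> real" where
  "heat s f x = (\<integral>z. f (x + sqrt s *\<^sub>R z) \<partial>std_gauss)"

lemma exp_growth_measurable: "exp_growth g \<Longrightarrow> g \<in> borel_measurable borel"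
  by (simp add: exp_growth_def)

lemma exp_growth_affine_bound:
  assumes g: "\<And>x. \<bar>g x\<bar> \<le> A * exp (c * norm x)" and A: "0 \<le> A" "0 \<le> c" "0 \<le> r"
  shows "\<bar>g (x + r *\<^sub>R z)\<bar> \<le> (A * exp (c * norm x)) * exp ((c * r) * norm z)"
proof -
  have "norm (x + r *\<^sub>R z) \<le> norm x + r * norm z"
    using norm_triangle_ineq[of x "r *\<^sub>R z"] A by simp
  from mult_left_mono[OF this \<open>0 \<le> c\<close>]
  have "exp (c * norm (x + r *\<^sub>R z)) \<le> exp (c * norm x) * exp ((c * r) * norm z)"
    by (simp add: mult_exp_exp algebra_simps)
  from mult_left_mono[OF this A(1)] g[of "x + r *\<^sub>R z"] show ?thesis by (simp add: mult.assoc)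
qed

lemma exp_growth_integrable:
  assumes "exp_growth g" "0 \<le> r"
  shows "integrable std_gauss (\<lambda>z. g (x + r *\<^sub>R z))"
proof -
  obtain A c where Ac: "0 \<le> A" "0 \<le> c" "\<And>x. \<bar>g x\<bar> \<le> A * exp (c * norm x)"
    using assms(1) by (auto simp: exp_growth_def)
  have [measurable]: "g \<in> borel_measurable borel" using assms(1) by (rule exp_growth_measurable)
  show ?thesis
    by (rule integrable_std_gauss_bound[of _ "A * exp (c * norm x)" "c * r"])
      (use exp_growth_affine_bound[OF Ac(3,1,2) assms(2)] in auto)
qed

lemma exp_growth_heat:
  assumes "exp_growth g" "0 \<le> s"
  shows "exp_growth (heat s g)"
proof -
  obtain A c where Ac: "0 \<le> A" "0 \<le> c" "\<And>x. \<bar>g x\<bar> \<le> A * exp (c * norm x)"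
    using assms(1) by (auto simp: exp_growth_def)
  have [measurable]: "g \<in> borel_measurable borel" using assms(1) by (rule exp_growth_measurable)
  let ?I = "\<integral>z. exp ((c * sqrt s) * norm z) \<partial>(std_gauss :: 'a measure)"
  have "\<bar>heat s g x\<bar> \<le> (A * ?I) * exp (c * norm x)" for x
  proof -
    have "\<bar>heat s g x\<bar> \<le> (\<integral>z. \<bar>g (x + sqrt s *\<^sub>R z)\<bar> \<partial>std_gauss)"
      unfolding heat_def by (rule integral_abs_bound)
    also have "\<dots> \<le> (\<integral>z. (A * exp (c * norm x)) * exp ((c * sqrt s) * norm z) \<partial>(std_gauss :: 'a measure))"
    proof (rule integral_mono)
      show "integrable std_gauss (\<lambda>z. \<bar>g (x + sqrt s *\<^sub>R z)\<bar>)"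
        using assms by (intro integrable_abs exp_growth_integrable) auto
      show "integrable std_gauss (\<lambda>z::'a. (A * exp (c * norm x)) * exp ((c * sqrt s) * norm z))"
        by (intro integrable_mult_right integrable_std_gauss_exp_norm)
      show "\<bar>g (x + sqrt s *\<^sub>R z)\<bar> \<le> (A * exp (c * norm x)) * exp ((c * sqrt s) * norm z)" for z
        using assms by (intro exp_growth_affine_bound Ac) auto
    qed
    finally show ?thesis by (simp add: mult_ac)
  qed
  moreover have "heat s g \<in> borel_measurable borel"
    unfolding heat_def by measurable
  moreover have "0 \<le> A * ?I" using Ac by simp
  ultimately show ?thesis unfolding exp_growth_def using Ac(2) by blast
qed

lemma heat_semigroup:
  assumes g: "exp_growth g" and "0 \<le> s" "0 \<le> t"
  shows "heat s (heat t g) x = heat (s + t) g x"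
proof -
  interpret P: pair_prob_space "std_gauss :: 'a measure" "std_gauss :: 'a measure" ..
  have [measurable]: "g \<in> borel_measurable borel" using g by (rule exp_growth_measurable)
  let ?T = "\<lambda>p :: 'a \<times> 'a. case p of (z, w) \<Rightarrow> sqrt s *\<^sub>R z + sqrt t *\<^sub>R w"
  note eq = distr_std_gauss_sum[OF assms(2,3), where 'a = 'a]
  \<comment> \<open>Integrability on the product space is transported from a single Gaussian through
    the equality of the two laws.\<close>
  have "integrable (distr std_gauss borel (\<lambda>z :: 'a. sqrt (s + t) *\<^sub>R z)) (\<lambda>y. g (x + y))"
    by (subst integrable_distr_eq) (use assms in \<open>auto intro!: exp_growth_integrable\<close>)
  then have "integrable (std_gauss \<Otimes>\<^sub>M std_gauss) (\<lambda>p. g (x + ?T p))"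
    unfolding eq[symmetric] by (subst (asm) integrable_distr_eq) auto
  then have int: "integrable (std_gauss \<Otimes>\<^sub>M std_gauss) (\<lambda>(z, w). g (x + sqrt s *\<^sub>R z + sqrt t *\<^sub>R w))"
    by (simp add: case_prod_beta' add.assoc)
  have "heat s (heat t g) x = (\<integral>p. g (x + ?T p) \<partial>(std_gauss \<Otimes>\<^sub>M std_gauss))"
    unfolding heat_def using P.integral_fst'[OF int] by (simp add: case_prod_beta' add.assoc)
  also have "\<dots> = (\<integral>y. g (x + y) \<partial>distr (std_gauss \<Otimes>\<^sub>M std_gauss) borel ?T)"
    by (subst integral_distr) auto
  also have "\<dots> = heat (s + t) g x"
    unfolding eq heat_def by (subst integral_distr) auto
  finally show ?thesis .
qed

lemma exp_growth_lipschitz: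
  assumes lip: "L-lipschitz_on UNIV f"
  shows "exp_growth f" "exp_growth (\<lambda>x. exp (f x))"
proof -
  have L: "0 \<le> L" using lip by (rule lipschitz_on_nonneg)
  have [measurable]: "f \<in> borel_measurable borel"
    by (rule borel_measurable_continuous_onI[OF lipschitz_on_continuous_on[OF lip]])
  have b: "\<bar>f x\<bar> \<le> \<bar>f 0\<bar> + L * norm x" for x
    using abs_diff_le_if_lipschitz[OF lip, of x 0] by simp
  have "\<bar>f x\<bar> \<le> (\<bar>f 0\<bar> + L) * exp (1 * norm x)" for x
  proof -
    have "norm x \<le> exp (norm x)" using exp_ge_add_one_self[of "norm x"] by linarith
    then have "L * norm x \<le> L * exp (norm x)" using L by (rule mult_left_mono)
    moreover have "\<bar>f 0\<bar> * 1 \<le> \<bar>f 0\<bar> * exp (norm x)" by (intro mult_left_mono) auto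
    ultimately show ?thesis using b[of x] by (simp add: algebra_simps)
  qed
  moreover have "0 \<le> \<bar>f 0\<bar> + L" "0 \<le> (1 :: real)" using L by auto
  ultimately show "exp_growth f" unfolding exp_growth_def
    using \<open>f \<in> borel_measurable borel\<close> by blast
  have "\<bar>exp (f x)\<bar> \<le> exp \<bar>f 0\<bar> * exp (L * norm x)" for x
    using b[of x] by (simp add: mult_exp_exp)
  moreover have "(\<lambda>x. exp (f x)) \<in> borel_measurable borel" by measurable
  ultimately show "exp_growth (\<lambda>x. exp (f x))" unfolding exp_growth_def
    using L exp_ge_zero[of "\<bar>f 0\<bar>"] by blast
qed

lemma exp_growth_cmult:
  assumes "exp_growth g"
  shows "exp_growth (\<lambda>x. c * g x)"
proof -
  obtain A b where g: "0 \<le> A" "0 \<le> b" "\<And>x. \<bar>g x\<bar> \<le> A * exp (b * norm x)" "g \<in> borel_measurable borel"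
    using assms by (auto simp: exp_growth_def)
  have "\<bar>c * g x\<bar> \<le> (\<bar>c\<bar> * A) * exp (b * norm x)" for x
    using mult_left_mono[OF g(3)[of x], of "\<bar>c\<bar>"] by (simp add: abs_mult mult.assoc)
  moreover have "(\<lambda>x. c * g x) \<in> borel_measurable borel" using g(4) by measurable
  ultimately show ?thesis unfolding exp_growth_def
    using g(1,2) by (intro conjI exI[of _ "\<bar>c\<bar> * A"] exI[of _ b]) auto
qed

lemma heat_mono:
  assumes "exp_growth g" "exp_growth h" "0 \<le> s" "\<And>x. g x \<le> h x"
  shows "heat s g x \<le> heat s h x"
  unfolding heat_def using assms by (intro integral_mono exp_growth_integrable) auto

lemma heat_cmult: "heat s (\<lambda>x. c * g x) x = c * heat s g x"
  by (simp add: heat_def)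

lemma lipschitz_heat:
  assumes lip: "L-lipschitz_on UNIV f" and "0 \<le> s"
  shows "L-lipschitz_on UNIV (heat s f)"
proof (rule lipschitz_onI)
  show "0 \<le> L" using lip by (rule lipschitz_on_nonneg)
  fix x y
  note int = exp_growth_integrable[OF exp_growth_lipschitz(1)[OF lip], of "sqrt s"]
  have "heat s f x - heat s f y = (\<integral>z. f (x + sqrt s *\<^sub>R z) - f (y + sqrt s *\<^sub>R z) \<partial>std_gauss)"
    unfolding heat_def using assms by (intro Bochner_Integration.integral_diff[symmetric] int) auto
  also have "\<bar>\<dots>\<bar> \<le> (\<integral>z. \<bar>f (x + sqrt s *\<^sub>R z) - f (y + sqrt s *\<^sub>R z)\<bar> \<partial>std_gauss)"
    by (rule integral_abs_bound)
  also have "\<dots> \<le> (\<integral>z. L * norm (x - y) \<partial>(std_gauss :: 'a measure))"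
  proof (intro integral_mono integrable_abs Bochner_Integration.integrable_diff int)
    show "\<bar>f (x + sqrt s *\<^sub>R z) - f (y + sqrt s *\<^sub>R z)\<bar> \<le> L * norm (x - y)" for z
      using abs_diff_le_if_lipschitz[OF lip, of "x + sqrt s *\<^sub>R z" "y + sqrt s *\<^sub>R z"] by simp
  qed (use assms in auto)
  finally show "dist (heat s f x) (heat s f y) \<le> L * dist x y"
    by (simp add: dist_norm std_gauss.prob_space[simplified])
qed

text \<open>A bound of order \<open>sqrt s\<close>, uniform in \<open>x\<close>. It controls the
  displacement of the mean in one time step and, later, the removal of the smoothing.\<close>

lemma heat_diff_le:
  fixes x :: "'a::euclidean_space"
  assumes lip: "L-lipschitz_on UNIV f" and "0 \<le> s"
  shows "\<bar>heat s f x - f x\<bar> \<le> L * sqrt s * (\<integral>z. norm z \<partial>(std_gauss :: 'a measure))"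
proof -
  note int = exp_growth_integrable[OF exp_growth_lipschitz(1)[OF lip], of "sqrt s"]
  have n: "integrable std_gauss (\<lambda>z::'a. norm z)"
  proof (rule integrable_std_gauss_bound[of _ 1 1])
    show "norm (norm z) \<le> 1 * exp (1 * norm z)" for z :: 'a
      using exp_ge_add_one_self[of "norm z"] unfolding real_norm_def abs_norm_cancel mult_1 by linarith
  qed measurable
  have "heat s f x - f x = (\<integral>z. f (x + sqrt s *\<^sub>R z) - f x \<partial>std_gauss)"
    unfolding heat_def using assms by (subst Bochner_Integration.integral_diff) (auto intro!: int simp: std_gauss.prob_space[simplified])
  also have "\<bar>\<dots>\<bar> \<le> (\<integral>z. \<bar>f (x + sqrt s *\<^sub>R z) - f x\<bar> \<partial>std_gauss)"
    by (rule integral_abs_bound)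
  also have "\<dots> \<le> (\<integral>z. (L * sqrt s) * norm z \<partial>(std_gauss :: 'a measure))"
  proof (intro integral_mono integrable_abs Bochner_Integration.integrable_diff int integrable_mult_right n)
    show "\<bar>f (x + sqrt s *\<^sub>R z) - f x\<bar> \<le> L * sqrt s * norm z" for z
      using abs_diff_le_if_lipschitz[OF lip, of "x + sqrt s *\<^sub>R z" x] assms by (simp add: mult_ac)
  qed (use assms in auto)
  finally show ?thesis by simp
qed

section \<open>Expansions of the exponential and of Gaussian shifts\<close>

text \<open>One term of the exponential series is at most the whole sum when \<open>p\<close> is
  nonnegative.\<close>

lemma power_le_fact_exp:
  fixes p :: real
  assumes "0 \<le> p"
  shows "p ^ k \<le> fact k * exp p"
proof -
  obtain t where "exp p = (\<Sum>m<Suc k. p ^ m / fact m) + (exp t / fact (Suc k)) * p ^ Suc k"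
    using Maclaurin_exp_le[of p "Suc k"] by blast
  moreover have "0 \<le> (\<Sum>m<k. p ^ m / fact m)" "0 \<le> (exp t / fact (Suc k)) * p ^ Suc k"
    using assms by (auto intro!: sum_nonneg)
  ultimately have "p ^ k / fact k \<le> exp p" by simp
  then show ?thesis by (simp add: field_simps)
qed

lemma integrable_std_gauss_norm_power_exp:
  assumes "0 \<le> m"
  shows "integrable std_gauss (\<lambda>z :: 'a::euclidean_space. (norm z + m) ^ k * exp (c * (norm z + m)))"
proof (rule integrable_std_gauss_bound[of _ "fact k * exp ((1 + c) * m)" "1 + c"])
  fix z :: 'a
  have "(norm z + m) ^ k * exp (c * (norm z + m)) \<le> (fact k * exp (norm z + m)) * exp (c * (norm z + m))"
    using assms by (intro mult_right_mono power_le_fact_exp) auto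
  then show "norm ((norm z + m) ^ k * exp (c * (norm z + m))) \<le> fact k * exp ((1 + c) * m) * exp ((1 + c) * norm z)"
    using assms by (simp add: mult_exp_exp algebra_simps)
qed measurable

lemma exp_minus_linear_bound: "\<bar>exp a - 1 - a\<bar> \<le> a\<^sup>2 * exp \<bar>a :: real\<bar>"
proof -
  obtain t where t: "\<bar>t\<bar> \<le> \<bar>a\<bar>" "exp a = (\<Sum>m<2. a ^ m / fact m) + (exp t / fact 2) * a ^ 2"
    using Maclaurin_exp_le[of a 2] by blast
  then have "\<bar>exp a - 1 - a\<bar> = exp t / 2 * a\<^sup>2" by (simp add: numeral_2_eq_2 abs_mult)
  also have "\<dots> \<le> exp \<bar>a\<bar> * a\<^sup>2"
  proof (rule mult_right_mono)
    have "exp t \<le> exp \<bar>a\<bar>" using t(1) by simp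
    then show "exp t / 2 \<le> exp \<bar>a\<bar>" using exp_gt_zero[of t] by linarith
  qed simp
  finally show ?thesis by (simp add: mult.commute)
qed

lemma exp_minus_quadratic_bound: "exp u \<le> 1 + u + u\<^sup>2 / 2 + \<bar>u\<bar> ^ 3 * exp \<bar>u :: real\<bar>"
proof -
  obtain t where t: "\<bar>t\<bar> \<le> \<bar>u\<bar>" "exp u = (\<Sum>m<3. u ^ m / fact m) + (exp t / fact 3) * u ^ 3"
    using Maclaurin_exp_le[of u 3] by blast
  have "(exp t / fact 3) * u ^ 3 \<le> (exp t / fact 3) * \<bar>u\<bar> ^ 3"
    by (intro mult_left_mono) (metis abs_ge_self power_abs, simp)
  also have "\<dots> \<le> exp \<bar>u\<bar> * \<bar>u\<bar> ^ 3"
  proof (rule mult_right_mono)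
    have "exp t \<le> exp \<bar>u\<bar>" using t(1) by simp
    moreover have "exp t / fact 3 \<le> exp t" by (simp add: fact_numeral)
    ultimately show "exp t / fact 3 \<le> exp \<bar>u\<bar>" by linarith
  qed simp
  finally have "(exp t / fact 3) * u ^ 3 \<le> exp \<bar>u\<bar> * \<bar>u\<bar> ^ 3" .
  then show ?thesis using t(2) by (simp add: numeral_3_eq_3 power2_eq_square mult.commute)
qed

text \<open>The Cameron-Martin formula: completing the square in the density turns a shift of the
  argument into an exponential weight. The weight can be expanded in \<open>q\<close> even when
  \<open>\<phi>\<close> is merely measurable.\<close>

lemma std_gauss_shift:
  fixes \<phi> :: "'a::euclidean_space \<Rightarrow> real"
  assumes [measurable]: "\<phi> \<in> borel_measurable borel"
  shows "(\<integral>z. \<phi> (z + q) \<partial>std_gauss) = (\<integral>z. exp (z \<bullet> q - (norm q)\<^sup>2 / 2) * \<phi> z \<partial>std_gauss)"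
proof -
  have gd: "gauss_density (z - q) = gauss_density z * exp (z \<bullet> q - (norm q)\<^sup>2 / 2)" for z
  proof -
    have "(norm (z - q))\<^sup>2 = (norm z)\<^sup>2 - 2 * (z \<bullet> q) + (norm q)\<^sup>2"
      by (simp add: power2_norm_eq_inner inner_diff inner_commute)
    then have "- (norm (z - q))\<^sup>2 / 2 = - (norm z)\<^sup>2 / 2 + (z \<bullet> q - (norm q)\<^sup>2 / 2)" by (simp add: field_simps)
    then show ?thesis unfolding gauss_density_eq by (simp only: exp_add mult.assoc)
  qed
  have "(\<integral>z. \<phi> (z + q) \<partial>std_gauss) = (\<integral>z. gauss_density ((z + q) - q) * \<phi> (z + q) \<partial>lborel)"
    by (subst integral_std_gauss) auto
  also have "\<dots> = (\<integral>z. gauss_density (z - q) * \<phi> z \<partial>lborel)"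
    by (rule lborel_integral_translate) measurable
  also have "\<dots> = (\<integral>z. exp (z \<bullet> q - (norm q)\<^sup>2 / 2) * \<phi> z \<partial>std_gauss)"
    by (subst integral_std_gauss) (auto simp: gd mult_ac)
  finally show ?thesis .
qed

text \<open>First-order expansion of the Cameron-Martin weight, quadratic in \<open>norm q\<close>
  and with a factor in \<open>z\<close> that is integrable against the Gaussian. The added one in
  \<open>p = norm z + 1\<close> absorbs the term \<open>(norm q)\<^sup>2 / 2\<close>.\<close>

lemma tilt_bound:
  fixes z q :: "'a::real_inner"
  assumes "norm q \<le> 1"
  shows "\<bar>exp (z \<bullet> q - (norm q)\<^sup>2 / 2) - 1 - z \<bullet> q\<bar> \<le> (norm q)\<^sup>2 * (2 * (norm z + 1)\<^sup>2 * exp (norm z + 1))"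
proof -
  define a where "a = z \<bullet> q - (norm q)\<^sup>2 / 2"
  define p where "p = norm z + 1"
  have p: "1 \<le> p" by (simp add: p_def)
  have "\<bar>z \<bullet> q\<bar> \<le> norm z * norm q" by (rule Cauchy_Schwarz_ineq2)
  moreover have "(norm q)\<^sup>2 \<le> norm q"
    using assms mult_left_le_one_le[of "norm q" "norm q"] by (simp add: power2_eq_square)
  ultimately have "\<bar>a\<bar> \<le> norm z * norm q + norm q"
    unfolding a_def using zero_le_power2[of "norm q"] by linarith
  then have a: "\<bar>a\<bar> \<le> norm q * p" by (simp add: p_def algebra_simps)
  also have "\<dots> \<le> 1 * p" using assms p by (intro mult_right_mono) auto
  finally have ap: "\<bar>a\<bar> \<le> p" by simp
  have "a\<^sup>2 \<le> (norm q * p)\<^sup>2" using a by (metis abs_ge_zero power2_abs power_mono)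
  then have "a\<^sup>2 * exp \<bar>a\<bar> \<le> (norm q * p)\<^sup>2 * exp p" using ap by (intro mult_mono) auto
  then have 1: "\<bar>exp a - 1 - a\<bar> \<le> (norm q)\<^sup>2 * (p\<^sup>2 * exp p)"
    using exp_minus_linear_bound[of a] by (simp add: power_mult_distrib mult.assoc)
  have "1 * 1 \<le> p\<^sup>2 * exp p" using p by (intro mult_mono) auto
  then have 2: "(norm q)\<^sup>2 / 2 \<le> (norm q)\<^sup>2 * (p\<^sup>2 * exp p)"
    using mult_left_mono[of "1/2" "p\<^sup>2 * exp p" "(norm q)\<^sup>2"] by simp
  have "exp a - 1 - z \<bullet> q = (exp a - 1 - a) - (norm q)\<^sup>2 / 2" by (simp add: a_def)
  then have "\<bar>exp a - 1 - z \<bullet> q\<bar> \<le> \<bar>exp a - 1 - a\<bar> + (norm q)\<^sup>2 / 2" using zero_le_power2[of "norm q"] by linarith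
  also have "\<dots> \<le> (norm q)\<^sup>2 * (2 * p\<^sup>2 * exp p)" using 1 2 by (simp add: algebra_simps)
  finally show ?thesis by (simp add: a_def p_def)
qed

lemma integrable_std_gauss_lipschitz_tilt:
  fixes \<phi> :: "'a::euclidean_space \<Rightarrow> real"
  assumes [measurable]: "\<phi> \<in> borel_measurable borel" and \<phi>: "\<And>z. \<bar>\<phi> z\<bar> \<le> l * norm z"
  shows "integrable std_gauss \<phi>" "integrable std_gauss (\<lambda>z. \<phi> z *\<^sub>R z)"
    "integrable std_gauss (\<lambda>z. exp (z \<bullet> q - (norm q)\<^sup>2 / 2) * \<phi> z)"
proof -
  have e: "norm z \<le> exp (norm z)" "(norm z)\<^sup>2 \<le> 2 * exp (norm z)" for z :: 'a
    using power_le_fact_exp[of "norm z" 1] power_le_fact_exp[of "norm z" 2] by auto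
  have l: "\<bar>\<phi> z\<bar> \<le> \<bar>l\<bar> * norm z" for z
    by (rule order_trans[OF \<phi>]) (simp add: mult_right_mono)
  show "integrable std_gauss \<phi>"
  proof (rule integrable_std_gauss_bound[of _ "\<bar>l\<bar>" 1])
    show "norm (\<phi> z) \<le> \<bar>l\<bar> * exp (1 * norm z)" for z
      using l[of z] mult_left_mono[OF e(1)[of z], of "\<bar>l\<bar>"] by simp
  qed measurable
  show "integrable std_gauss (\<lambda>z. \<phi> z *\<^sub>R z)"
  proof (rule integrable_std_gauss_bound[of _ "\<bar>l\<bar> * 2" 1])
    show "norm (\<phi> z *\<^sub>R z) \<le> \<bar>l\<bar> * 2 * exp (1 * norm z)" for z
      using mult_right_mono[OF l[of z], of "norm z"] mult_left_mono[OF e(2)[of z], of "\<bar>l\<bar>"]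
      by (simp add: power2_eq_square mult.assoc)
  qed measurable
  show "integrable std_gauss (\<lambda>z. exp (z \<bullet> q - (norm q)\<^sup>2 / 2) * \<phi> z)"
  proof (rule integrable_std_gauss_bound[of _ "\<bar>l\<bar>" "1 + norm q"])
    fix z
    have "z \<bullet> q - (norm q)\<^sup>2 / 2 \<le> norm q * norm z"
      using Cauchy_Schwarz_ineq2[of z q] zero_le_power2[of "norm q"] unfolding mult.commute[of "norm q"] by linarith
    then have "exp (z \<bullet> q - (norm q)\<^sup>2 / 2) * \<bar>\<phi> z\<bar> \<le> exp (norm q * norm z) * (\<bar>l\<bar> * exp (norm z))"
      using l[of z] mult_left_mono[OF e(1)[of z], of "\<bar>l\<bar>"] by (intro mult_mono) auto
    then show "norm (exp (z \<bullet> q - (norm q)\<^sup>2 / 2) * \<phi> z) \<le> \<bar>l\<bar> * exp ((1 + norm q) * norm z)"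
      by (simp add: abs_mult mult_exp_exp algebra_simps)
  qed measurable
qed

text \<open>Integrating by parts against the Gaussian weight (in the form of the Cameron-Martin shift)
  makes \<open>heat \<epsilon> h\<close> differentiable with a remainder that only depends on \<open>\<epsilon>\<close> and the Lipschitz constant.\<close>

lemma heat_taylor:
  fixes \<epsilon> \<sigma> :: real
  assumes "0 < \<epsilon>" "0 \<le> \<sigma>"
  obtains C where "0 \<le> C" and "\<And>(h :: 'a::euclidean_space \<Rightarrow> real) x. \<sigma>-lipschitz_on UNIV h \<Longrightarrow>
    \<exists>g. norm g \<le> \<sigma> \<and> (\<forall>k. \<bar>heat \<epsilon> h (x + k) - heat \<epsilon> h x - g \<bullet> k\<bar> \<le> C * (norm k)\<^sup>2)"
proof -
  define l where "l = \<sigma> * sqrt \<epsilon>"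
  \<comment> \<open>The bound \<open>l * (norm z + 1)\<close> on the increment of \<open>h\<close>,
    times the remainder of the weight. Neither \<open>h\<close> nor \<open>x\<close> occurs, so
    \<open>C0\<close> and \<open>C\<close> are uniform.\<close>
  define T where "T z = (2 * l) * ((norm z + 1) ^ 3 * exp (1 * (norm z + 1)))" for z :: 'a
  define C0 where "C0 = (\<integral>z. T z \<partial>std_gauss)"
  \<comment> \<open>The first summand serves \<open>norm k \<le> sqrt \<epsilon>\<close>, where the
    expansion of the weight applies. The second serves larger \<open>k\<close>, for which the
    Lipschitz bound \<open>2 * \<sigma> * norm k\<close> is already at most quadratic.\<close>
  define C where "C = C0 / \<epsilon> + 2 * \<sigma> / sqrt \<epsilon>"
  have l: "0 \<le> l" using assms by (simp add: l_def)
  have Tint: "integrable std_gauss T"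
    unfolding T_def by (intro integrable_mult_right integrable_std_gauss_norm_power_exp) simp
  have C0: "0 \<le> C0" unfolding C0_def T_def using l by (intro integral_nonneg_AE) auto
  have C: "0 \<le> C" using C0 assms by (simp add: C_def)
  have "\<exists>g. norm g \<le> \<sigma> \<and> (\<forall>k. \<bar>heat \<epsilon> h (x + k) - heat \<epsilon> h x - g \<bullet> k\<bar> \<le> C * (norm k)\<^sup>2)"
    if lip: "\<sigma>-lipschitz_on UNIV h" for h :: "'a \<Rightarrow> real" and x
  proof -
    define \<phi> where "\<phi> z = h (x + sqrt \<epsilon> *\<^sub>R z) - h x" for z
    have [measurable]: "h \<in> borel_measurable borel"
      by (rule borel_measurable_continuous_onI[OF lipschitz_on_continuous_on[OF lip]])
    have \<phi>m [measurable]: "\<phi> \<in> borel_measurable borel" unfolding \<phi>_def by measurable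
    have \<phi>b: "\<bar>\<phi> z\<bar> \<le> l * norm z" for z
      using abs_diff_le_if_lipschitz[OF lip, of "x + sqrt \<epsilon> *\<^sub>R z" x] assms
      by (simp add: \<phi>_def l_def mult_ac)
    note int = integrable_std_gauss_lipschitz_tilt[OF \<phi>m \<phi>b]
    \<comment> \<open>The linear term \<open>z \<bullet> q\<close> of the weight, integrated against
      \<open>\<phi>\<close> and rescaled from \<open>q\<close> to
      \<open>k = sqrt \<epsilon> q\<close>: this is the gradient of \<open>heat \<epsilon> h\<close>
      at \<open>x\<close>.\<close>
    define g where "g = (1 / sqrt \<epsilon>) *\<^sub>R (\<integral>z. \<phi> z *\<^sub>R z \<partial>std_gauss)"
    have hint: "integrable std_gauss (\<lambda>z. h (y + sqrt \<epsilon> *\<^sub>R z))" for y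
      using assms by (intro exp_growth_integrable exp_growth_lipschitz[OF lip]) auto
    have small: "\<bar>heat \<epsilon> h (x + k) - heat \<epsilon> h x - g \<bullet> k\<bar> \<le> (C0 / \<epsilon>) * (norm k)\<^sup>2" if k: "norm k \<le> sqrt \<epsilon>" for k
    proof -
      define q where "q = (1 / sqrt \<epsilon>) *\<^sub>R k"
      have kq: "k = sqrt \<epsilon> *\<^sub>R q" using assms by (simp add: q_def)
      have q: "norm q \<le> 1" using k assms by (simp add: q_def)
      let ?E = "\<lambda>z. exp (z \<bullet> q - (norm q)\<^sup>2 / 2)"
      have "heat \<epsilon> h (x + k) - h x = (\<integral>z. \<phi> (z + q) \<partial>std_gauss)"
      proof -
        have "heat \<epsilon> h (x + k) - h x = (\<integral>z. h ((x + k) + sqrt \<epsilon> *\<^sub>R z) - h x \<partial>std_gauss)"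
          unfolding heat_def by (subst Bochner_Integration.integral_diff) (auto intro!: hint simp: std_gauss.prob_space[simplified])
        then show ?thesis by (simp add: \<phi>_def kq scaleR_add_right add_ac)
      qed
      then have 1: "heat \<epsilon> h (x + k) - h x = (\<integral>z. ?E z * \<phi> z \<partial>std_gauss)"
        by (simp add: std_gauss_shift)
      have 2: "heat \<epsilon> h x - h x = (\<integral>z. \<phi> z \<partial>std_gauss)"
        unfolding heat_def \<phi>_def by (subst Bochner_Integration.integral_diff) (auto intro!: hint simp: std_gauss.prob_space[simplified])
      have 3: "g \<bullet> k = (\<integral>z. \<phi> z * (z \<bullet> q) \<partial>std_gauss)"
        using int(2) assms by (simp add: g_def kq)
          (subst integral_inner_left[symmetric], auto)
      have i3: "integrable std_gauss (\<lambda>z. \<phi> z * (z \<bullet> q))"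
        using integrable_inner_left[of q, OF int(2)] by simp
      have "heat \<epsilon> h (x + k) - heat \<epsilon> h x - g \<bullet> k = (\<integral>z. ?E z * \<phi> z - \<phi> z - \<phi> z * (z \<bullet> q) \<partial>std_gauss)"
        using 1 2 3 int i3 by (simp add: Bochner_Integration.integral_diff Bochner_Integration.integrable_diff)
      also have "\<bar>\<dots>\<bar> \<le> (\<integral>z. \<bar>?E z * \<phi> z - \<phi> z - \<phi> z * (z \<bullet> q)\<bar> \<partial>std_gauss)"
        by (rule integral_abs_bound)
      also have "\<dots> \<le> (\<integral>z. (norm q)\<^sup>2 * T z \<partial>std_gauss)"
      proof (rule integral_mono)
        show "integrable std_gauss (\<lambda>z. \<bar>?E z * \<phi> z - \<phi> z - \<phi> z * (z \<bullet> q)\<bar>)"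
          using int i3 by (intro integrable_abs Bochner_Integration.integrable_diff) auto
        show "integrable std_gauss (\<lambda>z. (norm q)\<^sup>2 * T z)" using Tint by simp
        fix z
        have "\<bar>?E z * \<phi> z - \<phi> z - \<phi> z * (z \<bullet> q)\<bar> = \<bar>\<phi> z\<bar> * \<bar>?E z - 1 - z \<bullet> q\<bar>"
          by (simp add: abs_mult[symmetric] algebra_simps)
        also have "\<dots> \<le> (l * (norm z + 1)) * ((norm q)\<^sup>2 * (2 * (norm z + 1)\<^sup>2 * exp (norm z + 1)))"
        proof (rule mult_mono)
          show "\<bar>\<phi> z\<bar> \<le> l * (norm z + 1)"
            by (rule order_trans[OF \<phi>b]) (use l in \<open>simp add: mult_left_mono\<close>)
          show "\<bar>?E z - 1 - z \<bullet> q\<bar> \<le> (norm q)\<^sup>2 * (2 * (norm z + 1)\<^sup>2 * exp (norm z + 1))"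
            by (rule tilt_bound[OF q])
        qed (use l in auto)
        also have "\<dots> = (norm q)\<^sup>2 * T z" by (simp add: T_def power2_eq_square power3_eq_cube)
        finally show "\<bar>?E z * \<phi> z - \<phi> z - \<phi> z * (z \<bullet> q)\<bar> \<le> (norm q)\<^sup>2 * T z" .
      qed
      also have "\<dots> = (norm q)\<^sup>2 * C0" by (simp add: C0_def)
      also have "\<dots> = (C0 / \<epsilon>) * (norm k)\<^sup>2" using assms by (simp add: kq power_mult_distrib)
      finally show ?thesis .
    qed
    have hl: "\<bar>heat \<epsilon> h (x + k) - heat \<epsilon> h x\<bar> \<le> \<sigma> * norm k" for k
      using abs_diff_le_if_lipschitz[OF lipschitz_heat[OF lip], of \<epsilon> "x + k" x] assms by simp
    have g: "norm g \<le> \<sigma>"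
    proof (rule ccontr)
      assume "\<not> ?thesis"
      then have gt: "\<sigma> < norm g" by simp
      then have gp: "0 < norm g" using assms by linarith
      define D where "D = C0 / \<epsilon> + 1"
      have D: "0 < D" "C0 / \<epsilon> < D" using C0 assms by (auto simp: D_def add_nonneg_pos)
      \<comment> \<open>Short enough for the expansion to apply and for its quadratic error per unit
        length to stay within the excess \<open>norm g - \<sigma>\<close>. The growth along
        \<open>g\<close> would then contradict the Lipschitz bound.\<close>
      define t where "t = min (sqrt \<epsilon> / norm g) ((norm g - \<sigma>) / (D * norm g))"
      have t: "0 < t" using gp gt D assms by (simp add: t_def)
      have n: "norm (t *\<^sub>R g) = t * norm g" using t by simp
      have "t \<le> sqrt \<epsilon> / norm g" "t \<le> (norm g - \<sigma>) / (D * norm g)" by (auto simp: t_def)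
      then have t1: "t * norm g \<le> sqrt \<epsilon>" and t2: "D * (t * norm g) \<le> norm g - \<sigma>"
        using gp D by (simp_all add: field_simps)
      have "t * (norm g)\<^sup>2 \<le> \<sigma> * (t * norm g) + (C0 / \<epsilon>) * (t * norm g)\<^sup>2"
      proof -
        have ip: "g \<bullet> (t *\<^sub>R g) = t * (norm g)\<^sup>2" by (simp add: power2_norm_eq_inner)
        have "norm (t *\<^sub>R g) \<le> sqrt \<epsilon>" using t1 by (simp only: n)
        from small[OF this] hl[of "t *\<^sub>R g"] show ?thesis unfolding n ip by linarith
      qed
      also have "(C0 / \<epsilon>) * (t * norm g)\<^sup>2 < D * (t * norm g)\<^sup>2"
        using D gp t by (intro mult_strict_right_mono) auto
      also have "\<sigma> * (t * norm g) + D * (t * norm g)\<^sup>2 = (t * norm g) * (\<sigma> + D * (t * norm g))"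
        by (simp add: power2_eq_square algebra_simps)
      also have "\<dots> \<le> (t * norm g) * norm g" using t2 t gp by (intro mult_left_mono) auto
      finally show False by (simp add: power2_eq_square mult.assoc)
    qed
    have "\<bar>heat \<epsilon> h (x + k) - heat \<epsilon> h x - g \<bullet> k\<bar> \<le> C * (norm k)\<^sup>2" for k
    proof (cases "norm k \<le> sqrt \<epsilon>")
      case True
      have "(C0 / \<epsilon>) * (norm k)\<^sup>2 \<le> C * (norm k)\<^sup>2" using assms by (intro mult_right_mono) (auto simp: C_def)
      then show ?thesis using small[OF True] by linarith
    next
      case False
      have "\<bar>g \<bullet> k\<bar> \<le> \<sigma> * norm k"
        using Cauchy_Schwarz_ineq2[of g k] mult_right_mono[OF g, of "norm k"] by simp
      then have "\<bar>heat \<epsilon> h (x + k) - heat \<epsilon> h x - g \<bullet> k\<bar> \<le> 2 * \<sigma> * norm k" using hl[of k] by linarith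
      also have "\<dots> \<le> (2 * \<sigma> / sqrt \<epsilon>) * (norm k)\<^sup>2"
      proof -
        have "\<sigma> * norm k * sqrt \<epsilon> \<le> \<sigma> * norm k * norm k" using False assms by (intro mult_left_mono) auto
        then show ?thesis using assms by (simp add: field_simps power2_eq_square)
      qed
      also have "\<dots> \<le> C * (norm k)\<^sup>2" using C0 assms by (intro mult_right_mono) (auto simp: C_def)
      finally show ?thesis .
    qed
    then show ?thesis using g by blast
  qed
  then show ?thesis using that C by blast
qed

lemma integrable_std_gauss_norm_powers:
  "integrable std_gauss (\<lambda>z :: 'a::euclidean_space. norm z)"
  "integrable std_gauss (\<lambda>z :: 'a::euclidean_space. (norm z)\<^sup>2)"
  using integrable_std_gauss_norm_power_exp[of 0 1 0] integrable_std_gauss_norm_power_exp[of 0 2 0] by simp_all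

text \<open>One small time step. With \<open>u = F (x + sqrt s z) - heat s F x\<close>, of mean zero, the bound
  \<open>exp u \<le> 1 + u + u\<^sup>2 / 2 + \<bar>u\<bar>\<^sup>3 exp \<bar>u\<bar>\<close> leaves only the variance, and there the linear part
  \<open>sqrt s (g \<bullet> z)\<close> of \<open>u\<close> contributes \<open>s (norm g)\<^sup>2 \<le> s \<sigma>\<^sup>2\<close>.\<close>

lemma heat_exp_step:
  fixes \<epsilon> \<sigma> :: real
  assumes "0 < \<epsilon>" "0 \<le> \<sigma>"
  obtains B where "0 \<le> B" and "\<And>(h :: 'a::euclidean_space \<Rightarrow> real) s x. \<sigma>-lipschitz_on UNIV h \<Longrightarrow> 0 < s \<Longrightarrow> s \<le> 1 \<Longrightarrow>
    heat s (\<lambda>y. exp (heat \<epsilon> h y)) x \<le> (1 + s * \<sigma>\<^sup>2 / 2 + B * (s * sqrt s)) * exp (heat s (heat \<epsilon> h) x)"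
proof -
  obtain C where C: "0 \<le> C" and taylor: "\<And>(h :: 'a \<Rightarrow> real) x. \<sigma>-lipschitz_on UNIV h \<Longrightarrow>
    \<exists>g. norm g \<le> \<sigma> \<and> (\<forall>k. \<bar>heat \<epsilon> h (x + k) - heat \<epsilon> h x - g \<bullet> k\<bar> \<le> C * (norm k)\<^sup>2)"
    using heat_taylor[OF assms] by metis
  define m1 where "m1 = (\<integral>z. norm z \<partial>(std_gauss :: 'a measure))"
  define m2 where "m2 = (\<integral>z. (norm z)\<^sup>2 \<partial>(std_gauss :: 'a measure))"
  have m: "0 \<le> m1" "0 \<le> m2" unfolding m1_def m2_def by simp_all
  \<comment> \<open>Chosen so that \<open>p z\<close> dominates \<open>norm z + m1\<close> and its
    square dominates \<open>(norm z)\<^sup>2 + m2\<close>: one envelope covers the errors at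
    \<open>z\<close> together with those of the mean.\<close>
  define m where "m = m1 + m2 + 1"
  define p where "p z = norm z + m" for z :: 'a
  \<comment> \<open>In order: the cross term of linear part and remainder, the squared remainder,
    and the cubic remainder of the exponential. The exponent \<open>0 * p z\<close> puts pure powers
    into the shape of \<open>integrable_std_gauss_norm_power_exp\<close>.\<close>
  define K where "K z = \<sigma> * C * (p z ^ 3 * exp (0 * p z)) + C\<^sup>2 / 2 * (p z ^ 4 * exp (0 * p z)) + \<sigma> ^ 3 * (p z ^ 3 * exp (\<sigma> * p z))" for z
  define B where "B = (\<integral>z. K z \<partial>std_gauss)"
  have m0: "0 \<le> m" using m by (simp add: m_def)
  have p0: "0 \<le> p z" for z using m0 by (simp add: p_def)
  have Kint: "integrable std_gauss K"
    unfolding K_def p_def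
    by (intro Bochner_Integration.integrable_add integrable_mult_right integrable_std_gauss_norm_power_exp m0)
  have B0: "0 \<le> B" unfolding B_def K_def using assms C p0 by (intro integral_nonneg_AE AE_I2) simp
  have p1: "norm z + m1 \<le> p z" "norm z \<le> p z" for z using m by (auto simp: p_def m_def)
  have p2: "(norm z)\<^sup>2 + m2 \<le> (p z)\<^sup>2" for z
  proof -
    have "m2 * 1 \<le> m * m" using m by (intro mult_mono) (auto simp: m_def)
    moreover have "0 \<le> norm z * m" using m0 by simp
    ultimately show ?thesis by (simp add: p_def power2_eq_square algebra_simps)
  qed
  have "heat s (\<lambda>y. exp (heat \<epsilon> h y)) x \<le> (1 + s * \<sigma>\<^sup>2 / 2 + B * (s * sqrt s)) * exp (heat s (heat \<epsilon> h) x)"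
    if lip: "\<sigma>-lipschitz_on UNIV h" and s: "0 < s" "s \<le> 1" for h :: "'a \<Rightarrow> real" and s x
  proof -
    define F where "F = heat \<epsilon> h"
    have lipF: "\<sigma>-lipschitz_on UNIV F" unfolding F_def using assms by (intro lipschitz_heat lip) simp
    obtain g where g: "norm g \<le> \<sigma>" and tay: "\<And>k. \<bar>F (x + k) - F x - g \<bullet> k\<bar> \<le> C * (norm k)\<^sup>2"
      using taylor[OF lip, of x] unfolding F_def by blast
    define r where "r = sqrt s"
    have r: "0 < r" "r \<le> 1" "r\<^sup>2 = s" using s by (auto simp: r_def)
    have [measurable]: "F \<in> borel_measurable borel"
      by (rule borel_measurable_continuous_onI[OF lipschitz_on_continuous_on[OF lipF]])
    have Fint: "integrable std_gauss (\<lambda>z. F (x + r *\<^sub>R z))"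
      using r by (intro exp_growth_integrable exp_growth_lipschitz[OF lipF]) auto
    have eFint: "integrable std_gauss (\<lambda>z. exp (F (x + r *\<^sub>R z)))"
      using r exp_growth_integrable[OF exp_growth_lipschitz(2)[OF lipF], of r] by simp
    have gint: "integrable std_gauss (\<lambda>z. (r *\<^sub>R g) \<bullet> z)"
      by (rule integrable_std_gauss_lipschitz_tilt(1)[of _ "norm (r *\<^sub>R g)"]) (measurable, rule Cauchy_Schwarz_ineq2)
    have g2int: "integrable std_gauss (\<lambda>z. (g \<bullet> z)\<^sup>2)"
    proof (rule Bochner_Integration.integrable_bound)
      show "integrable std_gauss (\<lambda>z. (norm g)\<^sup>2 * (norm z)\<^sup>2)"
        by (intro integrable_mult_right integrable_std_gauss_norm_powers)
      show "AE z in std_gauss. norm ((g \<bullet> z)\<^sup>2) \<le> norm ((norm g)\<^sup>2 * (norm z)\<^sup>2)"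
        using Cauchy_Schwarz_ineq[of g] by (intro AE_I2) (simp add: power2_norm_eq_inner)
    qed measurable
    define V where "V z = F (x + r *\<^sub>R z) - F x - (r *\<^sub>R g) \<bullet> z" for z
    define u where "u z = F (x + r *\<^sub>R z) - heat s F x" for z
    have Vint: "integrable std_gauss V" unfolding V_def
      by (intro Bochner_Integration.integrable_diff Fint gint) simp
    have mean: "heat s F x - F x = (\<integral>z. V z \<partial>std_gauss)"
      unfolding V_def heat_def r_def[symmetric] using Fint gint std_gauss_inner_moments(1)[of "r *\<^sub>R g"]
      by (simp add: Bochner_Integration.integral_diff Bochner_Integration.integrable_diff std_gauss.prob_space[simplified] del: inner_scaleR_left)
    have Vb: "\<bar>V z\<bar> \<le> C * s * (norm z)\<^sup>2" for z
      using tay[of "r *\<^sub>R z"] r by (simp add: V_def power_mult_distrib mult.assoc)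
    have EV: "\<bar>\<integral>z. V z \<partial>std_gauss\<bar> \<le> C * s * m2"
    proof -
      have "\<bar>\<integral>z. V z \<partial>std_gauss\<bar> \<le> (\<integral>z. \<bar>V z\<bar> \<partial>std_gauss)" by (rule integral_abs_bound)
      also have "\<dots> \<le> (\<integral>z. C * s * (norm z)\<^sup>2 \<partial>(std_gauss :: 'a measure))"
        by (intro integral_mono integrable_abs Vint integrable_mult_right integrable_std_gauss_norm_powers Vb)
      finally show ?thesis by (simp add: m2_def)
    qed
    \<comment> \<open>Since \<open>g \<bullet> z\<close> has mean zero, centring affects only
      \<open>V\<close>, and the linear part stays exact.\<close>
    have u_split: "u z = r * (g \<bullet> z) + (V z - (\<integral>z. V z \<partial>std_gauss))" for z
      unfolding u_def mean[symmetric] by (simp add: V_def)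
    have W: "\<bar>V z - (\<integral>z. V z \<partial>std_gauss)\<bar> \<le> C * s * (p z)\<^sup>2" for z
    proof -
      have "\<bar>V z - (\<integral>z. V z \<partial>std_gauss)\<bar> \<le> C * s * (norm z)\<^sup>2 + C * s * m2" using Vb[of z] EV by linarith
      also have "\<dots> = C * s * ((norm z)\<^sup>2 + m2)" by (simp add: algebra_simps)
      also have "\<dots> \<le> C * s * (p z)\<^sup>2" using C s p2 by (intro mult_left_mono) auto
      finally show ?thesis .
    qed
    have gz: "\<bar>g \<bullet> z\<bar> \<le> \<sigma> * p z" for z
    proof -
      have "\<bar>g \<bullet> z\<bar> \<le> norm g * norm z" by (rule Cauchy_Schwarz_ineq2)
      also have "\<dots> \<le> \<sigma> * p z" using g p1 assms by (intro mult_mono) auto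
      finally show ?thesis .
    qed
    have u_abs: "\<bar>u z\<bar> \<le> r * (\<sigma> * p z)" for z
    proof -
      have "\<bar>F (x + r *\<^sub>R z) - F x\<bar> \<le> \<sigma> * (r * norm z)"
        using abs_diff_le_if_lipschitz[OF lipF, of "x + r *\<^sub>R z" x] r by simp
      moreover have "\<bar>heat s F x - F x\<bar> \<le> \<sigma> * r * m1"
        using heat_diff_le[OF lipF, of s x] s by (simp add: r_def m1_def)
      ultimately have "\<bar>u z\<bar> \<le> r * (\<sigma> * (norm z + m1))" unfolding u_def by (simp add: algebra_simps)
      also have "\<dots> \<le> r * (\<sigma> * p z)" using p1[of z] r assms by (intro mult_left_mono) auto
      finally show ?thesis .
    qed
    \<comment> \<open>The cross term carries \<open>r * s\<close> and the squared remainder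
      \<open>s * s\<close>, which is at most \<open>s * r\<close> because \<open>s \<le> 1\<close>.
      Only \<open>s / 2 * (g \<bullet> z)\<^sup>2\<close> is of first order in
      \<open>s\<close>.\<close>
    have u2: "(u z)\<^sup>2 / 2 \<le> s / 2 * (g \<bullet> z)\<^sup>2 + (s * r) * (\<sigma> * C * p z ^ 3 + C\<^sup>2 / 2 * p z ^ 4)" for z
    proof -
      define w where "w = V z - (\<integral>z. V z \<partial>std_gauss)"
      have "(g \<bullet> z) * w \<le> \<bar>g \<bullet> z\<bar> * \<bar>w\<bar>" by (metis abs_ge_self abs_mult)
      also have "\<dots> \<le> (\<sigma> * p z) * (C * s * (p z)\<^sup>2)"
        using gz[of z] W[of z] assms p0 by (intro mult_mono) (auto simp: w_def)
      finally have "r * ((g \<bullet> z) * w) \<le> r * ((\<sigma> * p z) * (C * s * (p z)\<^sup>2))" using r by (intro mult_left_mono) auto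
      then have 1: "r * ((g \<bullet> z) * w) \<le> (s * r) * (\<sigma> * C * p z ^ 3)" by (simp add: power2_eq_square power3_eq_cube mult_ac)
      have "w\<^sup>2 \<le> (C * s * (p z)\<^sup>2)\<^sup>2" using W[of z] unfolding w_def by (metis abs_ge_zero power2_abs power_mono)
      also have "\<dots> = (s * s) * (C\<^sup>2 * p z ^ 4)" by (simp add: power_mult_distrib power2_eq_square power4_eq_xxxx mult_ac)
      also have "\<dots> \<le> (s * r) * (C\<^sup>2 * p z ^ 4)"
      proof (intro mult_right_mono mult_left_mono)
        show "s \<le> r" using r mult_left_le_one_le[of r r] by (simp add: power2_eq_square)
      qed (use s in auto)
      finally have 2: "w\<^sup>2 / 2 \<le> (s * r) * (C\<^sup>2 / 2 * p z ^ 4)" by simp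
      have "(u z)\<^sup>2 / 2 = s / 2 * (g \<bullet> z)\<^sup>2 + r * ((g \<bullet> z) * w) + w\<^sup>2 / 2"
        unfolding u_split w_def[symmetric] r(3)[symmetric] by (simp add: power2_eq_square field_simps)
      then show ?thesis using 1 2 by (simp add: distrib_left)
    qed
    have u3: "\<bar>u z\<bar> ^ 3 * exp \<bar>u z\<bar> \<le> (s * r) * (\<sigma> ^ 3 * (p z ^ 3 * exp (\<sigma> * p z)))" for z
    proof -
      have "r * (\<sigma> * p z) \<le> 1 * (\<sigma> * p z)" using r assms p0 by (intro mult_right_mono) auto
      then have "\<bar>u z\<bar> \<le> \<sigma> * p z" using u_abs[of z] by simp
      then have "\<bar>u z\<bar> ^ 3 * exp \<bar>u z\<bar> \<le> (r * (\<sigma> * p z)) ^ 3 * exp (\<sigma> * p z)"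
        using u_abs[of z] by (intro mult_mono power_mono) auto
      also have "\<dots> = (s * r) * (\<sigma> ^ 3 * (p z ^ 3 * exp (\<sigma> * p z)))"
        unfolding r(3)[symmetric] by (simp add: power_mult_distrib power2_eq_square power3_eq_cube mult_ac)
      finally show ?thesis .
    qed
    have point: "exp (u z) \<le> 1 + u z + (s / 2 * (g \<bullet> z)\<^sup>2 + (s * r) * K z)" for z
      using exp_minus_quadratic_bound[of "u z"] u2[of z] u3[of z] unfolding K_def by (simp add: distrib_left)
    have uint: "integrable std_gauss u" unfolding u_def by (intro Bochner_Integration.integrable_diff Fint) simp
    have Eu: "(\<integral>z. u z \<partial>std_gauss) = 0"
      unfolding u_def using Fint
      by (simp add: heat_def r_def std_gauss.prob_space[simplified])
    have euint: "integrable std_gauss (\<lambda>z. exp (u z))"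
    proof -
      have "(\<lambda>z. exp (u z)) = (\<lambda>z. exp (F (x + r *\<^sub>R z)) * exp (- heat s F x))"
        by (simp add: u_def exp_diff exp_minus field_simps fun_eq_iff)
      then show ?thesis using eFint by simp
    qed
    have "(\<integral>z. exp (u z) \<partial>std_gauss) \<le> (\<integral>z. 1 + u z + (s / 2 * (g \<bullet> z)\<^sup>2 + (s * r) * K z) \<partial>std_gauss)"
      by (intro integral_mono euint Bochner_Integration.integrable_add integrable_mult_right uint g2int Kint point) simp
    also have "\<dots> = 1 + s / 2 * (norm g)\<^sup>2 + (s * r) * B"
      using uint g2int Kint
      by (simp add: Eu B_def std_gauss_inner_moments(2) std_gauss.prob_space[simplified])
    also have "\<dots> \<le> 1 + s * \<sigma>\<^sup>2 / 2 + B * (s * sqrt s)"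
    proof -
      have "(norm g)\<^sup>2 \<le> \<sigma>\<^sup>2" using g by (intro power_mono) auto
      then have "s / 2 * (norm g)\<^sup>2 \<le> s / 2 * \<sigma>\<^sup>2" using s by (intro mult_left_mono) auto
      then show ?thesis by (simp add: r_def mult.commute)
    qed
    finally have le: "(\<integral>z. exp (u z) \<partial>std_gauss) \<le> 1 + s * \<sigma>\<^sup>2 / 2 + B * (s * sqrt s)" .
    have "heat s (\<lambda>y. exp (F y)) x = (\<integral>z. exp (u z) * exp (heat s F x) \<partial>std_gauss)"
      unfolding heat_def[of s "\<lambda>y. exp (F y)"] r_def[symmetric] u_def by (simp add: exp_diff)
    also have "\<dots> = (\<integral>z. exp (u z) \<partial>std_gauss) * exp (heat s F x)" by simp
    also have "\<dots> \<le> (1 + s * \<sigma>\<^sup>2 / 2 + B * (s * sqrt s)) * exp (heat s F x)"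
      using le by (intro mult_right_mono) auto
    finally show ?thesis unfolding F_def .
  qed
  then show ?thesis using that B0 by blast
qed

section \<open>Iteration of the step and removal of the smoothing\<close>

text \<open>The induction generalises over \<open>h\<close>: one step turns the problem for
  \<open>h\<close> into that for \<open>heat s h\<close>, which is again
  \<open>\<sigma>\<close>-Lipschitz, so the factor \<open>\<rho>\<close> must not depend on
  \<open>h\<close>. Commuting \<open>heat s\<close> with \<open>heat \<epsilon>\<close> restores the
  smoothed form that the next step expects.\<close>

lemma heat_exp_iterate:
  fixes h :: "'a::euclidean_space \<Rightarrow> real"
  assumes "0 < \<epsilon>" "0 < s" "0 \<le> \<rho>"
    and step: "\<And>(h :: 'a \<Rightarrow> real) x. \<sigma>-lipschitz_on UNIV h \<Longrightarrow>
      heat s (\<lambda>y. exp (heat \<epsilon> h y)) x \<le> \<rho> * exp (heat s (heat \<epsilon> h) x)"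
    and lip: "\<sigma>-lipschitz_on UNIV h"
  shows "heat (real j * s) (\<lambda>y. exp (heat \<epsilon> h y)) x \<le> \<rho> ^ j * exp (heat (real j * s) (heat \<epsilon> h) x)"
  using lip
proof (induction j arbitrary: h x)
  case 0
  then show ?case by (simp add: heat_def std_gauss.prob_space[simplified])
next
  case (Suc j)
  have lips: "\<sigma>-lipschitz_on UNIV (heat s h)" using Suc.prems assms by (intro lipschitz_heat) auto
  have lipe: "\<sigma>-lipschitz_on UNIV (heat \<epsilon> h)" "\<sigma>-lipschitz_on UNIV (heat \<epsilon> (heat s h))"
    using Suc.prems lips assms by (auto intro!: lipschitz_heat)
  note gr = exp_growth_lipschitz[OF Suc.prems] exp_growth_lipschitz[OF lipe(1)] exp_growth_lipschitz[OF lipe(2)]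
  have comm: "heat s (heat \<epsilon> h) = heat \<epsilon> (heat s h)"
    using assms gr by (simp add: fun_eq_iff heat_semigroup add.commute)
  have js: "0 \<le> real j * s" using assms by simp
  have "heat (real (Suc j) * s) (\<lambda>y. exp (heat \<epsilon> h y)) x = heat (real j * s) (heat s (\<lambda>y. exp (heat \<epsilon> h y))) x"
    using assms gr js by (simp add: heat_semigroup algebra_simps)
  also have "\<dots> \<le> heat (real j * s) (\<lambda>y. \<rho> * exp (heat \<epsilon> (heat s h) y)) x"
  proof (rule heat_mono[OF _ _ js])
    show "exp_growth (heat s (\<lambda>y. exp (heat \<epsilon> h y)))" using gr assms by (intro exp_growth_heat) auto
    show "exp_growth (\<lambda>y. \<rho> * exp (heat \<epsilon> (heat s h) y))"
      using exp_growth_cmult[OF gr(6)] .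
    show "heat s (\<lambda>y. exp (heat \<epsilon> h y)) y \<le> \<rho> * exp (heat \<epsilon> (heat s h) y)" for y
      using step[OF Suc.prems, of y] unfolding comm .
  qed
  also have "\<dots> = \<rho> * heat (real j * s) (\<lambda>y. exp (heat \<epsilon> (heat s h) y)) x" by (rule heat_cmult)
  also have "\<dots> \<le> \<rho> * (\<rho> ^ j * exp (heat (real j * s) (heat \<epsilon> (heat s h)) x))"
    using Suc.IH[OF lips] \<open>0 \<le> \<rho>\<close> by (rule mult_left_mono)
  also have "heat (real j * s) (heat \<epsilon> (heat s h)) x = heat (real (Suc j) * s) (heat \<epsilon> h) x"
    unfolding comm[symmetric] using assms gr js by (simp add: heat_semigroup algebra_simps)
  finally show ?case by (simp add: mult.assoc)
qed

text \<open>The error \<open>B * (s * sqrt s)\<close> of one step adds up to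
  \<open>B * sqrt s\<close> over \<open>1 / s\<close> steps and vanishes in the limit;
  \<open>1 + y \<le> exp y\<close> turns the product of the factors into one exponential.\<close>

lemma heat_exp_le_smoothed:
  fixes h :: "'a::euclidean_space \<Rightarrow> real"
  assumes "0 < \<epsilon>" and lip: "\<sigma>-lipschitz_on UNIV h"
  shows "heat 1 (\<lambda>y. exp (heat \<epsilon> h y)) x \<le> exp (\<sigma>\<^sup>2 / 2) * exp (heat 1 (heat \<epsilon> h) x)"
proof -
  have \<sigma>: "0 \<le> \<sigma>" using lip by (rule lipschitz_on_nonneg)
  obtain B where B: "0 \<le> B" and step: "\<And>(h :: 'a \<Rightarrow> real) s x. \<sigma>-lipschitz_on UNIV h \<Longrightarrow> 0 < s \<Longrightarrow> s \<le> 1 \<Longrightarrow>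
    heat s (\<lambda>y. exp (heat \<epsilon> h y)) x \<le> (1 + s * \<sigma>\<^sup>2 / 2 + B * (s * sqrt s)) * exp (heat s (heat \<epsilon> h) x)"
    using heat_exp_step[OF \<open>0 < \<epsilon>\<close> \<sigma>] by metis
  let ?s = "\<lambda>n. inverse (real (Suc n))"
  have "heat 1 (\<lambda>y. exp (heat \<epsilon> h y)) x \<le> exp (\<sigma>\<^sup>2 / 2 + B * sqrt (?s n)) * exp (heat 1 (heat \<epsilon> h) x)" for n
  proof -
    define s where "s = ?s n"
    define \<rho> where "\<rho> = 1 + s * \<sigma>\<^sup>2 / 2 + B * (s * sqrt s)"
    have s: "0 < s" "s \<le> 1" "real (Suc n) * s = 1" by (auto simp: s_def field_simps)
    have \<rho>: "0 \<le> \<rho>" using s B by (simp add: \<rho>_def)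
    have "heat (real (Suc n) * s) (\<lambda>y. exp (heat \<epsilon> h y)) x \<le> \<rho> ^ Suc n * exp (heat (real (Suc n) * s) (heat \<epsilon> h) x)"
      by (rule heat_exp_iterate[OF \<open>0 < \<epsilon>\<close> s(1) \<rho> _ lip]) (use step s in \<open>simp add: \<rho>_def\<close>)
    then have "heat 1 (\<lambda>y. exp (heat \<epsilon> h y)) x \<le> \<rho> ^ Suc n * exp (heat 1 (heat \<epsilon> h) x)"
      unfolding s(3) .
    also have "\<rho> ^ Suc n \<le> exp (s * \<sigma>\<^sup>2 / 2 + B * (s * sqrt s)) ^ Suc n"
    proof (rule power_mono[OF _ \<rho>])
      show "\<rho> \<le> exp (s * \<sigma>\<^sup>2 / 2 + B * (s * sqrt s))"
        using exp_ge_add_one_self[of "s * \<sigma>\<^sup>2 / 2 + B * (s * sqrt s)"] unfolding \<rho>_def by linarith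
    qed
    also have "\<dots> = exp ((real (Suc n) * s) * (\<sigma>\<^sup>2 / 2 + B * sqrt s))"
      unfolding exp_of_nat_mult[symmetric] by (simp add: algebra_simps)
    also have "\<dots> = exp (\<sigma>\<^sup>2 / 2 + B * sqrt s)" unfolding s(3) by simp
    finally show ?thesis by (simp add: s_def mult_right_mono)
  qed
  moreover have "(\<lambda>n. exp (\<sigma>\<^sup>2 / 2 + B * sqrt (?s n)) * exp (heat 1 (heat \<epsilon> h) x)) \<longlonglongrightarrow> exp (\<sigma>\<^sup>2 / 2 + B * sqrt 0) * exp (heat 1 (heat \<epsilon> h) x)"
    by (intro tendsto_intros LIMSEQ_inverse_real_of_nat)
  ultimately show ?thesis
    using LIMSEQ_le_const[of _ "exp (\<sigma>\<^sup>2 / 2 + B * sqrt 0) * exp (heat 1 (heat \<epsilon> h) x)"] by fastforce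
qed

text \<open>Smoothing displaces both \<open>h\<close> and its mean by at most \<open>d\<close>,
  whence the two factors \<open>exp d\<close>, and \<open>d\<close> vanishes with
  \<open>\<epsilon>\<close>. The expectation is \<open>heat 1\<close> evaluated at the
  origin.\<close>

theorem std_gauss_exp_lipschitz:
  fixes h :: "'a::euclidean_space \<Rightarrow> real"
  assumes lip: "\<sigma>-lipschitz_on UNIV h"
  shows "(\<integral>z. exp (h z) \<partial>std_gauss) \<le> exp ((\<integral>z. h z \<partial>std_gauss) + \<sigma>\<^sup>2 / 2)"
proof -
  have \<sigma>: "0 \<le> \<sigma>" using lip by (rule lipschitz_on_nonneg)
  define m1 where "m1 = (\<integral>z. norm z \<partial>(std_gauss :: 'a measure))"
  note gr = exp_growth_lipschitz[OF lip]
  let ?d = "\<lambda>n. \<sigma> * sqrt (inverse (real (Suc n))) * m1"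
  have "heat 1 (\<lambda>y. exp (h y)) 0 \<le> exp (heat 1 h 0 + \<sigma>\<^sup>2 / 2 + 2 * ?d n)" for n
  proof -
    define \<epsilon> where "\<epsilon> = inverse (real (Suc n))"
    define d where "d = \<sigma> * sqrt \<epsilon> * m1"
    have \<epsilon>: "0 < \<epsilon>" by (simp add: \<epsilon>_def)
    have lipe: "\<sigma>-lipschitz_on UNIV (heat \<epsilon> h)" using \<epsilon> by (intro lipschitz_heat lip) simp
    note gre = exp_growth_lipschitz[OF lipe]
    have d: "\<bar>heat \<epsilon> h y - h y\<bar> \<le> d" for y
      using heat_diff_le[OF lip, of \<epsilon> y] \<epsilon> by (simp add: d_def m1_def)
    have "heat 1 (\<lambda>y. exp (h y)) 0 \<le> heat 1 (\<lambda>y. exp d * exp (heat \<epsilon> h y)) 0"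
    proof (rule heat_mono[OF gr(2) exp_growth_cmult[OF gre(2)]])
      show "exp (h y) \<le> exp d * exp (heat \<epsilon> h y)" for y
        using d[of y] by (simp add: mult_exp_exp)
    qed simp
    also have "\<dots> = exp d * heat 1 (\<lambda>y. exp (heat \<epsilon> h y)) 0" by (rule heat_cmult)
    also have "\<dots> \<le> exp d * (exp (\<sigma>\<^sup>2 / 2) * exp (heat 1 (heat \<epsilon> h) 0))"
      by (intro mult_left_mono heat_exp_le_smoothed \<epsilon> lip) simp
    also have "heat 1 (heat \<epsilon> h) 0 \<le> heat 1 h 0 + d"
    proof -
      have "heat 1 (heat \<epsilon> h) 0 = heat \<epsilon> (heat 1 h) 0"
        using gr \<epsilon> by (simp add: heat_semigroup add.commute)
      moreover have "\<bar>heat \<epsilon> (heat 1 h) 0 - heat 1 h 0\<bar> \<le> d"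
        using heat_diff_le[OF lipschitz_heat[OF lip], of 1 \<epsilon> 0] \<epsilon> by (simp add: d_def m1_def)
      ultimately show ?thesis by linarith
    qed
    finally have "heat 1 (\<lambda>y. exp (h y)) 0 \<le> exp d * (exp (\<sigma>\<^sup>2 / 2) * exp (heat 1 h 0 + d))" by simp
    then show ?thesis unfolding mult_exp_exp d_def[symmetric] \<epsilon>_def[symmetric] by (simp add: algebra_simps)
  qed
  moreover have "(\<lambda>n. exp (heat 1 h 0 + \<sigma>\<^sup>2 / 2 + 2 * ?d n)) \<longlonglongrightarrow> exp (heat 1 h 0 + \<sigma>\<^sup>2 / 2 + 2 * (\<sigma> * sqrt 0 * m1))"
    by (intro tendsto_intros LIMSEQ_inverse_real_of_nat)
  ultimately have "heat 1 (\<lambda>y. exp (h y)) 0 \<le> exp (heat 1 h 0 + \<sigma>\<^sup>2 / 2 + 2 * (\<sigma> * sqrt 0 * m1))"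
    using LIMSEQ_le_const by blast
  then show ?thesis by (simp add: heat_def)
qed

section \<open>Gaussian vectors and concentration\<close>

text \<open>Gives Dirac masses and proper normal laws one description, so that moments and
  characteristic functions are computed once for both.\<close>

lemma normal_law_eq_distr:
  assumes "0 \<le> v"
  shows "normal_law m v = distr std_normal_distribution borel (\<lambda>t. m + sqrt v * t)"
proof -
  interpret N: prob_space std_normal_distribution by (rule prob_space_normal_density) simp
  show ?thesis
  proof (cases "v = 0")
    case True
    have "distr std_normal_distribution borel (\<lambda>t. m) = return borel m"
    proof (rule measure_eqI)
      fix A :: "real set" assume "A \<in> sets (distr std_normal_distribution borel (\<lambda>t. m))"
      then have "A \<in> sets borel" by simp
      then show "emeasure (distr std_normal_distribution borel (\<lambda>t. m)) A = emeasure (return borel m) A"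
        using N.emeasure_space_1 by (cases "m \<in> A") (simp_all add: emeasure_distr)
    qed simp
    then show ?thesis using True by (simp add: normal_law_def)
  next
    case False
    then have v: "0 < v" using assms by simp
    have "distributed std_normal_distribution lborel (\<lambda>t. t) std_normal_density"
      by (simp add: distributed_def distr_id2)
    from N.normal_density_affine[OF this, of "sqrt v" m] v
    have "distributed std_normal_distribution lborel (\<lambda>t. m + sqrt v * t) (normal_density m (sqrt v))" by simp
    from distributed_distr_eq_density[OF this]
    have "distr std_normal_distribution lborel (\<lambda>t. m + sqrt v * t) = density lborel (\<lambda>x. ennreal (normal_density m (sqrt v) x))" .
    moreover have "distr std_normal_distribution lborel (\<lambda>t. m + sqrt v * t) = distr std_normal_distribution borel (\<lambda>t. m + sqrt v * t)"
      by (rule distr_cong) auto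
    ultimately show ?thesis using v by (simp add: normal_law_def)
  qed
qed

lemma normal_law_moments:
  assumes "0 \<le> v"
  shows "integrable (normal_law m v) (\<lambda>x. x)" "integrable (normal_law m v) (\<lambda>x. x\<^sup>2)"
    "(\<integral>x. x \<partial>normal_law m v) = m" "(\<integral>x. (x - m)\<^sup>2 \<partial>normal_law m v) = v"
    "(\<integral>x. iexp x \<partial>normal_law m v) = iexp m * complex_of_real (exp (- v / 2))"
proof -
  interpret N: prob_space std_normal_distribution by (rule prob_space_normal_density) simp
  have i: "integrable std_normal_distribution (\<lambda>t. t)" "integrable std_normal_distribution (\<lambda>t. t\<^sup>2)"
    using integrable_std_normal_distribution_moment[of 1] integrable_std_normal_distribution_moment[of 2] by simp_all
  have e: "(\<integral>t. t \<partial>std_normal_distribution) = 0" "(\<integral>t. t\<^sup>2 \<partial>std_normal_distribution) = 1"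
    using integral_std_normal_distribution_moment_odd[of 1] std_normal_distribution_even_moments(1)[of 1] by simp_all
  have c: "(\<integral>t. iexp (s * t) \<partial>std_normal_distribution) = complex_of_real (exp (- s\<^sup>2 / 2))" for s
    using fun_cong[OF char_std_normal_distribution, of s] by (simp add: char_def)
  show "integrable (normal_law m v) (\<lambda>x. x)"
    unfolding normal_law_eq_distr[OF assms] by (subst integrable_distr_eq) (auto intro!: i)
  have sq: "(m + sqrt v * t)\<^sup>2 = m\<^sup>2 + 2 * m * sqrt v * t + v * t\<^sup>2" for t
    using assms by (simp add: power2_sum power_mult_distrib)
  have "integrable std_normal_distribution (\<lambda>t. (m + sqrt v * t)\<^sup>2)"
    unfolding sq by (intro Bochner_Integration.integrable_add integrable_mult_right i N.integrable_const)
  then show "integrable (normal_law m v) (\<lambda>x. x\<^sup>2)"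
    unfolding normal_law_eq_distr[OF assms] by (subst integrable_distr_eq) auto
  have "(\<integral>x. x \<partial>normal_law m v) = (\<integral>t. m + sqrt v * t \<partial>std_normal_distribution)"
    unfolding normal_law_eq_distr[OF assms] by (subst integral_distr) auto
  also have "\<dots> = (\<integral>t. m \<partial>std_normal_distribution) + (\<integral>t. sqrt v * t \<partial>std_normal_distribution)"
    by (intro Bochner_Integration.integral_add integrable_mult_right i N.integrable_const)
  also have "\<dots> = m"
    by (simp only: integral_mult_right_zero e lebesgue_integral_const N.prob_space) simp
  finally show "(\<integral>x. x \<partial>normal_law m v) = m" .
  have "(\<integral>x. (x - m)\<^sup>2 \<partial>normal_law m v) = (\<integral>t. v * t\<^sup>2 \<partial>std_normal_distribution)"
    unfolding normal_law_eq_distr[OF assms] using assms by (subst integral_distr) (auto simp: power_mult_distrib)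
  then show "(\<integral>x. (x - m)\<^sup>2 \<partial>normal_law m v) = v"
    by (simp only: integral_mult_right_zero e mult_1_right)
  have "(\<integral>x. iexp x \<partial>normal_law m v) = (\<integral>t. iexp m * iexp (sqrt v * t) \<partial>std_normal_distribution)"
    unfolding normal_law_eq_distr[OF assms]
    by (subst integral_distr) (auto simp: mult_exp_exp algebra_simps)
  then show "(\<integral>x. iexp x \<partial>normal_law m v) = iexp m * complex_of_real (exp (- v / 2))"
    using assms by (simp only: integral_mult_right_zero c) simp
qed

section \<open>Identification of the law of a Gaussian vector\<close>

text \<open>The definition provides for each \<open>u\<close> merely some \<open>m\<close> and
  \<open>v\<close>. Normality of the functionals first yields integrability, without which the mean
  and covariance integrals could be default values; then \<open>m\<close> and \<open>v\<close> are
  computed from \<open>\<mu>\<close> and \<open>\<Sigma>\<close>.\<close>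

lemma has_normal_law_char_fun:
  assumes M: "prob_space M" and X: "has_normal_law M X \<mu> \<Sigma>"
  shows "char_fun (distr M borel X) u = iexp (u \<bullet> \<mu>) * complex_of_real (exp (- (u \<bullet> (\<Sigma> *v u)) / 2))"
proof -
  interpret M: prob_space M by fact
  have Xm [measurable]: "X \<in> borel_measurable M"
    and lawX: "\<And>u. \<exists>m v. 0 \<le> v \<and> distr M borel (\<lambda>\<omega>. u \<bullet> X \<omega>) = normal_law m v"
    and mean: "(\<integral>\<omega>. X \<omega> \<partial>M) = \<mu>" and cov: "covariance_matrix M X = \<Sigma>"
    using X by (auto simp: has_normal_law_def gaussian_vector_def)
  have int: "integrable M (\<lambda>\<omega>. u \<bullet> X \<omega>)" "integrable M (\<lambda>\<omega>. (u \<bullet> X \<omega>)\<^sup>2)" for u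
  proof -
    obtain m v where v: "0 \<le> v" "distr M borel (\<lambda>\<omega>. u \<bullet> X \<omega>) = normal_law m v" using lawX by blast
    show "integrable M (\<lambda>\<omega>. u \<bullet> X \<omega>)" "integrable M (\<lambda>\<omega>. (u \<bullet> X \<omega>)\<^sup>2)"
      using normal_law_moments(1,2)[OF v(1), of m] unfolding v(2)[symmetric]
      by (simp_all add: integrable_distr_eq)
  qed
  have comp: "axis i 1 \<bullet> X \<omega> = X \<omega> $ i" for i \<omega> by (simp add: inner_axis' )
  have intX: "integrable M X"
  proof -
    have "integrable M (\<lambda>\<omega>. \<Sum>b\<in>Basis. (b \<bullet> X \<omega>) *\<^sub>R b)"
      by (intro Bochner_Integration.integrable_sum integrable_scaleR_left int)
    then show ?thesis by (simp add: inner_commute[of _ "X _"] euclidean_representation)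
  qed
  have mean_i: "(\<integral>\<omega>. X \<omega> $ i \<partial>M) = \<mu> $ i" for i
    using integral_inner_right[OF intX, of "axis i 1"] by (simp add: comp mean inner_axis')
  obtain m v where v: "0 \<le> v" "distr M borel (\<lambda>\<omega>. u \<bullet> X \<omega>) = normal_law m v" using lawX by blast
  have m: "m = u \<bullet> \<mu>"
  proof -
    have "m = (\<integral>\<omega>. u \<bullet> X \<omega> \<partial>M)"
      using normal_law_moments(3)[OF v(1), of m] unfolding v(2)[symmetric] by (simp add: integral_distr)
    also have "\<dots> = u \<bullet> \<mu>" using integral_inner_right[OF intX] mean by simp
    finally show ?thesis .
  qed
  \<comment> \<open>Allows the double sum of the quadratic form to be exchanged with the integral;
    products are dominated by sums of squares.\<close>
  have cij: "integrable M (\<lambda>\<omega>. (X \<omega> $ i - \<mu> $ i) * (X \<omega> $ j - \<mu> $ j))" for i j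
  proof (rule Bochner_Integration.integrable_bound)
    have sq: "integrable M (\<lambda>\<omega>. (X \<omega> $ i - \<mu> $ i)\<^sup>2)" for i
      using int[of "axis i 1"] unfolding comp by (auto simp: power2_diff)
    show "integrable M (\<lambda>\<omega>. (X \<omega> $ i - \<mu> $ i)\<^sup>2 + (X \<omega> $ j - \<mu> $ j)\<^sup>2)"
      by (intro Bochner_Integration.integrable_add sq)
    have "\<bar>a * b\<bar> \<le> a\<^sup>2 + b\<^sup>2" for a b :: real
    proof -
      have "2 * (\<bar>a\<bar> * \<bar>b\<bar>) \<le> a\<^sup>2 + b\<^sup>2" using sum_squares_bound[of "\<bar>a\<bar>" "\<bar>b\<bar>"] by (simp add: mult.assoc)
      then show ?thesis unfolding abs_mult using mult_nonneg_nonneg[OF abs_ge_zero[of a] abs_ge_zero[of b]] by linarith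
    qed
    then show "AE \<omega> in M. norm ((X \<omega> $ i - \<mu> $ i) * (X \<omega> $ j - \<mu> $ j)) \<le> norm ((X \<omega> $ i - \<mu> $ i)\<^sup>2 + (X \<omega> $ j - \<mu> $ j)\<^sup>2)"
      by (intro AE_I2) simp
    show "(\<lambda>\<omega>. (X \<omega> $ i - \<mu> $ i) * (X \<omega> $ j - \<mu> $ j)) \<in> borel_measurable M"
      unfolding comp[symmetric] by measurable
  qed
  have "v = u \<bullet> (\<Sigma> *v u)"
  proof -
    have "v = (\<integral>\<omega>. (u \<bullet> X \<omega> - u \<bullet> \<mu>)\<^sup>2 \<partial>M)"
      using normal_law_moments(4)[OF v(1), of m] unfolding v(2)[symmetric] by (simp add: integral_distr m)
    also have "\<dots> = (\<integral>\<omega>. (\<Sum>i\<in>UNIV. \<Sum>j\<in>UNIV. u $ i * u $ j * ((X \<omega> $ i - \<mu> $ i) * (X \<omega> $ j - \<mu> $ j))) \<partial>M)"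
    proof (rule Bochner_Integration.integral_cong)
      fix \<omega>
      have "u \<bullet> X \<omega> - u \<bullet> \<mu> = (\<Sum>i\<in>UNIV. u $ i * (X \<omega> $ i - \<mu> $ i))"
        by (simp add: inner_vec_def right_diff_distrib sum_subtractf)
      then show "(u \<bullet> X \<omega> - u \<bullet> \<mu>)\<^sup>2 = (\<Sum>i\<in>UNIV. \<Sum>j\<in>UNIV. u $ i * u $ j * ((X \<omega> $ i - \<mu> $ i) * (X \<omega> $ j - \<mu> $ j)))"
        by (simp add: power2_eq_square sum_product mult_ac)
    qed simp
    also have "\<dots> = (\<Sum>i\<in>UNIV. \<Sum>j\<in>UNIV. u $ i * u $ j * \<Sigma> $ i $ j)"
      using cij by (simp add: Bochner_Integration.integral_sum Bochner_Integration.integrable_sum cov[symmetric] covariance_matrix_def mean_i)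
    also have "\<dots> = u \<bullet> (\<Sigma> *v u)"
      by (simp add: inner_vec_def matrix_vector_mult_def sum_distrib_left mult_ac)
    finally show ?thesis .
  qed
  moreover have "char_fun (distr M borel X) u = (\<integral>x. iexp x \<partial>distr M borel (\<lambda>\<omega>. u \<bullet> X \<omega>))"
    unfolding char_fun_def by (simp add: integral_distr)
  ultimately show ?thesis using normal_law_moments(5)[OF v(1)] v(2) m by simp
qed

text \<open>Both characteristic functions are determined by \<open>u \<bullet> \<mu>\<close> and
  \<open>u \<bullet> (\<Sigma> *v u)\<close>, whether or not \<open>\<Sigma>\<close> is
  invertible.\<close>

lemma distr_has_normal_law:
  assumes M: "prob_space M" and \<Sigma>: "pos_semidef \<Sigma>" and X: "has_normal_law M X \<mu> \<Sigma>"
  shows "distr M borel X = distr std_gauss borel (\<lambda>z. \<mu> + psd_sqrt \<Sigma> *v z)"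
proof (rule measure_eq_if_char_fun_eq)
  interpret M: prob_space M by fact
  have [measurable]: "X \<in> borel_measurable M" using X by (simp add: has_normal_law_def gaussian_vector_def)
  have [measurable]: "(\<lambda>z. \<mu> + psd_sqrt \<Sigma> *v z) \<in> borel_measurable borel"
    by (intro borel_measurable_continuous_onI continuous_intros)
  show "prob_space (distr M borel X)" by (rule M.prob_space_distr) measurable
  show "prob_space (distr std_gauss borel (\<lambda>z. \<mu> + psd_sqrt \<Sigma> *v z))" by (rule std_gauss.prob_space_distr) simp
  fix u
  have "char_fun (distr std_gauss borel (\<lambda>z. \<mu> + psd_sqrt \<Sigma> *v z)) u =
      (\<integral>z. iexp (u \<bullet> \<mu>) * iexp ((psd_sqrt \<Sigma> *v u) \<bullet> z) \<partial>std_gauss)"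
    unfolding char_fun_def by (subst integral_distr)
      (auto simp: inner_add_right mult_exp_exp pos_semidef_dot[OF psd_sqrt(1)[OF \<Sigma>]] algebra_simps)
  also have "\<dots> = iexp (u \<bullet> \<mu>) * complex_of_real (exp (- (u \<bullet> (\<Sigma> *v u)) / 2))"
    by (simp only: integral_mult_right_zero char_std_gauss norm_psd_sqrt_mult[OF \<Sigma>])
  finally show "char_fun (distr M borel X) u = char_fun (distr std_gauss borel (\<lambda>z. \<mu> + psd_sqrt \<Sigma> *v z)) u"
    using has_normal_law_char_fun[OF M X] by simp
qed auto

section \<open>Gradients and the supremum\<close>

text \<open>The derivative is represented by exactly one vector, which gives the \<open>THE\<close>
  in \<open>gradient\<close> its meaning.\<close>

lemma has_derivative_gradient:
  fixes f :: "real^'n \<Rightarrow> real"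
  assumes "f differentiable (at y)"
  shows "(f has_derivative (\<lambda>h. h \<bullet> gradient f y)) (at y)"
proof -
  obtain f' where f': "(f has_derivative f') (at y)" using assms by (auto simp: differentiable_def)
  then have lin: "linear f'" using has_derivative_linear by blast
  define g where "g = (\<Sum>b\<in>Basis. f' b *\<^sub>R b)"
  have f'g: "f' h = h \<bullet> g" for h
  proof -
    have "f' h = f' (\<Sum>b\<in>Basis. (h \<bullet> b) *\<^sub>R b)" by (simp add: euclidean_representation)
    also have "\<dots> = (\<Sum>b\<in>Basis. (h \<bullet> b) * f' b)" using lin by (simp add: linear_sum linear_cmul)
    finally show ?thesis by (simp add: g_def inner_sum_right mult.commute)
  qed
  have "GDERIV f y :> g" using f' f'g unfolding gderiv_def by (metis (no_types, lifting) ext)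
  moreover have "g' = g" if "GDERIV f y :> g'" for g'
  proof -
    have "(\<lambda>h. h \<bullet> g') = f'" using that f' unfolding gderiv_def by (rule has_derivative_unique)
    then have "g' \<bullet> (g' - g) = 0" "g \<bullet> (g' - g) = 0"
      using f'g by (metis inner_commute inner_diff_right right_minus_eq)+
    then have "(g' - g) \<bullet> (g' - g) = 0" by (simp add: inner_diff_left)
    then show ?thesis by simp
  qed
  ultimately have "gradient f y = g" unfolding gradient_def by (rule the_equality)
  then show ?thesis using \<open>GDERIV f y :> g\<close> by (simp add: gderiv_def)
qed

text \<open>Move along the gradient itself: up to an error \<open>e\<close>, the growth per unit
  length there equals the norm of the gradient.\<close>

lemma norm_gradient_le:
  fixes f :: "real^'n \<Rightarrow> real"
  assumes lip: "L-lipschitz_on UNIV f" and "f differentiable (at y)"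
  shows "norm (gradient f y) \<le> L"
proof (rule field_le_epsilon)
  fix e :: real assume "0 < e"
  let ?g = "gradient f y"
  obtain d where d: "0 < d" "\<And>x. norm (x - y) < d \<Longrightarrow> norm (f x - f y - (x - y) \<bullet> ?g) \<le> e * norm (x - y)"
    using has_derivative_gradient[OF assms(2)] \<open>0 < e\<close> unfolding has_derivative_at_alt by blast
  show "norm ?g \<le> L + e"
  proof (cases "?g = 0")
    case False
    define t where "t = d / (2 * norm ?g)"
    have t: "0 < t" "t * norm ?g < d" using False d by (auto simp: t_def)
    have "t * (norm ?g)\<^sup>2 \<le> (L + e) * (t * norm ?g)"
    proof -
      have "\<bar>f (y + t *\<^sub>R ?g) - f y - t * (norm ?g)\<^sup>2\<bar> \<le> e * (t * norm ?g)"
        using d(2)[of "y + t *\<^sub>R ?g"] t by (simp add: power2_norm_eq_inner)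
      moreover have "\<bar>f (y + t *\<^sub>R ?g) - f y\<bar> \<le> L * (t * norm ?g)"
        using abs_diff_le_if_lipschitz[OF lip, of "y + t *\<^sub>R ?g" y] t by simp
      ultimately show ?thesis by (simp add: distrib_right abs_le_iff)
    qed
    then have "(t * norm ?g) * norm ?g \<le> (t * norm ?g) * (L + e)"
      by (simp only: power2_eq_square mult_ac)
    moreover have "0 < t * norm ?g" using t False by simp
    ultimately show ?thesis by (simp only: mult_le_cancel_left_pos)
  qed (use lipschitz_on_nonneg[OF lip] \<open>0 < e\<close> in simp)
qed

text \<open>A real supremum dominates its members once the set is bounded above; here the Lipschitz
  constant and an operator bound for the root provide this.\<close>

lemma gradient_quadratic_le_sup:
  fixes f :: "real^'n \<Rightarrow> real"
  assumes lip: "L-lipschitz_on UNIV f" and y: "f differentiable (at y)"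
  shows "(norm (psd_sqrt \<Sigma> *v gradient f y))\<^sup>2 \<le> sup_sqrt_gradient_sq \<Sigma> f"
  unfolding sup_sqrt_gradient_sq_def
proof (rule cSUP_upper)
  have "bounded_linear ((*v) (psd_sqrt \<Sigma>))" by simp
  from bounded_linear.pos_bounded[OF this]
  obtain K where K: "0 < K" "\<And>x. norm (psd_sqrt \<Sigma> *v x) \<le> norm x * K" by blast
  show "bdd_above ((\<lambda>y. (norm (psd_sqrt \<Sigma> *v gradient f y))\<^sup>2) ` {y. f differentiable at y})"
  proof (rule bdd_aboveI2)
    fix y assume "y \<in> {y. f differentiable at y}"
    then have "norm (gradient f y) * K \<le> L * K" using norm_gradient_le[OF lip] K by (intro mult_right_mono) auto
    then have "norm (psd_sqrt \<Sigma> *v gradient f y) \<le> L * K" by (rule order_trans[OF K(2)])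
    then show "(norm (psd_sqrt \<Sigma> *v gradient f y))\<^sup>2 \<le> (L * K)\<^sup>2" by (intro power_mono) auto
  qed
qed (use y in simp)

text \<open>The supremum over an empty set would carry no information, so a point of
  differentiability has to be produced first.\<close>

lemma sup_sqrt_gradient_sq_nonneg:
  fixes f :: "real^'n \<Rightarrow> real"
  assumes lip: "L-lipschitz_on UNIV f"
  shows "0 \<le> sup_sqrt_gradient_sq \<Sigma> f"
proof -
  have "\<exists>y. f differentiable (at y)"
  proof (rule ccontr)
    assume "\<nexists>y. f differentiable (at y)"
    \<comment> \<open>Without points of differentiability the derivative hypothesis is vacuous for
      every \<open>c\<close>; the zero increment with \<open>c = -1\<close> is then absurd.\<close>
    then have "f (0 + 0) - f 0 \<le> -1"
      by (intro lipschitz_increment_le[OF lip]) (auto simp: differentiable_def)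
    then show False by simp
  qed
  then obtain y where "f differentiable (at y)" by blast
  from gradient_quadratic_le_sup[OF lip this] show ?thesis by (rule order_trans[rotated]) simp
qed

text \<open>Symmetry of the root \<open>S\<close> moves it from the direction \<open>S w\<close>
  onto the gradient, and Cauchy-Schwarz brings in the supremum. The increment bound is applied to
  \<open>f\<close> in direction \<open>S w\<close>, because \<open>f\<close> may fail to be
  differentiable at the points \<open>\<mu> + S z\<close> where a chain rule would be
  evaluated.\<close>

lemma lipschitz_compose_psd_sqrt:
  fixes f :: "real^'n \<Rightarrow> real"
  assumes \<Sigma>: "pos_semidef \<Sigma>" and lip: "L-lipschitz_on UNIV f"
  shows "(sqrt (sup_sqrt_gradient_sq \<Sigma> f))-lipschitz_on UNIV (\<lambda>z. f (\<mu> + psd_sqrt \<Sigma> *v z))"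
proof (rule lipschitz_onI)
  let ?\<sigma> = "sqrt (sup_sqrt_gradient_sq \<Sigma> f)"
  show "0 \<le> ?\<sigma>" using sup_sqrt_gradient_sq_nonneg[OF lip] by simp
  have le: "f (y + psd_sqrt \<Sigma> *v w) - f y \<le> ?\<sigma> * norm w" for y w
  proof (rule lipschitz_increment_le[OF lip])
    fix x f' assume f': "(f has_derivative f') (at x)"
    then have d: "f differentiable (at x)" by (auto simp: differentiable_def)
    have "f' = (\<lambda>h. h \<bullet> gradient f x)" using f' has_derivative_gradient[OF d] by (rule has_derivative_unique)
    then have "f' (psd_sqrt \<Sigma> *v w) = w \<bullet> (psd_sqrt \<Sigma> *v gradient f x)"
      by (simp add: pos_semidef_dot[OF psd_sqrt(1)[OF \<Sigma>]])
    also have "\<dots> \<le> norm w * norm (psd_sqrt \<Sigma> *v gradient f x)" by (rule norm_cauchy_schwarz)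
    finally have w: "f' (psd_sqrt \<Sigma> *v w) \<le> norm w * norm (psd_sqrt \<Sigma> *v gradient f x)" .
    have "norm (psd_sqrt \<Sigma> *v gradient f x) \<le> ?\<sigma>"
      using gradient_quadratic_le_sup[OF lip d] by (rule real_le_rsqrt)
    then have "norm w * norm (psd_sqrt \<Sigma> *v gradient f x) \<le> norm w * ?\<sigma>" by (rule mult_left_mono) simp
    with w show "f' (psd_sqrt \<Sigma> *v w) \<le> ?\<sigma> * norm w" by (simp only: mult.commute)
  qed
  fix a b
  show "dist (f (\<mu> + psd_sqrt \<Sigma> *v a)) (f (\<mu> + psd_sqrt \<Sigma> *v b)) \<le> ?\<sigma> * dist a b"
    using le[of "\<mu> + psd_sqrt \<Sigma> *v a" "b - a"] le[of "\<mu> + psd_sqrt \<Sigma> *v b" "a - b"]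
    by (simp add: dist_real_def dist_norm matrix_vector_mult_diff_distrib norm_minus_commute abs_le_iff)
qed

section \<open>The tail bound\<close>

lemma std_gauss_concentration:
  fixes h :: "'a::euclidean_space \<Rightarrow> real"
  assumes lip: "\<sigma>-lipschitz_on UNIV h" and "0 < \<sigma>" "0 < x"
  shows "measure std_gauss {z. h z - (\<integral>z. h z \<partial>std_gauss) \<ge> x} \<le> exp (- (x\<^sup>2 / (2 * \<sigma>\<^sup>2)))"
proof -
  \<comment> \<open>The minimiser of the Chernoff exponent
    \<open>- t * x + (t * \<sigma>)\<^sup>2 / 2\<close>.\<close>
  define t where "t = x / \<sigma>\<^sup>2"
  have t: "0 < t" using assms by (simp add: t_def)
  define m where "m = (\<integral>z. h z \<partial>std_gauss)"
  have lipt: "(t * \<sigma>)-lipschitz_on UNIV (\<lambda>z. t * h z)"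
  proof (rule lipschitz_onI)
    show "dist (t * h a) (t * h b) \<le> t * \<sigma> * dist a b" for a b
      using mult_left_mono[OF lipschitz_onD[OF lip, of a b], of t] t
      by (simp add: dist_real_def abs_mult right_diff_distrib[symmetric] mult.assoc)
  qed (use t assms in simp)
  have "set_integrable std_gauss UNIV (\<lambda>z. exp (t * h z))"
    using exp_growth_integrable[OF exp_growth_lipschitz(2)[OF lipt], of 1 0] by (simp add: set_integrable_def)
  from std_gauss.Chernoff_ineq_ge[OF t this, of "m + x"]
  have "measure std_gauss {z. h z \<ge> m + x} \<le> exp (- t * (m + x)) * (\<integral>z. exp (t * h z) \<partial>std_gauss)"
    by (simp add: set_lebesgue_integral_def)
  also have "\<dots> \<le> exp (- t * (m + x)) * exp (t * m + (t * \<sigma>)\<^sup>2 / 2)"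
    using std_gauss_exp_lipschitz[OF lipt] by (intro mult_left_mono) (auto simp: m_def)
  also have "\<dots> = exp (- t * x + (t * \<sigma>)\<^sup>2 / 2)" by (simp add: mult_exp_exp algebra_simps)
  also have "- t * x + (t * \<sigma>)\<^sup>2 / 2 = - (x\<^sup>2 / (2 * \<sigma>\<^sup>2))"
    using \<open>0 < \<sigma>\<close> by (simp add: t_def field_simps power2_eq_square)
  finally show ?thesis by (simp add: m_def algebra_simps)
qed

theorem mainTheorem1:
  fixes M :: "'a measure"
    and X :: "'a \<Rightarrow> real^'n"
    and \<mu> :: "real^'n"
    and \<Sigma> :: "real^'n^'n"
    and f :: "real^'n \<Rightarrow> real"
  assumes "prob_space M"
    and "pos_semidef \<Sigma>"
    and "has_normal_law M X \<mu> \<Sigma>"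
    and "\<exists>L. L-lipschitz_on UNIV f"
  shows "sup_sqrt_gradient_sq \<Sigma> f =
           (SUP y\<in>{y. f differentiable (at y)}. gradient f y \<bullet> (\<Sigma> *v gradient f y)) \<and>
         (\<forall>x>0. measure M {\<omega> \<in> space M. f (X \<omega>) - (\<integral>\<omega>'. f (X \<omega>') \<partial>M) \<ge> x} \<le>
           (if sup_sqrt_gradient_sq \<Sigma> f = 0 then 0
            else exp (- (x\<^sup>2 / (2 * sup_sqrt_gradient_sq \<Sigma> f)))))"
proof (intro conjI allI impI)
  show "sup_sqrt_gradient_sq \<Sigma> f =
      (SUP y\<in>{y. f differentiable (at y)}. gradient f y \<bullet> (\<Sigma> *v gradient f y))"
    unfolding sup_sqrt_gradient_sq_def norm_psd_sqrt_mult[OF assms(2)] ..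
  fix x :: real assume "0 < x"
  obtain L where lip: "L-lipschitz_on UNIV f" using assms(4) by blast
  have [measurable]: "f \<in> borel_measurable borel"
    by (rule borel_measurable_continuous_onI[OF lipschitz_on_continuous_on[OF lip]])
  have [measurable]: "X \<in> borel_measurable M" using assms(3) by (simp add: has_normal_law_def gaussian_vector_def)
  have [measurable]: "(\<lambda>z. \<mu> + psd_sqrt \<Sigma> *v z) \<in> borel_measurable borel"
    by (intro borel_measurable_continuous_onI continuous_intros)
  note law = distr_has_normal_law[OF assms(1-3)]
  define h where "h z = f (\<mu> + psd_sqrt \<Sigma> *v z)" for z
  let ?s = "sup_sqrt_gradient_sq \<Sigma> f"
  have s0: "0 \<le> ?s" by (rule sup_sqrt_gradient_sq_nonneg[OF lip])
  have liph: "(sqrt ?s)-lipschitz_on UNIV h"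
    unfolding h_def by (rule lipschitz_compose_psd_sqrt[OF assms(2) lip])
  have mean: "(\<integral>\<omega>. f (X \<omega>) \<partial>M) = (\<integral>z. h z \<partial>std_gauss)"
  proof -
    have "(\<integral>\<omega>. f (X \<omega>) \<partial>M) = (\<integral>y. f y \<partial>distr M borel X)" by (simp add: integral_distr)
    also have "\<dots> = (\<integral>z. h z \<partial>std_gauss)" unfolding law h_def by (simp add: integral_distr)
    finally show ?thesis .
  qed
  have prob: "measure M {\<omega> \<in> space M. f (X \<omega>) - c \<ge> x} = measure std_gauss {z. h z - c \<ge> x}" for c
  proof -
    have "measure M {\<omega> \<in> space M. f (X \<omega>) - c \<ge> x} = measure (distr M borel X) {y. f y - c \<ge> x}"
      by (subst measure_distr) (auto intro!: arg_cong[where f = "measure M"])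
    also have "\<dots> = measure std_gauss {z. h z - c \<ge> x}"
      unfolding law by (subst measure_distr) (auto simp: h_def intro!: arg_cong[where f = "measure std_gauss"])
    finally show ?thesis .
  qed
  show "measure M {\<omega> \<in> space M. f (X \<omega>) - (\<integral>\<omega>'. f (X \<omega>') \<partial>M) \<ge> x} \<le>
      (if ?s = 0 then 0 else exp (- (x\<^sup>2 / (2 * ?s))))"
  proof (cases "?s = 0")
    case True
    \<comment> \<open>A vanishing Lipschitz constant makes \<open>h\<close> constant, and the event
      is empty because \<open>x > 0\<close>. The exponential formula would read
      \<open>exp 0 = 1\<close> here, as division by zero yields zero.\<close>
    then have "h z = h 0" for z using abs_diff_le_if_lipschitz[OF liph, of z 0] by simp
    then obtain c where "\<And>z. h z = c" by metis
    then have "{z. h z - (\<integral>z. h z \<partial>std_gauss) \<ge> x} = {}"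
      using \<open>0 < x\<close> by (simp add: std_gauss.prob_space[simplified])
    then show ?thesis unfolding mean prob using True by simp
  next
    case False
    then have "0 < sqrt ?s" using s0 by simp
    from std_gauss_concentration[OF liph this \<open>0 < x\<close>] show ?thesis
      unfolding mean prob using False s0 by simp
  qed
qed

end
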